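(* Let $S$ be a finitely-generated semigroup. Then at least one of the following holds: (i) $S$ is elementary; (ii) $S$ is semidiscrete; (iii) $S$ is contained in $\mathcal{M}(J)$ for some closed interval $J$, and either $S$ is exceptional or $S\cap\mathcal{M}_0(J)$ is dense in $\mathcal{M}_0(J)$; (iv) $S$ is dense in $\mathcal{M}$.
   Context: $\mathbb{H}$ is the upper half-plane, $\overline{\mathbb{R}}=\mathbb{R}\cup\{\infty\}$, $\overline{\mathbb{H}}=\mathbb{H}\cup\overline{\mathbb{R}}$. $\mathcal{M}\cong\mathrm{PSL}(2,\mathbb{R})$ is the topological group of real Möbius transformations $z\mapsto (az+b)/(cz+d)$ ($a,b,c,d\in\mathbb{R}$, $ad-bc>0$), with identity $I$. A semigroup is a nonempty subset of $\mathcal{M}$ closed under composition; it is finitely generated if there is a finite subset of it such that every element is a finite composition of elements of that subset. $S$ is elementary if it has a finite orbit in its action on $\overline{\mathbb{H}}$. $S$ is semidiscrete if $I$ is not an accumulation point of $S$ in $\mathcal{M}$. A closed interval is a closed interval in the circle $\overline{\mathbb{R}}$ that is neither a singleton nor all of $\overline{\mathbb{R}}$. For a closed interval $J$, $\mathcal{M}(J)=\{h\in\mathcal{M}:h(J)\subset J\}$ and $\mathcal{M}_0(J)=\{h\in\mathcal{M}:h(J)=J\}$, the group part of $\mathcal{M}(J)$. A semigroup $S$ is exceptional if there is a closed interval $J$ such that $S\subset\mathcal{M}(J)$, the elements $h\in S$ with $h(J)=J$ form a nontrivial discrete group, and some element of $S$ outside this discrete group fixes one of the end points of $J$. *)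

theory Defs
  imports "HOL-Analysis.Analysis" "HOL-Algebra.Group"
begin

text \<open>
  The Riemann sphere is \<open>complex option\<close> and the circle of extended reals is \<open>real option\<close>; in both,
  \<open>None\<close> is the point at infinity.
\<close>

definition mob_fun :: "real \<Rightarrow> real \<Rightarrow> real \<Rightarrow> real \<Rightarrow> complex option \<Rightarrow> complex option" where
  "mob_fun a b c d w =
     (case w of
        None \<Rightarrow> if c = 0 then None else Some (complex_of_real (a / c))
      | Some z \<Rightarrow>
          if complex_of_real c * z + complex_of_real d = 0 then None
          else Some ((complex_of_real a * z + complex_of_real b) /
                     (complex_of_real c * z + complex_of_real d)))"

typedef mobius = "{f. \<exists>a b c d. a * d - b * c > 0 \<and> f = mob_fun a b c d}"
  morphisms act Abs_mobius
proof -
  have "(1::real) * 1 - 0 * 0 > 0" by simp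
  then show ?thesis by blast
qed

text \<open>\<open>mob a b c d\<close> is unspecified unless \<open>a * d - b * c > 0\<close>.\<close>

definition mob :: "real \<Rightarrow> real \<Rightarrow> real \<Rightarrow> real \<Rightarrow> mobius" where
  "mob a b c d = Abs_mobius (mob_fun a b c d)"

lemma act_mob: "a * d - b * c > 0 \<Longrightarrow> act (mob a b c d) = mob_fun a b c d"
  unfolding mob_def by (rule Abs_mobius_inverse) blast

lemma mobius_cases:
  obtains a b c d where "a * d - b * c > 0" "h = mob a b c d"
proof -
  obtain a b c d where *: "a * d - b * c > 0" "act h = mob_fun a b c d"
    using act[of h] by blast
  then have "h = mob a b c d"
    unfolding mob_def by (metis act_inverse)
  with * that show thesis by blast
qed

lemma mob_fun_id: "t \<noteq> 0 \<Longrightarrow> mob_fun t 0 0 t = id"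
  by (rule ext) (simp add: mob_fun_def split: option.split)

lemma mob_fun_comp:
  assumes "a * d - b * c > 0" and "a' * d' - b' * c' > 0"
  shows "mob_fun a b c d \<circ> mob_fun a' b' c' d' =
    mob_fun (a * a' + b * c') (a * b' + b * d') (c * a' + d * c') (c * b' + d * d')"
proof
  fix w
  show "(mob_fun a b c d \<circ> mob_fun a' b' c' d') w =
    mob_fun (a * a' + b * c') (a * b' + b * d') (c * a' + d * c') (c * b' + d * d') w"
  proof (cases w)
    case None
    show ?thesis
    proof (cases "c' = 0")
      case True
      then have "a' \<noteq> 0" using assms(2) by auto
      with None True show ?thesis by (simp add: mob_fun_def)
    next
      case False
      have "complex_of_real c * (of_real a' / of_real c') + of_real d
          = of_real ((c * a' + d * c') / c')"
        using False by (simp add: field_simps)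
      moreover have "complex_of_real a * (of_real a' / of_real c') + of_real b
          = of_real ((a * a' + b * c') / c')"
        using False by (simp add: field_simps)
      ultimately show ?thesis using None False
        by (simp add: mob_fun_def del: of_real_add of_real_mult)
    qed
  next
    case (Some z)
    define p where "p = complex_of_real a' * z + of_real b'"
    define q where "q = complex_of_real c' * z + of_real d'"
    have num: "of_real (a * a' + b * c') * z + of_real (a * b' + b * d')
        = complex_of_real a * p + of_real b * q"
      by (simp add: p_def q_def algebra_simps)
    have den: "of_real (c * a' + d * c') * z + of_real (c * b' + d * d')
        = complex_of_real c * p + of_real d * q"
      by (simp add: p_def q_def algebra_simps)
    have lhs1: "mob_fun a' b' c' d' w = (if q = 0 then None else Some (p / q))"
      by (simp add: mob_fun_def Some p_def q_def)
    have rhs: "mob_fun (a * a' + b * c') (a * b' + b * d') (c * a' + d * c') (c * b' + d * d') w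
      = (if of_real c * p + of_real d * q = 0 then None
         else Some ((of_real a * p + of_real b * q) / (of_real c * p + of_real d * q)))"
      unfolding mob_fun_def Some option.case num den ..
    show ?thesis
    proof (cases "q = 0")
      case True
      have "p \<noteq> 0"
      proof
        assume "p = 0"
        have "of_real a' * q - of_real c' * p = complex_of_real (a' * d' - b' * c')"
          by (simp add: p_def q_def algebra_simps)
        with \<open>p = 0\<close> True assms(2) show False
          by (metis diff_self less_irrefl mult_zero_right of_real_eq_0_iff)
      qed
      with True show ?thesis
        unfolding comp_def lhs1 rhs by (simp add: mob_fun_def)
    next
      case False
      have "complex_of_real c * (p / q) + of_real d = (of_real c * p + of_real d * q) / q"
        and "complex_of_real a * (p / q) + of_real b = (of_real a * p + of_real b * q) / q"
        using False by (simp_all add: field_simps)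
      with False show ?thesis
        unfolding comp_def lhs1 rhs by (simp add: mob_fun_def)
    qed
  qed
qed

lemma det_comp:
  fixes a :: real
  assumes "a * d - b * c > 0" and "a' * d' - b' * c' > 0"
  shows "(a * a' + b * c') * (c * b' + d * d') - (a * b' + b * d') * (c * a' + d * c') > 0"
proof -
  have "(a * a' + b * c') * (c * b' + d * d') - (a * b' + b * d') * (c * a' + d * c')
      = (a * d - b * c) * (a' * d' - b' * c')"
    by (simp add: algebra_simps)
  then show ?thesis using assms by simp
qed

instantiation mobius :: monoid_mult
begin

definition "1 = Abs_mobius id"

definition "g * h = Abs_mobius (act g \<circ> act h)"

lemma act_one_aux: "act 1 = id"
proof -
  have "(1::real) * 1 - 0 * 0 > 0" by simp
  moreover have "id = mob_fun 1 0 0 1" using mob_fun_id[of 1] by simp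
  ultimately show ?thesis
    unfolding one_mobius_def by (intro Abs_mobius_inverse) blast
qed

lemma act_mult_aux: "act (g * h) = act g \<circ> act h"
proof -
  obtain a b c d where g: "a * d - b * c > 0" "act g = mob_fun a b c d"
    using act[of g] by blast
  obtain a' b' c' d' where h: "a' * d' - b' * c' > 0" "act h = mob_fun a' b' c' d'"
    using act[of h] by blast
  show ?thesis
    unfolding times_mobius_def
    by (rule Abs_mobius_inverse) (use g h mob_fun_comp[OF g(1) h(1)] det_comp[OF g(1) h(1)] in auto)
qed

instance
  by standard (simp_all add: act_inject[symmetric] act_one_aux act_mult_aux comp_assoc)

end

lemma act_one [simp]: "act 1 = id"
  by (rule act_one_aux)

lemma act_mult [simp]: "act (g * h) = act g \<circ> act h"
  by (rule act_mult_aux)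

text \<open>
  The topology of \<open>PSL(2, \<real>)\<close>: the quotient topology from the open set of coefficient quadruples
  of positive determinant in \<open>\<real>\<^sup>4\<close>.
\<close>

instantiation mobius :: topological_space
begin

definition
  "open (U :: mobius set) \<longleftrightarrow>
     open {(a, b, c, d). a * d - b * c > 0 \<and> mob a b c d \<in> U}"

instance
proof
  have "{(a, b, c, d). a * d - b * c > 0 \<and> mob a b c d \<in> UNIV}
      = {x :: real \<times> real \<times> real \<times> real.
          0 < fst x * snd (snd (snd x)) - fst (snd x) * fst (snd (snd x))}"
    by auto
  also have "open \<dots>"
    by (intro open_Collect_less continuous_intros)
  finally show "open (UNIV :: mobius set)"
    unfolding open_mobius_def .
next
  fix U V :: "mobius set"
  assume "open U" "open V"
  then have "open ({(a, b, c, d). a * d - b * c > 0 \<and> mob a b c d \<in> U}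
      \<inter> {(a, b, c, d). a * d - b * c > 0 \<and> mob a b c d \<in> V})"
    unfolding open_mobius_def by (rule open_Int)
  also have "\<dots> = {(a, b, c, d). a * d - b * c > 0 \<and> mob a b c d \<in> U \<inter> V}"
    by auto
  finally show "open (U \<inter> V)"
    unfolding open_mobius_def .
next
  fix K :: "mobius set set"
  assume "\<forall>U\<in>K. open U"
  then have "open (\<Union>U\<in>K. {(a, b, c, d).
      a * d - b * c > 0 \<and> mob a b c d \<in> U})"
    unfolding open_mobius_def by (intro open_UN) blast
  also have "\<dots> = {(a, b, c, d). a * d - b * c > 0 \<and> mob a b c d \<in> \<Union>K}"
    by auto
  finally show "open (\<Union>K)"
    unfolding open_mobius_def .
qed

end

definition mobius_group :: "mobius monoid" where
  "mobius_group = \<lparr>carrier = UNIV, mult = (*), one = 1\<rparr>"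

lemma group_mobius_group: "group mobius_group"
proof (rule groupI)
  fix h assume "h \<in> carrier mobius_group"
  obtain a b c d where h: "a * d - b * c > 0" "h = mob a b c d"
    by (rule mobius_cases)
  have inv: "d * a - (- b) * (- c) > 0" using h(1) by (simp add: mult.commute)
  have "act (mob d (- b) (- c) a * h) = mob_fun (d * a - b * c) 0 0 (d * a - b * c)"
    using mob_fun_comp[OF inv h(1)] by (simp add: h(2) act_mob[OF h(1)] act_mob[OF inv] algebra_simps)
  also have "\<dots> = act 1"
    using mob_fun_id[of "d * a - b * c"] h(1) by (simp add: mult.commute)
  finally have "mob d (- b) (- c) a * h = 1"
    by (simp only: act_inject)
  then show "\<exists>k\<in>carrier mobius_group. k \<otimes>\<^bsub>mobius_group\<^esub> h = \<one>\<^bsub>mobius_group\<^esub>"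
    unfolding mobius_group_def by auto
qed (simp_all add: mobius_group_def mult.assoc)

definition Hbar :: "complex option set" where
  "Hbar = insert None (Some ` {z. 0 \<le> Im z})"

definition mobius_semigroup :: "mobius set \<Rightarrow> bool" where
  "mobius_semigroup S \<longleftrightarrow> S \<noteq> {} \<and> (\<forall>g\<in>S. \<forall>h\<in>S. g * h \<in> S)"

definition finitely_generated :: "mobius set \<Rightarrow> bool" where
  "finitely_generated S \<longleftrightarrow>
     (\<exists>F. finite F \<and> F \<subseteq> S \<and> (\<forall>h\<in>S. \<exists>hs. hs \<noteq> [] \<and> set hs \<subseteq> F \<and> h = prod_list hs))"

definition elementary :: "mobius set \<Rightarrow> bool" where
  "elementary S \<longleftrightarrow> (\<exists>w\<in>Hbar. finite ((\<lambda>h. act h w) ` S))"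

definition semidiscrete :: "mobius set \<Rightarrow> bool" where
  "semidiscrete S \<longleftrightarrow> \<not> 1 islimpt S"

abbreviation embed :: "real option \<Rightarrow> complex option" where
  "embed \<equiv> map_option complex_of_real"

text \<open>
  For \<open>p \<noteq> q\<close>, \<open>circle_arc p q\<close> is the closed arc traversed from \<open>p\<close> to \<open>q\<close> in the direction of increasing
  reals, passing through infinity if \<open>p\<close>, \<open>q\<close> are reals with \<open>q < p\<close>. Every closed interval of the
  circle has this form for exactly one pair \<open>(p, q)\<close>, and \<open>p\<close>, \<open>q\<close> are its end points.
\<close>

fun circle_arc :: "real option \<Rightarrow> real option \<Rightarrow> real option set" where
  "circle_arc (Some a) (Some b) =
     (if a \<le> b then Some ` {a..b} else insert None (Some ` ({a..} \<union> {..b})))"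
| "circle_arc (Some a) None = insert None (Some ` {a..})"
| "circle_arc None (Some b) = insert None (Some ` {..b})"
| "circle_arc None None = {None}"

definition closed_interval_with_endpoints ::
    "complex option set \<Rightarrow> complex option \<Rightarrow> complex option \<Rightarrow> bool" where
  "closed_interval_with_endpoints J u v \<longleftrightarrow>
     (\<exists>p q. p \<noteq> q \<and> J = embed ` circle_arc p q \<and> u = embed p \<and> v = embed q)"

definition closed_interval :: "complex option set \<Rightarrow> bool" where
  "closed_interval J \<longleftrightarrow> (\<exists>u v. closed_interval_with_endpoints J u v)"

definition Mob :: "complex option set \<Rightarrow> mobius set" where
  "Mob J = {h. act h ` J \<subseteq> J}"

definition Mob0 :: "complex option set \<Rightarrow> mobius set" where
  "Mob0 J = {h. act h ` J = J}"

definition exceptional :: "mobius set \<Rightarrow> bool" where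
  "exceptional S \<longleftrightarrow>
     (\<exists>J u v. closed_interval_with_endpoints J u v \<and> S \<subseteq> Mob J \<and>
        subgroup (S \<inter> Mob0 J) mobius_group \<and> S \<inter> Mob0 J \<noteq> {1} \<and> discrete (S \<inter> Mob0 J) \<and>
        (\<exists>h\<in>S - Mob0 J. act h u = u \<or> act h v = v))"

end

(*
  Lift S to matrices of positive determinant. Since I is an accumulation point of S, the closure T of
  the lift contains a one-parameter semigroup exp(tX), t >= 0, and as S is not elementary the
  conjugates of X span sl(2), so T has nonempty interior U. If U contains an element that is not
  hyperbolic, a perturbation of it is elliptic of finite order, so I lies in U and T is everything.
  Otherwise the trace never vanishes on U. Following its sign along exp(tX) shows that the lifts with
  positive trace form a semigroup, and this semigroup preserves a pointed cone in the plane up to sign: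
  in a basis B of extreme rays every element of S has a matrix with nonnegative entries, so S maps the
  interval J = B[0, oo] into itself.

  Now let S be generated by finitely many nonnegative matrices of determinant 1. The product of the
  off-diagonal entries is superadditive, so words near I only involve triangular generators, and
  unless the diagonal generators include both an expanding and a contracting one, no word other than
  I is close to I. Hence S meets the group of diagonal matrices (a copy of the real line) in a semigroup with
  positive and negative elements, which is dense or infinite cyclic; in the cyclic case a triangular,
  non-diagonal generator must exist, as otherwise S would be semidiscrete, and S is exceptional.
*)

theory Submission
  imports Defs
begin

section \<open>Lifting Moebius transformations to matrices\<close>

text \<open>The obstacle is the sign. A Moebius map determines its matrix only up to a nonzero
  scalar, and the sign of the trace is not multiplicative in general, so no choice of lifts forms a
  semigroup for an evident reason. What helps is that the trace factorises along a matrix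
  \<open>P\<close> of rank one: \<open>tr2 (A \<star> P \<star> B \<star> P) = tr2 (A \<star> P) *
  tr2 (B \<star> P)\<close>. Such a \<open>P\<close> is the limit of the rescaled one-parameter
  semigroup. The only case without such a limit is a rotation group; it joins \<open>one2\<close> to
  \<open>- one2\<close> inside \<open>T\<close> and would force a zero of the trace on
  \<open>U\<close>. Lifts are kept closed under all nonzero scalars and determinants are not
  normalised: \<open>T\<close> then lies in an open subset of four-space, where interior points come
  from an open mapping argument. In the second half the sign is settled by nonnegativity, so that
  words in the generators of S become words in matrices. Finite generation supplies positive lower
  bounds for the positive entries, ratios and products formed from the generators.\<close>

type_synonym mat = "real \<times> real \<times> real \<times> real"

text \<open>Quadruples list a matrix row by row, in the order of the coefficients of
  \<open>mob\<close>; as nested pairs of reals they carry the topology of which that of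
  \<open>mobius\<close> is the quotient.\<close>

fun mm :: "mat \<Rightarrow> mat \<Rightarrow> mat"  (infixl "\<star>" 70) where
  "(a, b, c, d) \<star> (a', b', c', d') = (a * a' + b * c', a * b' + b * d', c * a' + d * c', c * b' + d * d')"

fun det2 :: "mat \<Rightarrow> real" where
  "det2 (a, b, c, d) = a * d - b * c"

fun tr2 :: "mat \<Rightarrow> real" where
  "tr2 (a, b, c, d) = a + d"

text \<open>The adjugate serves as inverse: it is linear in the entries, and
  \<open>A \<star> X \<star> adj A\<close> is conjugation by \<open>A\<close> up to the factor
  \<open>det2 A\<close>.\<close>

fun adj :: "mat \<Rightarrow> mat" where
  "adj (a, b, c, d) = (d, - b, - c, a)"

definition one2 :: mat where
  "one2 = (1, 0, 0, 1)"

fun mobm :: "mat \<Rightarrow> mobius" where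
  "mobm (a, b, c, d) = mob a b c d"

lemma mm_assoc: "A \<star> B \<star> C = A \<star> (B \<star> C)"
  by (cases A rule: prod_cases4; cases B rule: prod_cases4; cases C rule: prod_cases4)
     (simp add: algebra_simps)

lemma mm_one [simp]: "one2 \<star> A = A" "A \<star> one2 = A"
  by (cases A rule: prod_cases4; simp add: one2_def)+

lemma det2_mm [simp]: "det2 (A \<star> B) = det2 A * det2 B"
  by (cases A rule: prod_cases4; cases B rule: prod_cases4) (simp add: algebra_simps)

lemma det2_one [simp]: "det2 one2 = 1"
  by (simp add: one2_def)

lemma det2_adj [simp]: "det2 (adj A) = det2 A"
  by (cases A rule: prod_cases4) (simp add: algebra_simps)

lemma adj_mm: "adj (A \<star> B) = adj B \<star> adj A"
  by (cases A rule: prod_cases4; cases B rule: prod_cases4) (simp add: algebra_simps)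

lemma adj_adj [simp]: "adj (adj A) = A"
  by (cases A rule: prod_cases4) simp

lemma mm_adj: "A \<star> adj A = det2 A *\<^sub>R one2" "adj A \<star> A = det2 A *\<^sub>R one2"
  by (cases A rule: prod_cases4; simp add: one2_def algebra_simps)+

lemma adj_scaleR [simp]: "adj (r *\<^sub>R A) = r *\<^sub>R adj A"
  by (cases A rule: prod_cases4) simp

lemma det2_scaleR [simp]: "det2 (r *\<^sub>R A) = r\<^sup>2 * det2 A"
  by (cases A rule: prod_cases4) (simp add: algebra_simps power2_eq_square)

lemma tr2_mm_commute: "tr2 (A \<star> B) = tr2 (B \<star> A)"
  by (cases A rule: prod_cases4; cases B rule: prod_cases4) (simp add: algebra_simps)

lemma linear_tr2: "linear tr2"
  by (rule linearI; clarsimp simp: algebra_simps)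

lemmas tr2_add [simp] = linear_add[OF linear_tr2]
  and tr2_diff [simp] = linear_diff[OF linear_tr2]
  and tr2_scaleR [simp] = linear_cmul[OF linear_tr2, unfolded real_scaleR_def]

lemma bounded_bilinear_mm: "bounded_bilinear (\<star>)"
  unfolding bilinear_conv_bounded_bilinear[symmetric] bilinear_def
  by (intro conjI allI; rule linearI; clarsimp simp: algebra_simps)

lemmas mm_add_left = bounded_bilinear.add_left[OF bounded_bilinear_mm]
  and mm_add_right = bounded_bilinear.add_right[OF bounded_bilinear_mm]
  and mm_diff_left = bounded_bilinear.diff_left[OF bounded_bilinear_mm]
  and mm_diff_right = bounded_bilinear.diff_right[OF bounded_bilinear_mm]
  and mm_scaleR_left [simp] = bounded_bilinear.scaleR_left[OF bounded_bilinear_mm]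
  and mm_scaleR_right [simp] = bounded_bilinear.scaleR_right[OF bounded_bilinear_mm]
  and mm_zero_left [simp] = bounded_bilinear.zero_left[OF bounded_bilinear_mm]
  and mm_zero_right [simp] = bounded_bilinear.zero_right[OF bounded_bilinear_mm]
  and tendsto_mm [tendsto_intros] = bounded_bilinear.tendsto[OF bounded_bilinear_mm]
  and continuous_on_mm [continuous_intros] = bounded_bilinear.continuous_on[OF bounded_bilinear_mm]

lemma linear_adj: "linear adj"
  by (rule linearI; clarsimp)

lemmas tendsto_tr2 [tendsto_intros] =
    bounded_linear.tendsto[OF linear_tr2[unfolded linear_conv_bounded_linear]]
  and continuous_on_tr2 [continuous_intros] =
    bounded_linear.continuous_on[OF linear_tr2[unfolded linear_conv_bounded_linear]]
  and tendsto_adj [tendsto_intros] =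
    bounded_linear.tendsto[OF linear_adj[unfolded linear_conv_bounded_linear]]
  and continuous_on_adj [continuous_intros] =
    bounded_linear.continuous_on[OF linear_adj[unfolded linear_conv_bounded_linear]]

text \<open>Writes the determinant in terms of linear and bilinear maps, from which it inherits
  limits and continuity.\<close>

lemma det2_conv_tr2: "2 * det2 A = tr2 (A \<star> adj A)"
  by (cases A rule: prod_cases4) (simp add: algebra_simps)

lemma det2_conv_tr2': "det2 A = tr2 (A \<star> adj A) / 2"
  using det2_conv_tr2[of A] by simp

lemma tendsto_det2 [tendsto_intros]: "(f \<longlongrightarrow> A) F \<Longrightarrow> ((\<lambda>x. det2 (f x)) \<longlongrightarrow> det2 A) F"
  unfolding det2_conv_tr2' by (intro tendsto_intros) auto

lemma continuous_on_det2 [continuous_intros]: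
  "continuous_on T f \<Longrightarrow> continuous_on T (\<lambda>x. det2 (f x))"
  unfolding det2_conv_tr2' by (intro continuous_intros) auto

lemma mobm_mm:
  assumes "det2 A > 0" "det2 B > 0"
  shows "mobm (A \<star> B) = mobm A * mobm B"
proof -
  obtain a b c d where A: "A = (a, b, c, d)" by (cases A rule: prod_cases4)
  obtain a' b' c' d' where B: "B = (a', b', c', d')" by (cases B rule: prod_cases4)
  have "act (mobm (A \<star> B)) = act (mobm A * mobm B)"
    using assms mob_fun_comp[of a d b c a' d' b' c'] det_comp[of a d b c a' d' b' c']
    by (simp add: A B act_mob)
  then show ?thesis by (simp only: act_inject)
qed

lemma mobm_one [simp]: "mobm one2 = 1"
proof -
  have "act (mobm one2) = act 1"
    by (simp add: one2_def act_mob mob_fun_id[of 1, simplified])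
  then show ?thesis by (simp only: act_inject)
qed

lemma mobm_scaleR:
  assumes "r \<noteq> 0" "det2 A > 0"
  shows "mobm (r *\<^sub>R A) = mobm A"
proof -
  have 1: "det2 (r *\<^sub>R one2) > 0" using assms by simp
  have "act (mobm (r *\<^sub>R one2)) = act 1"
    using assms 1 by (simp add: one2_def act_mob mob_fun_id)
  then have "mobm (r *\<^sub>R one2) = 1" by (simp only: act_inject)
  then show ?thesis
    using mobm_mm[OF 1 assms(2)] by simp
qed

text \<open>Three points suffice: the values at infinity, 0 and 1 force \<open>c = 0\<close>,
  \<open>b = 0\<close> and \<open>a = d\<close>.\<close>

lemma mobm_eq_one_iff:
  assumes "det2 A > 0"
  shows "mobm A = 1 \<longleftrightarrow> (\<exists>r. A = r *\<^sub>R one2)"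
proof
  obtain a b c d where A: "A = (a, b, c, d)" by (cases A rule: prod_cases4)
  assume "mobm A = 1"
  then have id: "mob_fun a b c d = id"
    using assms by (metis A act_mob act_one det2.simps mobm.simps)
  have "c = 0" using fun_cong[OF id, of None] by (simp add: mob_fun_def split: if_splits)
  moreover have "b = 0" using fun_cong[OF id, of "Some 0"] assms calculation
    by (simp add: mob_fun_def A split: if_splits)
  moreover have "a = d" using fun_cong[OF id, of "Some 1"] assms calculation
    by (simp add: mob_fun_def A split: if_splits)
  ultimately show "\<exists>r. A = r *\<^sub>R one2" by (auto simp: A one2_def)
next
  assume "\<exists>r. A = r *\<^sub>R one2"
  then obtain r where r: "A = r *\<^sub>R one2" by blast
  then have "r \<noteq> 0" using assms by auto
  then show "mobm A = 1" using mobm_scaleR[of r one2] by (simp add: r)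
qed

text \<open>\<open>adj B\<close> lifts the inverse of \<open>mobm B\<close>, so the claim reduces to
  the kernel, which consists of the scalar matrices.\<close>

lemma mobm_eq_iff:
  assumes "det2 A > 0" "det2 B > 0"
  shows "mobm A = mobm B \<longleftrightarrow> (\<exists>r. r \<noteq> 0 \<and> A = r *\<^sub>R B)"
proof
  assume eq: "mobm A = mobm B"
  have "mobm (adj B \<star> A) = mobm (adj B \<star> B)"
    using assms eq by (simp add: mobm_mm)
  also have "\<dots> = 1"
    using assms mobm_scaleR[of "det2 B" one2] by (simp add: mm_adj)
  finally obtain r where r: "adj B \<star> A = r *\<^sub>R one2"
    using mobm_eq_one_iff[of "adj B \<star> A"] assms by auto
  have "B \<star> (adj B \<star> A) = r *\<^sub>R B" by (simp add: r)
  then have *: "det2 B *\<^sub>R A = r *\<^sub>R B" by (simp add: mm_assoc[symmetric] mm_adj)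
  have "A = (1 / det2 B) *\<^sub>R (det2 B *\<^sub>R A)"
    using assms(2) by simp
  then have "A = (r / det2 B) *\<^sub>R B"
    unfolding * by simp
  moreover have "r / det2 B \<noteq> 0" using assms(1) calculation by (auto simp del: divide_eq_0_iff)
  ultimately show "\<exists>r. r \<noteq> 0 \<and> A = r *\<^sub>R B" by blast
next
  assume "\<exists>r. r \<noteq> 0 \<and> A = r *\<^sub>R B"
  then obtain r where "r \<noteq> 0" "A = r *\<^sub>R B" by blast
  then show "mobm A = mobm B" using mobm_scaleR[of r B] assms by simp
qed

lemma mobm_surj:
  obtains A where "det2 A = 1" "mobm A = h"
proof -
  obtain a b c d where h: "a * d - b * c > 0" "h = mob a b c d"
    by (rule mobius_cases)
  define A where "A = (1 / sqrt (det2 (a, b, c, d))) *\<^sub>R (a, b, c, d)"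
  have "det2 A = 1"
    unfolding A_def det2_scaleR using h(1) by (simp add: power_divide)
  moreover have "mobm A = h"
    unfolding A_def using h mobm_scaleR[of "1 / sqrt (det2 (a, b, c, d))" "(a, b, c, d)"] by simp
  ultimately show ?thesis by (rule that)
qed

section \<open>The topology of the Moebius group in terms of lifts\<close>

lemma open_mobius_iff: "open U \<longleftrightarrow> open {A. det2 A > 0 \<and> mobm A \<in> U}"
proof -
  have "{(a, b, c, d). a * d - b * c > 0 \<and> mob a b c d \<in> U} = {A. det2 A > 0 \<and> mobm A \<in> U}"
    by auto
  then show ?thesis by (simp add: open_mobius_def)
qed

lemma open_det2_pos: "open {A. det2 A > 0}"
  by (intro open_Collect_less continuous_intros)

text \<open>The quotient map is open, because the saturation of an open set under nonzero scalars is
  a union of rescaled copies of it.\<close>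

lemma open_mobm_image:
  assumes "open O'"
  shows "open (mobm ` (O' \<inter> {A. det2 A > 0}))"
proof -
  have eq: "{A. det2 A > 0 \<and> mobm A \<in> mobm ` (O' \<inter> {A. det2 A > 0})}
    = (\<Union>r\<in>-{0}. (\<lambda>A. r *\<^sub>R A) ` (O' \<inter> {A. det2 A > 0}))" (is "?L = ?R")
  proof
    show "?L \<subseteq> ?R"
    proof
      fix A assume "A \<in> ?L"
      then obtain B where B: "B \<in> O'" "det2 B > 0" "det2 A > 0" "mobm A = mobm B" by auto
      then obtain r where "r \<noteq> 0" "A = r *\<^sub>R B" using mobm_eq_iff by blast
      with B show "A \<in> ?R" by auto
    qed
    show "?R \<subseteq> ?L"
    proof
      fix A assume "A \<in> ?R"
      then obtain r B where "r \<noteq> 0" "B \<in> O'" "det2 B > 0" "A = r *\<^sub>R B" by blast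
      then show "A \<in> ?L" by (simp add: mobm_scaleR)
    qed
  qed
  have "open (O' \<inter> {A. det2 A > 0})" using assms open_det2_pos by (rule open_Int)
  then show ?thesis
    unfolding open_mobius_iff eq by (intro open_UN ballI open_scaling) auto
qed

lemma tendsto_mobm:
  assumes "(f \<longlongrightarrow> A) F" "det2 A > 0"
  shows "((\<lambda>x. mobm (f x)) \<longlongrightarrow> mobm A) F"
proof (rule topological_tendstoI)
  fix U assume "open U" "mobm A \<in> U"
  then have "eventually (\<lambda>x. f x \<in> {A. det2 A > 0 \<and> mobm A \<in> U}) F"
    using assms by (intro topological_tendstoD) (auto simp: open_mobius_iff)
  then show "eventually (\<lambda>x. mobm (f x) \<in> U) F"
    by (rule eventually_mono) auto
qed

text \<open>Balls around \<open>one2\<close> have open images, so elements of \<open>S\<close> near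
  1 but different from it have lifts near \<open>one2\<close>; dividing by the root of the
  determinant does not disturb the limit.\<close>

lemma islimpt_one_sequence:
  assumes "1 islimpt S"
  obtains f where "\<And>n. det2 (f n) = 1" "\<And>n::nat. mobm (f n) \<in> S" "\<And>n. f n \<noteq> one2"
    "f \<longlonglongrightarrow> one2"
proof -
  have "\<exists>A. det2 A > 0 \<and> mobm A \<in> S \<and> mobm A \<noteq> 1 \<and> dist A one2 < inverse (Suc n)" for n
  proof -
    let ?V = "ball one2 (inverse (Suc n)) \<inter> {A. det2 A > 0}"
    have V: "open (mobm ` ?V)"
      by (rule open_mobm_image) simp
    have V1: "1 \<in> mobm ` ?V"
      by (rule image_eqI[of _ _ one2]) simp_all
    obtain y where y: "y \<in> S" "y \<in> mobm ` ?V" "y \<noteq> 1"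
      by (rule islimptE[OF assms V1 V])
    from y(2) obtain A where "A \<in> ?V" "y = mobm A" by (rule imageE)
    with y show ?thesis
      by (intro exI[of _ A]) (simp add: dist_commute)
  qed
  then obtain g where g: "\<And>n. det2 (g n) > 0" "\<And>n. mobm (g n) \<in> S" "\<And>n. mobm (g n) \<noteq> 1"
      "\<And>n. dist (g n) one2 < inverse (Suc n)" by metis
  have lim: "g \<longlonglongrightarrow> one2"
  proof (rule metric_tendsto_imp_tendsto[OF LIMSEQ_inverse_real_of_nat])
    show "\<forall>\<^sub>F x in sequentially. dist (g x) one2 \<le> dist (inverse (real (Suc x))) 0"
      using g(4) by (intro always_eventually) (simp add: less_imp_le)
  qed
  define f where "f n = (1 / sqrt (det2 (g n))) *\<^sub>R g n" for n
  have "f \<longlonglongrightarrow> (1 / sqrt (det2 one2)) *\<^sub>R one2"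
    unfolding f_def by (intro tendsto_intros lim) auto
  then have "f \<longlonglongrightarrow> one2" by simp
  moreover have "det2 (f n) = 1" for n
    unfolding f_def using g(1)[of n] by (simp add: power_divide)
  moreover have eq: "mobm (f n) = mobm (g n)" for n
    unfolding f_def using g(1)[of n] by (intro mobm_scaleR) auto
  moreover have "f n \<noteq> one2" for n
    using eq[of n] g(3)[of n] by auto
  ultimately show ?thesis using that g(2) by metis
qed

lemma closure_eq_UNIV_if_lift_dense:
  assumes "{A. det2 A > 0} \<subseteq> closure {A. det2 A > 0 \<and> mobm A \<in> S}"
  shows "closure S = UNIV"
proof -
  have "h \<in> closure S" for h
  proof -
    obtain A where A: "det2 A = 1" "mobm A = h" by (rule mobm_surj)
    then obtain f where f: "\<And>n::nat. det2 (f n) > 0" "\<And>n. mobm (f n) \<in> S" "f \<longlonglongrightarrow> A"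
      using assms by (force simp: closure_sequential)
    have "(\<lambda>n. mobm (f n)) \<longlonglongrightarrow> h"
      using tendsto_mobm[OF f(3)] A by simp
    moreover have "mobm (f n) \<in> closure S" for n
      using f(2) closure_subset by blast
    ultimately show ?thesis
      by (intro Lim_in_closed_set[OF closed_closure, of "\<lambda>n. mobm (f n)" S sequentially]) auto
  qed
  then show ?thesis by blast
qed

section \<open>Elementary semigroups\<close>

text \<open>The points of the sphere that represent eigenlines of \<open>Z\<close> are the zeros of
  a nonzero quadratic form with real coefficients, so they are finite in number and one of them lies
  in \<open>Hbar\<close>. If conjugation preserves the line of \<open>Z\<close>, then
  \<open>S\<close> maps this finite set into itself.\<close>

lemma elementary_if_conj_eigenvector:
  assumes Z: "Z \<noteq> 0" "tr2 Z = 0"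
    and eig: "\<And>A. det2 A > 0 \<Longrightarrow> mobm A \<in> S \<Longrightarrow> \<exists>k. A \<star> Z \<star> adj A = k *\<^sub>R Z"
  shows "elementary S"
proof -
  obtain p q r s where "Z = (p, q, r, s)" by (cases Z rule: prod_cases4)
  with Z have Zdef: "Z = (p, q, r, - p)" and nz: "p \<noteq> 0 \<or> q \<noteq> 0 \<or> r \<noteq> 0"
    by (auto simp: zero_prod_def)
  \<comment> \<open>The determinant of the two columns Zv and v for v = (z, w); it vanishes exactly
    when v is an eigenvector or zero.\<close>
  define \<phi> where "\<phi> z w = of_real q * w\<^sup>2 + 2 * of_real p * z * w - of_real r * z\<^sup>2" for z w :: complex
  define Fix where "Fix = {w. case w of None \<Rightarrow> r = 0 | Some z \<Rightarrow> \<phi> z 1 = 0}"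
  have inv: "act h w \<in> Fix" if h: "h \<in> S" and w: "w \<in> Fix" for h w
  proof -
    obtain A where A: "det2 A = 1" "mobm A = h" by (rule mobm_surj)
    obtain a b c d where Adef: "A = (a, b, c, d)" by (cases A rule: prod_cases4)
    obtain k where k: "A \<star> Z \<star> adj A = k *\<^sub>R Z" using eig[of A] A h by auto
    have "adj A \<star> (A \<star> Z \<star> adj A) \<star> A = Z"
      using A by (simp add: mm_assoc mm_adj) (simp add: mm_assoc[symmetric] mm_adj)
    then have "k \<noteq> 0" using k Z(1) by auto
    from A have det: "a * d - b * c = 1" by (simp add: Adef)
    from k have k1: "k * p = (a * p + b * r) * d + (a * q + b * - p) * - c"
      and k2: "k * q = (a * p + b * r) * - b + (a * q + b * - p) * a"
      and k3: "k * r = (c * p + d * r) * d + (c * q + d * - p) * - c"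
      by (simp_all only: Adef Zdef mm.simps adj.simps scaleR_Pair real_scaleR_def prod.inject)
    \<comment> \<open>As \<open>A\<close> has determinant 1, the form of
      \<open>A \<star> Z \<star> adj A\<close> at the image of a vector under \<open>A\<close>
      equals the form of \<open>Z\<close> at that vector.\<close>
    have key: "of_real k * \<phi> (of_real a * z + of_real b * w) (of_real c * z + of_real d * w) = \<phi> z w"
      for z w
    proof -
      have "of_real k * \<phi> (of_real a * z + of_real b * w) (of_real c * z + of_real d * w)
        = of_real (k * q) * (of_real c * z + of_real d * w)\<^sup>2
          + 2 * of_real (k * p) * (of_real a * z + of_real b * w) * (of_real c * z + of_real d * w)
          - of_real (k * r) * (of_real a * z + of_real b * w)\<^sup>2"
        by (simp add: \<phi>_def algebra_simps)
      also have "\<dots> = of_real ((a * d - b * c)\<^sup>2) * \<phi> z w"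
        unfolding k1 k2 k3 \<phi>_def by (simp add: power2_eq_square algebra_simps)
      finally show ?thesis using det by simp
    qed
    have act: "act h = mob_fun a b c d"
      using A det by (simp add: Adef act_mob flip: A(2))
    have scale: "\<phi> (n / m) 1 = \<phi> n m / m\<^sup>2" if "m \<noteq> 0" for n m
      using that by (simp add: \<phi>_def field_simps power2_eq_square)
    have None: "\<phi> 1 0 = 0 \<longleftrightarrow> r = 0" by (simp add: \<phi>_def)
    show ?thesis
    proof (cases w)
      case None
      then have "\<phi> (of_real a) (of_real c) = 0"
        using key[of 1 0] w \<open>k \<noteq> 0\<close> \<open>\<phi> 1 0 = 0 \<longleftrightarrow> r = 0\<close> by (simp add: Fix_def)
      moreover have "a \<noteq> 0 \<or> c \<noteq> 0" using det by auto
      ultimately show ?thesis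
        using None scale[of "of_real c" "of_real a"]
        by (auto simp: act Fix_def mob_fun_def) (simp add: \<phi>_def)
    next
      case (Some z)
      have 0: "\<phi> (of_real a * z + of_real b) (of_real c * z + of_real d) = 0"
        using key[of z 1] w \<open>k \<noteq> 0\<close> by (simp add: Fix_def Some)
      show ?thesis
      proof (cases "of_real c * z + of_real d = 0")
        case True
        have "of_real a * z + of_real b \<noteq> 0"
        proof
          assume "of_real a * z + of_real b = 0"
          then have "of_real a * (of_real c * z + of_real d) - of_real c * (of_real a * z + of_real b) = 0"
            using True by simp
          then have "complex_of_real (a * d - b * c) = 0" by (simp add: algebra_simps)
          then show False using det by simp
        qed
        then show ?thesis using 0 True Some
          by (simp add: act Fix_def mob_fun_def \<phi>_def)
      next
        case False
        then show ?thesis using 0 Some scale[OF False]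
          by (simp add: act Fix_def mob_fun_def)
      qed
    qed
  qed
  have fin: "finite Fix"
  proof -
    have "[: complex_of_real q, 2 * of_real p, - of_real r :] \<noteq> 0" using nz by auto
    then have "finite {z. poly [: complex_of_real q, 2 * of_real p, - of_real r :] z = 0}"
      by (rule poly_roots_finite)
    moreover have "Fix \<subseteq> insert None (Some ` {z. poly [: complex_of_real q, 2 * of_real p, - of_real r :] z = 0})"
    proof
      fix w assume "w \<in> Fix"
      then show "w \<in> insert None (Some ` {z. poly [: complex_of_real q, 2 * of_real p, - of_real r :] z = 0})"
        by (cases w) (auto simp: Fix_def \<phi>_def power2_eq_square algebra_simps)
    qed
    ultimately show ?thesis by (meson finite_imageI finite_insert finite_subset)
  qed
  have "\<exists>w\<in>Hbar. w \<in> Fix"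
  proof (cases "r = 0")
    case True
    then show ?thesis by (auto simp: Hbar_def Fix_def)
  next
    case r: False
    define \<delta> where "\<delta> = p\<^sup>2 + q * r"
    \<comment> \<open>A square root of the discriminant \<open>\<delta>\<close>; for negative
      \<open>\<delta>\<close> its sign follows that of \<open>r\<close>, so that dividing by
      \<open>r\<close> leads into the upper half-plane.\<close>
    define e where "e = (if \<delta> \<ge> 0 then complex_of_real (sqrt \<delta>) else \<i> * of_real (sgn r * sqrt (- \<delta>)))"
    have e2: "e\<^sup>2 = of_real \<delta>"
      using r by (simp add: e_def power_mult_distrib sgn_if flip: of_real_power)
    define z where "z = (of_real p + e) / of_real r"
    have "\<phi> z 1 * of_real r = of_real (p\<^sup>2 + q * r) - e\<^sup>2"
      using r by (simp add: \<phi>_def z_def field_simps power2_eq_square)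
    then have "\<phi> z 1 = 0" using r by (simp add: e2 \<delta>_def)
    moreover have "Im z \<ge> 0"
      unfolding z_def e_def by (auto simp: Im_divide_of_real sgn_if divide_simps)
    ultimately show ?thesis by (intro bexI[of _ "Some z"]) (auto simp: Hbar_def Fix_def)
  qed
  then obtain w where w: "w \<in> Hbar" "w \<in> Fix" by blast
  have "finite ((\<lambda>h. act h w) ` S)"
    by (rule finite_subset[OF _ fin]) (use inv w in auto)
  with w(1) show ?thesis unfolding elementary_def by blast
qed

section \<open>One-parameter subgroups\<close>

lemma tracelessE:
  assumes "tr2 X = 0" obtains p q r where "X = (p, q, r, - p)"
proof -
  obtain p q r s where X: "X = (p, q, r, s)" by (cases X rule: prod_cases4)
  with assms have "s = - p" by simp
  with X that show thesis by blast
qed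

text \<open>Cayley-Hamilton with vanishing linear term. Hence combinations of \<open>one2\<close>
  and \<open>X\<close> are closed under multiplication, and exp(tX) is found among them.\<close>

lemma mm_self_if_traceless: "tr2 X = 0 \<Longrightarrow> X \<star> X = (- det2 X) *\<^sub>R one2"
  by (erule tracelessE) (simp add: one2_def algebra_simps)

lemma det2_one_add: "tr2 X = 0 \<Longrightarrow> det2 (a *\<^sub>R one2 + b *\<^sub>R X) = a\<^sup>2 + b\<^sup>2 * det2 X"
  by (erule tracelessE) (simp add: one2_def algebra_simps power2_eq_square)

text \<open>Describes exp(tX) by the properties that all three types share; the closed formulas
  differ with the sign of \<open>det2 X\<close>.\<close>

locale one_parameter =
  fixes X :: mat and E :: "real \<Rightarrow> mat"
  assumes E_0 [simp]: "E 0 = one2"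
    and E_add: "E (s + t) = E s \<star> E t"
    and E_deriv: "(E has_derivative (\<lambda>h. h *\<^sub>R X)) (at 0)"
    and det2_E [simp]: "det2 (E t) = 1"
    and E_commute: "E t \<star> X = X \<star> E t"

text \<open>Since \<open>X \<star> X\<close> is the scalar \<open>- det2 X\<close>, the coefficients
  \<open>c\<close> and \<open>s\<close> have to satisfy the addition formulas of cosine and sine
  with \<open>det2 X\<close> inserted.\<close>

lemma one_parameterI:
  assumes X: "tr2 X = 0"
    and cs: "c 0 = 1" "s 0 = 0"
      "\<And>x y. c (x + y) = c x * c y - det2 X * s x * s y"
      "\<And>x y. s (x + y) = c x * s y + s x * c y"
      "\<And>x. (c x)\<^sup>2 + det2 X * (s x)\<^sup>2 = 1"
    and deriv: "(c has_real_derivative 0) (at 0)" "(s has_real_derivative 1) (at 0)"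
  shows "one_parameter X (\<lambda>t. c t *\<^sub>R one2 + s t *\<^sub>R X)"
proof
  show "c 0 *\<^sub>R one2 + s 0 *\<^sub>R X = one2" using cs by simp
next
  fix x y
  show "c (x + y) *\<^sub>R one2 + s (x + y) *\<^sub>R X = (c x *\<^sub>R one2 + s x *\<^sub>R X) \<star> (c y *\<^sub>R one2 + s y *\<^sub>R X)"
    by (simp add: cs mm_add_left mm_add_right mm_self_if_traceless[OF X] scaleR_add_left
        scaleR_diff_left scaleR_add_right scaleR_diff_right mult_ac)
next
  show "((\<lambda>t. c t *\<^sub>R one2 + s t *\<^sub>R X) has_derivative (\<lambda>h. h *\<^sub>R X)) (at 0)"
    using deriv unfolding has_field_derivative_def
    by (auto intro!: derivative_eq_intros)
next
  fix x show "det2 (c x *\<^sub>R one2 + s x *\<^sub>R X) = 1"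
    using cs(5)[of x] by (simp add: det2_one_add[OF X] mult.commute)
  show "(c x *\<^sub>R one2 + s x *\<^sub>R X) \<star> X = X \<star> (c x *\<^sub>R one2 + s x *\<^sub>R X)"
    by (simp add: mm_add_left mm_add_right)
qed

text \<open>The sign of \<open>det2 X\<close> separates rotations, unipotents and hyperbolics.
  Rotations reach \<open>- one2\<close>. Otherwise \<open>P\<close> is the nilpotent
  \<open>X\<close> itself, with \<open>k t = 1 / t\<close>, or the projection onto the expanding
  eigenline of \<open>X\<close>, with \<open>k t = exp (- \<omega> * t)\<close>.\<close>

lemma one_parameter_exists:
  assumes X: "tr2 X = 0" "X \<noteq> 0"
  obtains E t0 where "one_parameter X E" "t0 > 0" "E t0 = - one2"
  | E P k where "one_parameter X E" "P \<noteq> 0" "det2 P = 0" "\<And>t. t > 0 \<Longrightarrow> (k t :: real) > 0"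
      "((\<lambda>t. k t *\<^sub>R E t) \<longlongrightarrow> P) at_top"
proof (cases "det2 X" "0 :: real" rule: linorder_cases)
  case greater
  define \<omega> where "\<omega> = sqrt (det2 X)"
  have \<omega>: "\<omega> > 0" "\<omega>\<^sup>2 = det2 X" using greater by (simp_all add: \<omega>_def)
  have "one_parameter X (\<lambda>t. cos (\<omega> * t) *\<^sub>R one2 + (sin (\<omega> * t) / \<omega>) *\<^sub>R X)"
    using \<omega>(1)
    by (intro one_parameterI[OF X(1)])
       (auto intro!: derivative_eq_intros simp: cos_add sin_add distrib_left field_simps
          power2_eq_square simp flip: \<omega>(2))
  then show ?thesis
    by (rule that(1)[of _ "pi / \<omega>"]) (use \<omega> in auto)
next
  case equal
  have op: "one_parameter X (\<lambda>t. 1 *\<^sub>R one2 + t *\<^sub>R X)"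
    by (intro one_parameterI[OF X(1)]) (auto intro!: derivative_eq_intros simp: equal)
  have "((\<lambda>t. (1 / t) *\<^sub>R one2 + X) \<longlongrightarrow> 0 *\<^sub>R one2 + X) at_top"
    by (intro tendsto_intros tendsto_divide_0[OF tendsto_const] filterlim_at_top_imp_at_infinity filterlim_ident)
  then have lim: "((\<lambda>t. (1 / t) *\<^sub>R one2 + X) \<longlongrightarrow> X) at_top" by simp
  have ev: "\<forall>\<^sub>F t in at_top. (1 / t) *\<^sub>R one2 + X = (1 / t) *\<^sub>R (1 *\<^sub>R one2 + t *\<^sub>R X)"
    using eventually_gt_at_top[of 0] by eventually_elim (simp add: scaleR_add_right)
  have "((\<lambda>t. (1 / t) *\<^sub>R (1 *\<^sub>R one2 + t *\<^sub>R X)) \<longlongrightarrow> X) at_top"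
    by (rule Lim_transform_eventually[OF lim ev])
  with op X(2) equal show ?thesis
    by (intro that(2)[of _ X "\<lambda>t. 1 / t"]) auto
next
  case less
  define \<omega> where "\<omega> = sqrt (- det2 X)"
  have \<omega>: "\<omega> > 0" "det2 X = - \<omega>\<^sup>2" using less by (simp_all add: \<omega>_def)
  have op: "one_parameter X (\<lambda>t. cosh (\<omega> * t) *\<^sub>R one2 + (sinh (\<omega> * t) / \<omega>) *\<^sub>R X)"
    using \<omega>(1) cosh_square_eq
    by (intro one_parameterI[OF X(1)])
       (auto intro!: derivative_eq_intros simp: cosh_add sinh_add distrib_left field_simps \<omega>(2)
          power2_eq_square)
  have lim: "((\<lambda>t. exp (- 2 * \<omega> * t)) \<longlongrightarrow> 0) at_top"
    using \<omega>(1) by (intro filterlim_compose[OF exp_at_bot]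
        filterlim_tendsto_neg_mult_at_bot[OF tendsto_const] filterlim_ident) auto
  define e where "e t = exp (- 2 * \<omega> * t)" for t
  have "((\<lambda>t. ((1 + e t) / 2) *\<^sub>R one2 + ((1 - e t) / (2 * \<omega>)) *\<^sub>R X)
      \<longlongrightarrow> ((1 + 0) / 2) *\<^sub>R one2 + ((1 - 0) / (2 * \<omega>)) *\<^sub>R X) at_top"
    using lim unfolding e_def[symmetric] by (intro tendsto_intros) (use \<omega> in auto)
  moreover have "exp (- \<omega> * t) *\<^sub>R (cosh (\<omega> * t) *\<^sub>R one2 + (sinh (\<omega> * t) / \<omega>) *\<^sub>R X)
      = ((1 + e t) / 2) *\<^sub>R one2 + ((1 - e t) / (2 * \<omega>)) *\<^sub>R X" for t
  proof -
    have eqs: "exp (- \<omega> * t) * cosh (\<omega> * t) = (1 + e t) / 2"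
      "exp (- \<omega> * t) * sinh (\<omega> * t) = (1 - e t) / 2"
      by (simp_all add: cosh_field_def sinh_field_def e_def field_simps flip: exp_add)
    have "exp (- \<omega> * t) *\<^sub>R (cosh (\<omega> * t) *\<^sub>R one2 + (sinh (\<omega> * t) / \<omega>) *\<^sub>R X)
      = (exp (- \<omega> * t) * cosh (\<omega> * t)) *\<^sub>R one2 + ((exp (- \<omega> * t) * sinh (\<omega> * t)) / \<omega>) *\<^sub>R X"
      by (simp add: scaleR_add_right)
    also have "\<dots> = ((1 + e t) / 2) *\<^sub>R one2 + (((1 - e t) / 2) / \<omega>) *\<^sub>R X"
      by (simp only: eqs)
    finally show ?thesis by simp
  qed
  ultimately have lim: "((\<lambda>t. exp (- \<omega> * t) *\<^sub>R (cosh (\<omega> * t) *\<^sub>R one2 + (sinh (\<omega> * t) / \<omega>) *\<^sub>R X))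
      \<longlongrightarrow> (1 / 2) *\<^sub>R one2 + (1 / (2 * \<omega>)) *\<^sub>R X) at_top" by simp
  have "det2 ((1 / 2) *\<^sub>R one2 + (1 / (2 * \<omega>)) *\<^sub>R X) = 0"
    using \<omega> by (simp add: det2_one_add[OF X(1)] power2_eq_square)
  moreover have "tr2 ((1 / 2) *\<^sub>R one2 + (1 / (2 * \<omega>)) *\<^sub>R X) = 1"
    using X(1) by (simp add: one2_def)
  then have "(1 / 2) *\<^sub>R one2 + (1 / (2 * \<omega>)) *\<^sub>R X \<noteq> 0"
    by (metis linear_0 linear_tr2 zero_neq_one)
  ultimately show ?thesis
    using that(2)[OF op _ _ _ lim] by simp
qed

context one_parameter
begin

lemma isCont_E: "isCont E t"
proof -
  have "isCont E 0"
    using E_deriv by (rule has_derivative_continuous)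
  then have "((\<lambda>h. E t \<star> E h) \<longlongrightarrow> E t \<star> one2) (at 0)"
    by (intro tendsto_intros) (simp add: isCont_def)
  then show ?thesis
    unfolding isCont_iff by (simp add: E_add)
qed

lemma continuous_on_E [continuous_intros]:
  assumes "continuous_on A f"
  shows "continuous_on A (\<lambda>x. E (f x))"
proof -
  have "continuous_on UNIV E"
    by (simp add: continuous_at_imp_continuous_on isCont_E)
  from continuous_on_compose2[OF this assms] show ?thesis by simp
qed

text \<open>
  With \<open>r = \<parallel>f n - 1\<parallel>\<close> both \<open>f n\<close> and \<open>E r\<close> equal \<open>1 + r X + o(r)\<close>, so their powers with exponent
  about \<open>t / r\<close> differ by \<open>o(1)\<close>.
\<close>

lemma in_closure_powers:
  fixes f :: "nat \<Rightarrow> mat"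
  assumes f: "\<And>n. f n \<in> Q" and mult: "\<And>A B. A \<in> Q \<Longrightarrow> B \<in> Q \<Longrightarrow> A \<star> B \<in> Q"
    and lim: "f \<longlonglongrightarrow> one2" and nz: "\<And>n. f n \<noteq> one2"
    and dir: "(\<lambda>n. (1 / norm (f n - one2)) *\<^sub>R (f n - one2)) \<longlonglongrightarrow> X"
    and t: "t > 0"
  shows "E t \<in> closure Q"
proof -
  define r where "r n = norm (f n - one2)" for n
  have r_pos: "r n > 0" for n using nz by (simp add: r_def)
  have "(\<lambda>n. f n - one2) \<longlonglongrightarrow> 0" using tendsto_diff[OF lim tendsto_const[of one2]] by simp
  then have r_lim: "r \<longlonglongrightarrow> 0" unfolding r_def by (rule tendsto_norm_zero)
  obtain K where K: "K > 0" "\<And>A B. norm (A \<star> B) \<le> norm A * norm B * K"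
    using bounded_bilinear.pos_bounded[OF bounded_bilinear_mm] by blast
  have "compact (E ` {0..t})"
    by (intro compact_continuous_image continuous_on_E continuous_on_id) simp
  then obtain \<beta> where \<beta>: "\<beta> > 0" "\<And>u. u \<in> {0..t} \<Longrightarrow> norm (E u) \<le> \<beta>"
    using compact_imp_bounded[of "E ` {0..t}"] unfolding bounded_pos by blast
  define k where "k n = nat \<lfloor>t / r n\<rfloor>" for n
  have k_le: "real (k n) \<le> t / r n" for n
    using t r_pos[of n] by (simp add: k_def)
  have k_gt: "t / r n < real (k n) + 1" for n
    using t r_pos[of n] unfolding k_def by linarith
  define e where "e n = norm (f n - E (r n))" for n
  define pw where "pw A j = ((\<star>) A ^^ j) one2" for A j
  have pw_Suc: "pw A (Suc j) = A \<star> pw A j" and pw_0: "pw A 0 = one2" for A j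
    by (simp_all add: pw_def)
  \<comment> \<open>A discrete Gronwall estimate: each further factor multiplies the old error by at
    most \<open>1 + K * r n\<close> and adds at most \<open>K * \<beta> * e n\<close>.\<close>
  have step: "norm (pw (f n) j - E (j * r n)) \<le> j * (K * \<beta> * e n) * (1 + K * r n) ^ j"
    if "j * r n \<le> t" for n j
    using that
  proof (induction j)
    case 0
    then show ?case by (simp add: pw_0)
  next
    case (Suc j)
    define q where "q = 1 + K * r n"
    define C where "C = K * \<beta> * e n"
    have q: "q \<ge> 1" using K r_pos[of n] by (simp add: q_def less_imp_le)
    have C: "C \<ge> 0" using K \<beta> by (simp add: C_def e_def)
    have le: "j * r n \<le> t" using Suc.prems r_pos[of n] by (simp add: algebra_simps)
    define D where "D = pw (f n) j - E (j * r n)"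
    have D: "norm D \<le> j * C * q ^ j" using Suc.IH[OF le] by (simp add: D_def C_def q_def)
    have "E (Suc j * r n) = E (r n) \<star> E (j * r n)"
      by (simp add: distrib_right flip: E_add)
    then have "pw (f n) (Suc j) - E (Suc j * r n)
        = D + (f n - one2) \<star> D + (f n - E (r n)) \<star> E (j * r n)"
      by (simp add: pw_Suc D_def mm_diff_left mm_diff_right)
    also have "norm \<dots> \<le> norm D + norm ((f n - one2) \<star> D) + norm ((f n - E (r n)) \<star> E (j * r n))"
      by (meson add_mono norm_triangle_ineq order_refl order_trans)
    also have "\<dots> \<le> norm D + r n * norm D * K + e n * \<beta> * K"
    proof (intro add_mono order_refl)
      show "norm ((f n - one2) \<star> D) \<le> r n * norm D * K"
        using K(2) by (simp add: r_def)
      have "norm ((f n - E (r n)) \<star> E (j * r n)) \<le> e n * norm (E (j * r n)) * K"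
        using K(2) by (simp add: e_def)
      also have "\<dots> \<le> e n * \<beta> * K"
        using \<beta>(2)[of "j * r n"] le r_pos[of n] K(1)
        by (intro mult_right_mono mult_left_mono) (auto simp: e_def)
      finally show "norm ((f n - E (r n)) \<star> E (j * r n)) \<le> e n * \<beta> * K" .
    qed
    also have "\<dots> = q * norm D + C"
      by (simp add: q_def C_def algebra_simps)
    also have "\<dots> \<le> q * (j * C * q ^ j) + C * q ^ Suc j"
    proof (intro add_mono mult_left_mono D)
      show "0 \<le> q" using q by simp
      show "C \<le> C * q ^ Suc j"
        using mult_left_mono[OF one_le_power[OF q, of "Suc j"] C] by simp
    qed
    also have "\<dots> = Suc j * C * q ^ Suc j" by (simp add: algebra_simps)
    finally show ?case by (simp add: C_def q_def)
  qed
  have bound: "norm (pw (f n) (k n) - E (k n * r n)) \<le> t * (K * \<beta>) * exp (K * t) * (e n / r n)" for n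
  proof -
    have kr: "k n * r n \<le> t" using k_le[of n] r_pos[of n] by (simp add: field_simps)
    have "(1 + K * r n) ^ k n \<le> exp (K * r n) ^ k n"
      using K(1) r_pos[of n] by (intro power_mono) (auto simp: less_imp_le)
    also have "\<dots> = exp (K * (k n * r n))" by (simp add: exp_of_nat_mult[symmetric] mult_ac)
    also have "\<dots> \<le> exp (K * t)" using kr K(1) by simp
    finally have pow: "(1 + K * r n) ^ k n \<le> exp (K * t)" .
    have "norm (pw (f n) (k n) - E (k n * r n)) \<le> k n * (K * \<beta> * e n) * (1 + K * r n) ^ k n"
      by (rule step[OF kr])
    also have "\<dots> \<le> (t / r n) * (K * \<beta> * e n) * exp (K * t)"
      using k_le[of n] K(1) \<beta>(1) pow t r_pos[of n]
      by (intro mult_mono mult_nonneg_nonneg) (auto simp: e_def less_imp_le)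
    finally show ?thesis by (simp add: mult_ac)
  qed
  have "(\<lambda>n. e n / r n) \<longlonglongrightarrow> 0"
  proof -
    have 1: "((\<lambda>h. norm (E h - one2 - h *\<^sub>R X) / norm h) \<longlongrightarrow> 0) (at 0)"
      using E_deriv by (simp add: has_derivative_at)
    have "filterlim r (at 0) sequentially"
      using r_lim r_pos by (intro filterlim_atI) (auto simp: less_imp_neq[symmetric] intro!: always_eventually less_imp_neq[symmetric])
    with 1 have "(\<lambda>n. norm (E (r n) - one2 - r n *\<^sub>R X) / norm (r n)) \<longlonglongrightarrow> 0"
      by (rule filterlim_compose)
    moreover have "(\<lambda>n. norm ((1 / r n) *\<^sub>R (f n - one2) - X)) \<longlonglongrightarrow> 0"
      using dir unfolding r_def by (intro tendsto_norm_zero) (simp add: LIM_zero)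
    ultimately have "(\<lambda>n. norm ((1 / r n) *\<^sub>R (f n - one2) - X)
        + norm (E (r n) - one2 - r n *\<^sub>R X) / norm (r n)) \<longlonglongrightarrow> 0"
      by (auto intro: tendsto_add_zero)
    then show ?thesis
    proof (rule tendsto_sandwich[OF _ _ tendsto_const, rotated 2])
      show "\<forall>\<^sub>F n in sequentially. 0 \<le> e n / r n"
        using r_pos by (intro always_eventually) (simp add: e_def less_imp_le)
      show "\<forall>\<^sub>F n in sequentially. e n / r n \<le> norm ((1 / r n) *\<^sub>R (f n - one2) - X)
        + norm (E (r n) - one2 - r n *\<^sub>R X) / norm (r n)"
      proof (intro always_eventually allI)
        fix n
        have "f n - E (r n) = r n *\<^sub>R ((1 / r n) *\<^sub>R (f n - one2) - X) - (E (r n) - one2 - r n *\<^sub>R X)"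
          using r_pos[of n] by (simp add: algebra_simps)
        then have "e n \<le> r n * norm ((1 / r n) *\<^sub>R (f n - one2) - X) + norm (E (r n) - one2 - r n *\<^sub>R X)"
          unfolding e_def using norm_triangle_ineq4 r_pos[of n]
          by (metis abs_of_pos norm_scaleR)
        then show "e n / r n \<le> norm ((1 / r n) *\<^sub>R (f n - one2) - X)
            + norm (E (r n) - one2 - r n *\<^sub>R X) / norm (r n)"
          using r_pos[of n] by (simp add: field_simps)
      qed
    qed
  qed
  then have "(\<lambda>n. t * (K * \<beta>) * exp (K * t) * (e n / r n)) \<longlonglongrightarrow> 0"
    by (rule tendsto_mult_right_zero)
  then have diff: "(\<lambda>n. pw (f n) (k n) - E (k n * r n)) \<longlonglongrightarrow> 0"
    by (rule Lim_null_comparison[rotated]) (use bound in simp)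
  have "(\<lambda>n. k n * r n) \<longlonglongrightarrow> t"
  proof (rule tendsto_sandwich)
    show "\<forall>\<^sub>F n in sequentially. t - r n \<le> k n * r n"
    proof (intro always_eventually allI)
      fix n show "t - r n \<le> k n * r n"
        using k_gt[of n] r_pos[of n] by (simp add: field_simps)
    qed
    show "\<forall>\<^sub>F n in sequentially. k n * r n \<le> t"
    proof (intro always_eventually allI)
      fix n show "k n * r n \<le> t"
        using k_le[of n] r_pos[of n] by (simp add: field_simps)
    qed
    show "(\<lambda>n. t - r n) \<longlonglongrightarrow> t" using tendsto_diff[OF tendsto_const r_lim, of t] by simp
  qed simp
  then have "(\<lambda>n. E (k n * r n)) \<longlonglongrightarrow> E t"
    by (rule isCont_tendsto_compose[OF isCont_E])
  from tendsto_add[OF diff this] have lim_pw: "(\<lambda>n. pw (f n) (k n)) \<longlonglongrightarrow> E t" by simp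
  \<comment> \<open>Only positive powers are available, as \<open>one2\<close> may lie outside
    \<open>Q\<close>; below, \<open>k n \<noteq> 0\<close> is secured by
    \<open>r n < t\<close>.\<close>
  have pw_in: "pw (f n) (Suc j) \<in> Q" for n j
    by (induction j) (simp_all add: pw_Suc pw_0 f mult)
  have "\<forall>\<^sub>F n in sequentially. pw (f n) (k n) \<in> closure Q"
  proof -
    have "\<forall>\<^sub>F n in sequentially. r n < t"
      using order_tendstoD(2)[OF r_lim t] .
    then show ?thesis
    proof eventually_elim
      case (elim n)
      then have "t / r n > 1" using r_pos[of n] by simp
      then have "k n \<noteq> 0" unfolding k_def by linarith
      then obtain j where "k n = Suc j" by (cases "k n") auto
      then show ?case using pw_in closure_subset by auto
    qed
  qed
  with lim_pw show ?thesis
    by (intro Lim_in_closed_set[OF closed_closure, of "\<lambda>n. pw (f n) (k n)" Q sequentially]) auto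
qed

end

section \<open>The closure of a nonelementary, non-semidiscrete semigroup\<close>

definition bracket :: "mat \<Rightarrow> mat \<Rightarrow> mat" where
  "bracket X Y = X \<star> Y - Y \<star> X"

lemma tr2_bracket [simp]: "tr2 (bracket X Y) = 0"
  by (simp add: bracket_def tr2_mm_commute)

text \<open>With \<open>tr2 (X \<star> Y)\<close> as inner product, the bracket is orthogonal to
  both of its factors, as a cross product is.\<close>

lemma tr2_bracket_mm [simp]: "tr2 (bracket X Y \<star> X) = 0" "tr2 (bracket X Y \<star> Y) = 0"
proof -
  have "tr2 (Y \<star> X \<star> X) = tr2 (X \<star> Y \<star> X)" "tr2 (X \<star> Y \<star> Y) = tr2 (Y \<star> X \<star> Y)"
    by (metis mm_assoc tr2_mm_commute)+
  then show "tr2 (bracket X Y \<star> X) = 0" "tr2 (bracket X Y \<star> Y) = 0"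
    by (simp_all add: bracket_def mm_diff_left)
qed

lemma parallel_if_bracket_eq_zero:
  assumes "tr2 X = 0" "tr2 Y = 0" "X \<noteq> 0" "bracket X Y = 0"
  obtains k where "Y = k *\<^sub>R X"
proof -
  obtain p q r where X: "X = (p, q, r, - p)" using assms(1) by (rule tracelessE)
  obtain x y z where Y: "Y = (x, y, z, - x)" using assms(2) by (rule tracelessE)
  have "X \<star> Y = Y \<star> X" using assms(4) by (simp add: bracket_def)
  then have "p * x + q * z = x * p + y * r" "p * y + q * - x = x * q + y * - p"
      "r * x + - p * z = z * p + - x * r"
    by (simp_all only: X Y mm.simps prod.inject)
  then have eqs: "q * z = r * y" "p * y = q * x" "p * z = r * x"
    by (simp_all add: algebra_simps)
  have "p \<noteq> 0 \<or> q \<noteq> 0 \<or> r \<noteq> 0" using assms(3) by (auto simp: X zero_prod_def)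
  then consider "p \<noteq> 0" | "q \<noteq> 0" | "r \<noteq> 0" by blast
  then show thesis
  proof cases
    case 1 then show thesis using eqs by (intro that[of "x / p"]) (simp add: X Y field_simps)
  next
    case 2 then show thesis using eqs by (intro that[of "y / q"]) (simp add: X Y field_simps)
  next
    case 3 then show thesis using eqs by (intro that[of "z / r"]) (simp add: X Y field_simps)
  qed
qed

text \<open>The analogue of \<open>a \<times> (b \<times> c) = (a \<sqdot> c) b - (a \<sqdot> b) c\<close>.\<close>

lemma bracket_bracket:
  assumes "tr2 X = 0" "tr2 Y = 0" "tr2 Z = 0"
  shows "bracket Z (bracket X Y) = (2 * tr2 (Z \<star> X)) *\<^sub>R Y - (2 * tr2 (Z \<star> Y)) *\<^sub>R X"
proof -
  obtain p q r where X: "X = (p, q, r, - p)" using assms(1) by (rule tracelessE)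
  obtain x y z where Y: "Y = (x, y, z, - x)" using assms(2) by (rule tracelessE)
  obtain u v w where Z: "Z = (u, v, w, - u)" using assms(3) by (rule tracelessE)
  show ?thesis by (simp add: bracket_def X Y Z algebra_simps)
qed

lemma tr2_conj: "tr2 (A \<star> X \<star> adj A) = det2 A * tr2 X"
proof -
  have "tr2 (A \<star> X \<star> adj A) = tr2 (adj A \<star> A \<star> X)"
    by (metis mm_assoc tr2_mm_commute)
  then show ?thesis by (simp add: mm_adj)
qed

lemma conj_conj: "A \<star> (B \<star> X \<star> adj B) \<star> adj A = (A \<star> B) \<star> X \<star> adj (A \<star> B)"
  by (simp add: adj_mm mm_assoc)

lemma adj_conj_conj: "adj A \<star> (A \<star> X \<star> adj A) \<star> A = (det2 A)\<^sup>2 *\<^sub>R X"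
proof -
  have "adj A \<star> (A \<star> X \<star> adj A) \<star> A = (adj A \<star> A) \<star> X \<star> (adj A \<star> A)"
    by (simp add: mm_assoc)
  then show ?thesis by (simp add: mm_adj power2_eq_square)
qed

lemma conj_eq_zero_iff: "det2 A \<noteq> 0 \<Longrightarrow> A \<star> X \<star> adj A = 0 \<longleftrightarrow> X = 0"
  using adj_conj_conj[of A X] by (cases "X = 0") auto

text \<open>\<open>Q\<close> models the full preimage of the semigroup under \<open>mobm\<close>,
  both signs included. That the semigroup is not elementary enters as \<open>irreducible\<close>: no
  line of traceless matrices is invariant under conjugation by all of \<open>Q\<close>.\<close>

locale lifted_semigroup =
  fixes Q :: "mat set"
  assumes Q_pos: "A \<in> Q \<Longrightarrow> det2 A > 0"
    and Q_mult: "A \<in> Q \<Longrightarrow> B \<in> Q \<Longrightarrow> A \<star> B \<in> Q"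
    and Q_scale: "A \<in> Q \<Longrightarrow> r \<noteq> 0 \<Longrightarrow> r *\<^sub>R A \<in> Q"
    and irreducible: "tr2 Z = 0 \<Longrightarrow> Z \<noteq> 0 \<Longrightarrow> \<exists>A\<in>Q. \<forall>k. A \<star> Z \<star> adj A \<noteq> k *\<^sub>R Z"
    and accumulates: "\<exists>f::nat \<Rightarrow> mat. (\<forall>n. f n \<in> Q \<and> det2 (f n) = 1 \<and> f n \<noteq> one2) \<and> f \<longlonglongrightarrow> one2"
begin

section \<open>The relative closure \<open>T\<close> of the lift and its open ideal
  \<open>U\<close>\<close>

definition T :: "mat set" where
  "T = closure Q \<inter> {A. det2 A > 0}"

definition U :: "mat set" where
  "U = interior T"

lemma Q_subset_T: "Q \<subseteq> T"
  using closure_subset Q_pos by (auto simp: T_def simp del: split_paired_All)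

lemma T_pos: "A \<in> T \<Longrightarrow> det2 A > 0"
  by (simp add: T_def)

lemma T_sequence:
  assumes "A \<in> T"
  obtains f where "\<And>n::nat. f n \<in> Q" "f \<longlonglongrightarrow> A"
proof -
  have "A \<in> closure Q" using assms by (simp add: T_def)
  then show thesis unfolding closure_sequential using that by blast
qed

lemma T_mult:
  assumes "A \<in> T" "B \<in> T"
  shows "A \<star> B \<in> T"
proof -
  obtain f g where f: "\<And>n::nat. f n \<in> Q" "f \<longlonglongrightarrow> A" and g: "\<And>n::nat. g n \<in> Q" "g \<longlonglongrightarrow> B"
    using assms by (elim T_sequence) blast
  have "(\<lambda>n. f n \<star> g n) \<longlonglongrightarrow> A \<star> B" by (intro tendsto_intros f g)
  then have "A \<star> B \<in> closure Q"
    unfolding closure_sequential using Q_mult f(1) g(1) by (intro exI[of _ "\<lambda>n. f n \<star> g n"]) simp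
  then show ?thesis using assms by (simp add: T_def)
qed

lemma T_scale:
  assumes "A \<in> T" "r \<noteq> 0"
  shows "r *\<^sub>R A \<in> T"
proof -
  obtain f where f: "\<And>n::nat. f n \<in> Q" "f \<longlonglongrightarrow> A"
    using assms(1) by (elim T_sequence) blast
  have "(\<lambda>n. r *\<^sub>R f n) \<longlonglongrightarrow> r *\<^sub>R A" by (intro tendsto_intros f)
  then have "r *\<^sub>R A \<in> closure Q"
    unfolding closure_sequential using Q_scale f(1) assms(2)
    by (intro exI[of _ "\<lambda>n. r *\<^sub>R f n"]) simp
  then show ?thesis using assms by (simp add: T_def)
qed

lemma U_subset_T: "U \<subseteq> T" and open_U: "open U"
  by (simp_all add: U_def interior_subset)

lemma subset_U: "V \<subseteq> T \<Longrightarrow> open V \<Longrightarrow> V \<subseteq> U"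
  by (simp add: U_def interior_maximal)

lemma U_pos: "A \<in> U \<Longrightarrow> det2 A > 0"
  using U_subset_T T_pos by blast

lemma open_preimage:
  assumes "open V" "continuous_on UNIV f"
  shows "open {A. f A \<in> V}"
  using open_vimage[OF assms] by (simp add: vimage_def)

lemma U_scale:
  assumes "A \<in> U" "r \<noteq> 0"
  shows "r *\<^sub>R A \<in> U"
proof -
  have "{B. (1 / r) *\<^sub>R B \<in> U} \<subseteq> T"
  proof
    fix B assume "B \<in> {B. (1 / r) *\<^sub>R B \<in> U}"
    then have "(1 / r) *\<^sub>R B \<in> T" using U_subset_T by blast
    then have "r *\<^sub>R ((1 / r) *\<^sub>R B) \<in> T" using assms(2) by (rule T_scale)
    then show "B \<in> T" using assms(2) by simp
  qed
  moreover have "open {B. (1 / r) *\<^sub>R B \<in> U}"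
    by (intro open_preimage open_U continuous_intros)
  moreover have "r *\<^sub>R A \<in> {B. (1 / r) *\<^sub>R B \<in> U}" using assms by simp
  ultimately show ?thesis using subset_U by blast
qed

text \<open>Dividing by \<open>A\<close> on the right is continuous, and the preimage of
  \<open>V\<close> under it is an open set which lies in \<open>T\<close> because \<open>T\<close>
  is a semigroup. With its counterpart on the left this makes \<open>U\<close> a two-sided ideal of
  \<open>T\<close>.\<close>

lemma mult_right_open:
  assumes A: "A \<in> T" and V: "V \<subseteq> T" "open V" "B \<in> V"
  shows "B \<star> A \<in> U"
proof -
  let ?W = "{C. (1 / det2 A) *\<^sub>R (C \<star> adj A) \<in> V}"
  have pos: "det2 A > 0" using A by (rule T_pos)
  have "?W \<subseteq> T"
  proof
    fix C assume "C \<in> ?W"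
    then have "((1 / det2 A) *\<^sub>R (C \<star> adj A)) \<star> A \<in> T" using A V(1) T_mult by blast
    then show "C \<in> T" using pos by (simp add: mm_assoc mm_adj)
  qed
  moreover have "open ?W"
    by (intro open_preimage V continuous_intros)
  moreover have "B \<star> A \<in> ?W"
    using V(3) pos by (simp add: mm_assoc mm_adj)
  ultimately show ?thesis using subset_U by blast
qed

lemma U_mult_right: "B \<in> U \<Longrightarrow> A \<in> T \<Longrightarrow> B \<star> A \<in> U"
  using mult_right_open[OF _ U_subset_T open_U] by blast

lemma U_mult_left:
  assumes A: "A \<in> T" and B: "B \<in> U"
  shows "A \<star> B \<in> U"
proof -
  let ?W = "{C. (1 / det2 A) *\<^sub>R (adj A \<star> C) \<in> U}"
  have pos: "det2 A > 0" using A by (rule T_pos)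
  have "?W \<subseteq> T"
  proof
    fix C assume "C \<in> ?W"
    then have "A \<star> ((1 / det2 A) *\<^sub>R (adj A \<star> C)) \<in> T" using A U_subset_T T_mult by blast
    then show "C \<in> T" using pos by (simp add: mm_assoc[symmetric] mm_adj)
  qed
  moreover have "open ?W"
    by (intro open_preimage open_U continuous_intros)
  moreover have "A \<star> B \<in> ?W"
    using B pos by (simp add: mm_assoc[symmetric] mm_adj)
  ultimately show ?thesis using subset_U by blast
qed

lemma one_in_T: "one2 \<in> T"
proof -
  obtain f where "\<And>n::nat. f n \<in> Q" "f \<longlonglongrightarrow> one2" using accumulates by blast
  then have "one2 \<in> closure Q" unfolding closure_sequential by blast
  then show ?thesis by (simp add: T_def)
qed

text \<open>\<open>X\<close> is a limit, by compactness of the sphere, of the normalised directions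
  in which lifts approach \<open>one2\<close>; high powers of these lifts then follow the
  one-parameter group of \<open>X\<close>.\<close>

lemma infinitesimal_generator:
  obtains X where "tr2 X = 0" "X \<noteq> 0" "\<And>E t. one_parameter X E \<Longrightarrow> t \<ge> 0 \<Longrightarrow> E t \<in> T"
proof -
  obtain f where f: "\<And>n::nat. f n \<in> Q" "\<And>n. det2 (f n) = 1" "\<And>n. f n \<noteq> one2" "f \<longlonglongrightarrow> one2"
    using accumulates by blast
  define Y where "Y n = (1 / norm (f n - one2)) *\<^sub>R (f n - one2)" for n
  have "\<forall>n. Y n \<in> sphere 0 1" using f(3) by (simp add: Y_def)
  then obtain X \<rho> where X: "X \<in> sphere 0 1" "strict_mono (\<rho> :: nat \<Rightarrow> nat)" "(Y \<circ> \<rho>) \<longlonglongrightarrow> X"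
    using compact_sphere[of "0 :: mat" 1] unfolding compact_def by metis
  define g where "g = f \<circ> \<rho>"
  have g: "\<And>n. g n \<in> Q" "\<And>n. det2 (g n) = 1" "\<And>n. g n \<noteq> one2" "g \<longlonglongrightarrow> one2"
    using f LIMSEQ_subseq_LIMSEQ[OF f(4) X(2)] by (simp_all add: g_def)
  have dir: "(\<lambda>n. (1 / norm (g n - one2)) *\<^sub>R (g n - one2)) \<longlonglongrightarrow> X"
    using X(3) by (simp add: Y_def g_def comp_def)
  \<comment> \<open>As \<open>g n\<close> has determinant 1, the trace of \<open>g n - one2\<close>
    is minus its determinant and so quadratically small; hence the limit direction is
    traceless.\<close>
  have tr: "tr2 ((1 / norm (g n - one2)) *\<^sub>R (g n - one2)) = - norm (g n - one2) * det2 ((1 / norm (g n - one2)) *\<^sub>R (g n - one2))" for n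
  proof -
    have "tr2 (A - one2) + det2 (A - one2) = det2 A - 1" for A
      by (cases A rule: prod_cases4) (simp add: one2_def algebra_simps)
    from this[of "g n"] have 1: "tr2 (g n - one2) = - det2 (g n - one2)" using g(2) by simp
    have "tr2 ((1 / \<eta>) *\<^sub>R V) = - \<eta> * det2 ((1 / \<eta>) *\<^sub>R V)" if "\<eta> > 0" "tr2 V = - det2 V" for \<eta> V
      using that by (simp add: field_simps power2_eq_square)
    from this[OF _ 1] g(3) show ?thesis by simp
  qed
  have "(\<lambda>n. - norm (g n - one2) * det2 ((1 / norm (g n - one2)) *\<^sub>R (g n - one2))) \<longlonglongrightarrow> - norm (one2 - one2) * det2 X"
    by (intro tendsto_intros dir g)
  then have "(\<lambda>n. tr2 ((1 / norm (g n - one2)) *\<^sub>R (g n - one2))) \<longlonglongrightarrow> 0"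
    unfolding tr by simp
  moreover have "(\<lambda>n. tr2 ((1 / norm (g n - one2)) *\<^sub>R (g n - one2))) \<longlonglongrightarrow> tr2 X"
    by (intro tendsto_intros dir)
  ultimately have "tr2 X = 0" using LIMSEQ_unique by blast
  moreover have "X \<noteq> 0" using X(1) by auto
  moreover have "E t \<in> T" if E: "one_parameter X E" and t: "t \<ge> 0" for E t
  proof (cases "t = 0")
    case True
    then show ?thesis using one_in_T one_parameter.E_0[OF E] by simp
  next
    case False
    then show ?thesis
      using one_parameter.in_closure_powers[OF E g(1) Q_mult g(4,3) dir, of t] t
        one_parameter.det2_E[OF E] by (simp add: T_def)
  qed
  ultimately show ?thesis by (rule that)
qed

text \<open>An orbit inside the orthogonal complement of \<open>Z\<close> contains two independent
  elements, whose common complement is a line. That line contains \<open>Z\<close>, and also every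
  \<open>adj A \<star> Z \<star> A\<close>, so conjugation would preserve the line of
  \<open>Z\<close>, against \<open>irreducible\<close>.\<close>

lemma not_orthogonal_orbit:
  assumes Z: "tr2 Z = 0" "Z \<noteq> 0" and X: "tr2 X = 0" "X \<noteq> 0"
  shows "\<exists>A\<in>Q. tr2 (Z \<star> (A \<star> X \<star> adj A)) \<noteq> 0"
proof (rule ccontr)
  assume "\<not> ?thesis"
  then have orth: "tr2 (Z \<star> (A \<star> X \<star> adj A)) = 0" if "A \<in> Q" for A using that by blast
  obtain A0 where A0: "A0 \<in> Q" using irreducible[OF X] by blast
  \<comment> \<open>\<open>X\<close> itself may lie outside the orbit, since \<open>Q\<close> is not
    assumed to contain \<open>one2\<close>.\<close>
  define X' where "X' = A0 \<star> X \<star> adj A0"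
  have X': "tr2 X' = 0" "X' \<noteq> 0"
    using X Q_pos[OF A0] by (simp_all add: X'_def tr2_conj conj_eq_zero_iff)
  obtain B where B: "B \<in> Q" "\<And>k. B \<star> X' \<star> adj B \<noteq> k *\<^sub>R X'" using irreducible[OF X'] by blast
  define X'' where "X'' = B \<star> X' \<star> adj B"
  have X'': "tr2 X'' = 0" using X' by (simp add: X''_def tr2_conj)
  define N where "N = bracket X' X''"
  have N: "tr2 N = 0" "N \<noteq> 0"
    using parallel_if_bracket_eq_zero[OF X'(1) X'' X'(2)] B(2) by (auto simp: N_def X''_def)
  \<comment> \<open>By the double bracket formula, whatever is orthogonal to \<open>X'\<close> and
    \<open>X''\<close> commutes with \<open>N\<close>, hence is a multiple of it.\<close>
  have par: "\<exists>k. W = k *\<^sub>R N" if W: "tr2 W = 0" "tr2 (W \<star> X') = 0" "tr2 (W \<star> X'') = 0" for W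
  proof -
    have "bracket W N = 0" unfolding N_def by (simp add: bracket_bracket X' X'' W)
    then have "bracket N W = 0" by (simp add: bracket_def)
    then show ?thesis using parallel_if_bracket_eq_zero[OF N(1) W(1) N(2)] by blast
  qed
  have A0': "B \<star> A0 \<in> Q" using A0 B Q_mult by simp
  obtain k where k: "Z = k *\<^sub>R N"
    using par[of Z] Z orth[OF A0] orth[OF A0'] by (auto simp: X''_def X'_def conj_conj)
  then have "k \<noteq> 0" using Z by auto
  obtain A where A: "A \<in> Q" "\<And>k. A \<star> Z \<star> adj A \<noteq> k *\<^sub>R Z" using irreducible[OF Z] by blast
  define W where "W = adj A \<star> Z \<star> A"
  have move: "tr2 (W \<star> V) = tr2 (Z \<star> (A \<star> V \<star> adj A))" for V
    unfolding W_def by (metis mm_assoc tr2_mm_commute)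
  have "tr2 W = 0" using Z tr2_conj[of "adj A" Z] by (simp add: W_def)
  moreover have "tr2 (W \<star> X') = 0" "tr2 (W \<star> X'') = 0"
    unfolding move X''_def X'_def conj_conj using A A0 A0' B by (auto intro!: orth Q_mult)
  ultimately obtain l where l: "W = l *\<^sub>R N" using par by blast
  have pos: "det2 A > 0" using A Q_pos by blast
  have "A \<star> W \<star> adj A = (det2 A)\<^sup>2 *\<^sub>R Z"
    using adj_conj_conj[of "adj A" Z] by (simp add: W_def)
  then have eq: "(det2 A)\<^sup>2 *\<^sub>R Z = (l / k) *\<^sub>R (A \<star> Z \<star> adj A)"
    using k \<open>k \<noteq> 0\<close> by (simp add: l)
  then have "l / k \<noteq> 0" using Z(2) pos by auto
  then have "A \<star> Z \<star> adj A = (k / l) *\<^sub>R ((l / k) *\<^sub>R (A \<star> Z \<star> adj A))" by simp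
  also have "\<dots> = (k / l * (det2 A)\<^sup>2) *\<^sub>R Z" by (simp add: eq[symmetric])
  finally show False using A(2) by blast
qed

end

section \<open>Interior points of \<open>T\<close>\<close>

context lifted_semigroup
begin

text \<open>
  Multiplying out \<open>s E(t\<^sub>1) h\<^sub>1 E(t\<^sub>2) h\<^sub>2 E(t\<^sub>3)\<close>, irreducibility makes the four partial derivatives at
  \<open>(1, 0, 0, 0)\<close> independent for suitable \<open>h\<^sub>1\<close>, \<open>h\<^sub>2\<close>. Both are taken from \<open>E(1) Q\<close>, so that small
  negative parameters do not lead out of \<open>T\<close>.
\<close>

lemma U_nonempty: "U \<noteq> {}"
proof -
  obtain X where X: "tr2 X = 0" "X \<noteq> 0" and ET: "\<And>E t. one_parameter X E \<Longrightarrow> t \<ge> 0 \<Longrightarrow> E t \<in> T"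
    using infinitesimal_generator by metis
  obtain E where E: "one_parameter X E"
    using one_parameter_exists[OF X] by metis
  interpret one_parameter X E by (rule E)
  define E1 where "E1 = E 1"
  have E1: "det2 E1 = 1" by (simp add: E1_def)
  have "adj E1 \<star> X \<star> E1 = adj E1 \<star> E1 \<star> X"
    using E_commute[of 1] by (simp add: mm_assoc E1_def)
  \<comment> \<open>Thus the extra factor \<open>E1\<close> fixes \<open>X\<close> under conjugation
    and cannot destroy the independence provided by \<open>h1'\<close>.\<close>
  then have conj_E1: "adj E1 \<star> X \<star> E1 = X" using E1 by (simp add: mm_adj)
  obtain h1' where h1': "h1' \<in> Q" "\<And>k. h1' \<star> X \<star> adj h1' \<noteq> k *\<^sub>R X" using irreducible[OF X] by blast
  define h1 where "h1 = E1 \<star> h1'"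
  have h1_pos: "det2 h1 > 0" using h1' Q_pos E1 by (simp add: h1_def)
  define Y where "Y = h1 \<star> X \<star> adj h1"
  have Y_par: "Y \<noteq> k *\<^sub>R X" for k
  proof
    assume "Y = k *\<^sub>R X"
    then have "adj E1 \<star> Y \<star> E1 = k *\<^sub>R X" by (simp add: conj_E1)
    moreover have "adj E1 \<star> Y \<star> E1 = h1' \<star> X \<star> adj h1'"
      using adj_conj_conj[of E1 "h1' \<star> X \<star> adj h1'"] E1 by (simp add: Y_def h1_def conj_conj)
    ultimately show False using h1' by simp
  qed
  have Y: "tr2 Y = 0" using X by (simp add: Y_def tr2_conj)
  define N where "N = bracket X Y"
  have N: "tr2 N = 0" "N \<noteq> 0" "tr2 (N \<star> X) = 0" "tr2 (N \<star> Y) = 0"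
    using parallel_if_bracket_eq_zero[OF X(1) Y X(2)] Y_par by (auto simp: N_def)
  define g where "g = h1 \<star> E1"
  have g_pos: "det2 g > 0" using h1_pos E1 by (simp add: g_def)
  \<comment> \<open>\<open>N\<close> is normal to the plane of \<open>X\<close> and
    \<open>Y\<close>. Pulled back by \<open>g\<close> it is still a nonzero traceless matrix, so
    \<open>h2'\<close> can be chosen such that \<open>W\<close> below leaves that plane.\<close>
  have "tr2 (adj g \<star> N \<star> g) = 0" "adj g \<star> N \<star> g \<noteq> 0"
    using N g_pos tr2_conj[of "adj g" N] conj_eq_zero_iff[of "adj g" N] by simp_all
  then obtain h2' where h2': "h2' \<in> Q" "tr2 (adj g \<star> N \<star> g \<star> (h2' \<star> X \<star> adj h2')) \<noteq> 0"
    using not_orthogonal_orbit[OF _ _ X] by blast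
  define h2 where "h2 = E1 \<star> h2'"
  have h2_pos: "det2 h2 > 0" using h2' Q_pos E1 by (simp add: h2_def)
  define H where "H = h1 \<star> h2"
  define D where "D = det2 H"
  have D_pos: "D > 0" using h1_pos h2_pos by (simp add: D_def H_def)
  define W where "W = H \<star> X \<star> adj H"
  have "tr2 (N \<star> W) = tr2 (adj g \<star> N \<star> g \<star> (h2' \<star> X \<star> adj h2'))"
  proof -
    have "N \<star> W = N \<star> g \<star> (h2' \<star> X \<star> adj h2') \<star> adj g"
      by (simp add: W_def H_def h2_def g_def adj_mm mm_assoc)
    then show ?thesis by (metis mm_assoc tr2_mm_commute)
  qed
  then have NW: "tr2 (N \<star> W) \<noteq> 0" using h2' by simp
  define F where "F v = fst v *\<^sub>R (E (fst (snd v)) \<star> h1 \<star> E (fst (snd (snd v))) \<star> h2 \<star> E (snd (snd (snd v))))"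
    for v :: mat
  define F' where "F' v = fst v *\<^sub>R (h1 \<star> h2) + (fst (snd v) *\<^sub>R X \<star> h1 \<star> h2
      + h1 \<star> fst (snd (snd v)) *\<^sub>R X \<star> h2 + h1 \<star> h2 \<star> snd (snd (snd v)) *\<^sub>R X)" for v :: mat
  define x0 :: mat where "x0 = (1, 0, 0, 0)"
  have E_comp: "((\<lambda>v. E (\<pi> v)) has_derivative (\<lambda>h. \<pi> h *\<^sub>R X)) (at x0)"
    if "bounded_linear \<pi>" "\<pi> x0 = 0" for \<pi> :: "mat \<Rightarrow> real"
  proof -
    have "(\<pi> has_derivative \<pi>) (at x0)" using that(1) by (rule bounded_linear_imp_has_derivative)
    moreover have "(E has_derivative (\<lambda>h. h *\<^sub>R X)) (at (\<pi> x0))" using that(2) E_deriv by simp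
    ultimately show ?thesis by (rule has_derivative_compose)
  qed
  note mm_deriv = bounded_bilinear.FDERIV[OF bounded_bilinear_mm]
  have d1: "((\<lambda>v. E (fst (snd v))) has_derivative (\<lambda>h. fst (snd h) *\<^sub>R X)) (at x0)"
    and d2: "((\<lambda>v. E (fst (snd (snd v)))) has_derivative (\<lambda>h. fst (snd (snd h)) *\<^sub>R X)) (at x0)"
    and d3: "((\<lambda>v. E (snd (snd (snd v)))) has_derivative (\<lambda>h. snd (snd (snd h)) *\<^sub>R X)) (at x0)"
    by (rule E_comp; simp add: x0_def bounded_linear_intros)+
  have F_deriv: "(F has_derivative F') (at x0)"
  proof -
    have d4: "((\<lambda>v. E (fst (snd v)) \<star> h1 \<star> E (fst (snd (snd v))) \<star> h2 \<star> E (snd (snd (snd v)))) has_derivative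
       (\<lambda>v. fst (snd v) *\<^sub>R X \<star> h1 \<star> h2
      + h1 \<star> fst (snd (snd v)) *\<^sub>R X \<star> h2 + h1 \<star> h2 \<star> snd (snd (snd v)) *\<^sub>R X)) (at x0)"
      by (rule has_derivative_eq_rhs,
          (rule mm_deriv d1 d2 d3 has_derivative_const)+)
         (simp add: x0_def mm_add_left mm_add_right fun_eq_iff)
    have d5: "((\<lambda>v::mat. fst v) has_derivative fst) (at x0)"
      by (intro bounded_linear_imp_has_derivative bounded_linear_fst)
    show ?thesis
      unfolding F_def[abs_def] F'_def[abs_def]
      by (rule has_derivative_eq_rhs[OF has_derivative_scaleR[OF d5 d4]])
         (simp add: x0_def fun_eq_iff add.commute)
  qed
  have lin: "linear F'"
    using has_derivative_bounded_linear[OF F_deriv] by (simp add: linear_conv_bounded_linear)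
  have "inj F'"
    unfolding linear_injective_0[OF lin]
  proof (intro allI impI)
    fix v :: mat assume F'0: "F' v = 0"
    obtain s t1 t2 t3 where v: "v = (s, t1, t2, t3)" by (cases v rule: prod_cases4)
    \<comment> \<open>Multiplying by \<open>adj H\<close> turns the four partial derivatives into
      positive multiples of \<open>one2\<close>, \<open>X\<close>, \<open>Y\<close> and
      \<open>W\<close>. The trace isolates the first of them, pairing with \<open>N\<close> the
      last.\<close>
    have "F' v \<star> adj H = (s * D) *\<^sub>R one2 + ((t1 * D) *\<^sub>R X + (t2 * det2 h2) *\<^sub>R Y + t3 *\<^sub>R W)"
    proof -
      have 1: "h1 \<star> h2 \<star> adj H = D *\<^sub>R one2" using mm_adj(1)[of H] by (simp add: H_def D_def)
      have 2: "X \<star> h1 \<star> h2 \<star> adj H = D *\<^sub>R X" using 1 by (simp add: mm_assoc)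
      have "h1 \<star> X \<star> h2 \<star> adj H = h1 \<star> X \<star> (h2 \<star> adj h2) \<star> adj h1"
        by (simp add: H_def adj_mm mm_assoc)
      then have 3: "h1 \<star> X \<star> h2 \<star> adj H = det2 h2 *\<^sub>R Y" by (simp add: mm_adj Y_def)
      have 4: "h1 \<star> h2 \<star> X \<star> adj H = W" by (simp add: W_def H_def)
      show ?thesis by (simp add: F'_def v mm_add_left 1 2 3 4)
    qed
    then have eq: "(s * D) *\<^sub>R one2 + ((t1 * D) *\<^sub>R X + (t2 * det2 h2) *\<^sub>R Y + t3 *\<^sub>R W) = 0"
      by (simp add: F'0)
    have "tr2 W = 0" using X by (simp add: W_def tr2_conj)
    moreover have "tr2 (one2) = 2" by (simp add: one2_def)
    moreover have tr0: "tr2 0 = 0" using linear_0[OF linear_tr2] .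
    ultimately have "s * D = 0" using arg_cong[OF eq, of tr2] X Y by simp
    then have s: "s = 0" using D_pos by simp
    have "tr2 (N \<star> ((s * D) *\<^sub>R one2 + ((t1 * D) *\<^sub>R X + (t2 * det2 h2) *\<^sub>R Y + t3 *\<^sub>R W))) = 0"
      unfolding eq by (simp add: tr0)
    then have "t3 * tr2 (N \<star> W) = 0" using s N by (simp add: mm_add_right)
    then have t3: "t3 = 0" using NW by simp
    have eq: "(t1 * D) *\<^sub>R X + (t2 * det2 h2) *\<^sub>R Y = 0" using eq s t3 by simp
    have t2: "t2 = 0"
    proof (rule ccontr)
      assume "t2 \<noteq> 0"
      have "Y = (1 / (t2 * det2 h2)) *\<^sub>R ((t2 * det2 h2) *\<^sub>R Y)" using \<open>t2 \<noteq> 0\<close> h2_pos by simp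
      also have "(t2 * det2 h2) *\<^sub>R Y = (- t1 * D) *\<^sub>R X" using eq by (simp add: eq_neg_iff_add_eq_0 add.commute)
      finally have "Y = (1 / (t2 * det2 h2) * (- t1 * D)) *\<^sub>R X" by (simp only: scaleR_scaleR)
      then show False using Y_par by blast
    qed
    have "t1 = 0" using eq t2 X D_pos by simp
    with s t2 t3 show "v = 0" by (simp add: v zero_prod_def)
  qed
  then have "surj F'" using lin linear_injective_imp_surjective by blast
  then obtain G where G: "linear G" "F' \<circ> G = id" using linear_surjective_right_inverse[OF lin] by blast
  define Tset :: "mat set" where "Tset = {v. fst v > 0 \<and> \<bar>fst (snd v)\<bar> < 1 \<and> \<bar>fst (snd (snd v))\<bar> < 1 \<and> \<bar>snd (snd (snd v))\<bar> < 1}"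
  have "open Tset" unfolding Tset_def
    by (intro open_Collect_conj open_Collect_less continuous_intros)
  moreover have "x0 \<in> Tset" by (simp add: x0_def Tset_def)
  moreover have "continuous_on UNIV F" unfolding F_def by (intro continuous_intros)
  \<comment> \<open>This form of the open mapping theorem asks for the derivative at
    \<open>x0\<close> alone, which is what \<open>E_deriv\<close> supplies.\<close>
  ultimately have "F x0 \<in> interior (F ` Tset)"
    using G F_deriv
    by (intro sussmann_open_mapping[of UNIV F x0 F' G Tset])
       (auto simp: interior_open linear_conv_bounded_linear)
  moreover have "F v \<star> E1 \<in> T" if "v \<in> Tset" for v
  proof -
    obtain s t1 t2 t3 where v: "v = (s, t1, t2, t3)" by (cases v rule: prod_cases4)
    have st: "s > 0" "t1 + 1 \<ge> 0" "t2 + 1 \<ge> 0" "t3 + 1 \<ge> 0" using that by (auto simp: Tset_def v)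
    \<comment> \<open>The factors \<open>E1\<close> at the left of \<open>h1\<close> and
      \<open>h2\<close> and the one at the far right shift all three times by 1, which makes them
      nonnegative on \<open>Tset\<close>.\<close>
    have "F v \<star> E1 = s *\<^sub>R (E (t1 + 1) \<star> h1' \<star> E (t2 + 1) \<star> h2' \<star> E (t3 + 1))"
      by (simp add: F_def v h1_def h2_def E1_def E_add mm_assoc)
    also have "\<dots> \<in> T"
      using st h1'(1) h2'(1) Q_subset_T ET[OF E] by (intro T_scale T_mult) auto
    finally show ?thesis .
  qed
  moreover have "E1 \<in> T" using ET[OF E, of 1] by (simp add: E1_def)
  ultimately have "F x0 \<star> E1 \<in> interior ((\<lambda>A. A \<star> E1) ` F ` Tset)"
  proof -
    have "open {B. B \<star> adj E1 \<in> interior (F ` Tset)}"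
      by (intro open_preimage open_interior continuous_intros)
    moreover have "{B. B \<star> adj E1 \<in> interior (F ` Tset)} \<subseteq> (\<lambda>A. A \<star> E1) ` F ` Tset"
    proof
      fix B assume "B \<in> {B. B \<star> adj E1 \<in> interior (F ` Tset)}"
      then have "B \<star> adj E1 \<in> F ` Tset" using interior_subset by blast
      moreover have "B = B \<star> adj E1 \<star> E1" using E1 by (simp add: mm_assoc mm_adj)
      ultimately show "B \<in> (\<lambda>A. A \<star> E1) ` F ` Tset" by blast
    qed
    moreover have "F x0 \<star> E1 \<star> adj E1 = F x0" using E1 by (simp add: mm_assoc mm_adj)
    ultimately show ?thesis
      using \<open>F x0 \<in> interior (F ` Tset)\<close> by (intro interiorI[of "{B. B \<star> adj E1 \<in> interior (F ` Tset)}"]) auto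
  qed
  moreover have "(\<lambda>A. A \<star> E1) ` F ` Tset \<subseteq> T"
    using \<open>\<And>v. v \<in> Tset \<Longrightarrow> F v \<star> E1 \<in> T\<close> by blast
  ultimately have "F x0 \<star> E1 \<in> U"
    unfolding U_def using interior_mono by blast
  then show ?thesis by blast
qed

end

section \<open>Consequences of a non-hyperbolic element of \<open>U\<close>\<close>

context lifted_semigroup
begin

lemma eventually_in_U:
  assumes "A \<in> U" "f \<longlonglongrightarrow> A"
  shows "\<forall>\<^sub>F n in sequentially. f n \<in> U"
  using topological_tendstoD[OF assms(2) open_U assms(1)] .

text \<open>Every unipotent matrix is a power of one close to \<open>one2\<close>, so
  \<open>T\<close> contains all upper and lower unipotents; these generate SL(2), and scalars give
  the rest.\<close>

lemma T_eq_if_one_in_U: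
  assumes "one2 \<in> U"
  shows "{A. det2 A > 0} \<subseteq> T"
proof -
  have powers: "\<gamma> x \<in> T"
    if \<gamma>: "\<gamma> 0 = one2" "\<And>x y. \<gamma> (x + y) = \<gamma> x \<star> \<gamma> y" "\<And>f. f \<longlonglongrightarrow> 0 \<Longrightarrow> (\<lambda>n. \<gamma> (f n)) \<longlonglongrightarrow> \<gamma> 0"
    for \<gamma> :: "real \<Rightarrow> mat" and x
  proof -
    have "(\<lambda>n. x * inverse (real (Suc n))) \<longlonglongrightarrow> x * 0"
      by (intro tendsto_intros LIMSEQ_inverse_real_of_nat)
    then have "(\<lambda>n. \<gamma> (x * inverse (real (Suc n)))) \<longlonglongrightarrow> one2"
      using \<gamma>(3) \<gamma>(1) by simp
    from eventually_in_U[OF assms this] obtain n where n: "\<gamma> (x * inverse (real (Suc n))) \<in> U"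
      unfolding eventually_sequentially by blast
    have "\<gamma> (real m * (x * inverse (real (Suc n)))) \<in> T" for m
    proof (induction m)
      case 0
      then show ?case using \<gamma>(1) one_in_T by simp
    next
      case (Suc m)
      have eq: "\<gamma> (real (Suc m) * (x * inverse (real (Suc n))))
        = \<gamma> (x * inverse (real (Suc n))) \<star> \<gamma> (real m * (x * inverse (real (Suc n))))"
        by (simp only: \<gamma>(2)[symmetric] of_nat_Suc distrib_right mult_1_left)
      have "\<gamma> (x * inverse (real (Suc n))) \<in> T" using n U_subset_T by blast
      then show ?case unfolding eq using Suc by (rule T_mult)
    qed
    from this[of "Suc n"] show ?thesis by (simp add: field_simps del: of_nat_Suc)
  qed
  have up: "(1, x, 0, 1) \<in> T" for x
    using powers[of "\<lambda>x. (1, x, 0, 1)"] by (simp add: one2_def tendsto_Pair)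
  have low: "(1, 0, x, 1) \<in> T" for x
    using powers[of "\<lambda>x. (1, 0, x, 1)"] by (simp add: one2_def tendsto_Pair)
  have gen: "(a, b, c, d) \<in> T" if "a * d - b * c = 1" "c \<noteq> 0" for a b c d
  proof -
    have eq: "(a, b, c, d) = (1, (a - 1) / c, 0, 1) \<star> (1, 0, c, 1) \<star> (1, (d - 1) / c, 0, 1)"
      using that by (simp add: field_simps)
    show ?thesis by (subst eq) (intro T_mult up low)
  qed
  have "A \<in> T" if A: "det2 A = 1" for A
  proof -
    obtain a b c d where Adef: "A = (a, b, c, d)" by (cases A rule: prod_cases4)
    show ?thesis
    proof (cases "c = 0")
      case False
      then show ?thesis using gen A by (simp add: Adef)
    next
      case True
      then have "d \<noteq> 0" using A by (auto simp: Adef)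
      \<comment> \<open>A lower unipotent factor makes the vanishing lower left entry equal to
        \<open>d\<close>, which is nonzero; the next line undoes this.\<close>
      then have "(a + b, b, d, d) \<in> T" using A True by (intro gen) (auto simp: Adef algebra_simps)
      then have "(a + b, b, d, d) \<star> (1, 0, -1, 1) \<in> T" using T_mult low by blast
      then show ?thesis by (simp add: Adef True)
    qed
  qed
  moreover have "A = sqrt (det2 A) *\<^sub>R ((1 / sqrt (det2 A)) *\<^sub>R A)" if "det2 A > 0" for A
    using that by simp
  moreover have "det2 ((1 / sqrt (det2 A)) *\<^sub>R A) = 1" if "det2 A > 0" for A
    unfolding det2_scaleR using that by (simp add: power_divide)
  ultimately show ?thesis
    using T_scale by (metis (no_types, lifting) less_irrefl mem_Collect_eq real_sqrt_eq_zero_cancel_iff subsetI)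
qed

text \<open>Normalised, \<open>A\<close> is a rotation by some angle \<open>\<theta>\<close> in
  suitable coordinates. As \<open>U\<close> is open, \<open>\<theta>\<close> can be replaced by a
  rational multiple of pi, and a power of that rotation is \<open>one2\<close> or
  \<open>- one2\<close>.\<close>

lemma one_in_U_if_elliptic:
  assumes "A \<in> U" "(tr2 A)\<^sup>2 < 4 * det2 A"
  shows "one2 \<in> U"
proof -
  define B where "B = (1 / sqrt (det2 A)) *\<^sub>R A"
  have pos: "det2 A > 0" using assms U_pos by blast
  have BU: "B \<in> U" using assms U_scale pos by (simp add: B_def)
  have B1: "det2 B = 1" unfolding B_def det2_scaleR using pos by (simp add: power_divide)
  have "(tr2 B)\<^sup>2 < 4"
    unfolding B_def tr2_scaleR using assms pos by (simp add: power_mult_distrib power_divide pos_divide_less_eq)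
  then have "(tr2 B / 2)\<^sup>2 < 1" by (simp add: power_divide)
  then have tr: "\<bar>tr2 B / 2\<bar> < 1" by (simp only: abs_square_less_1)
  define \<theta> where "\<theta> = arccos (tr2 B / 2)"
  have \<theta>: "0 < \<theta>" "\<theta> < pi" "cos \<theta> = tr2 B / 2"
    using tr arccos_lt_bounded[of "tr2 B / 2"] by (auto simp: \<theta>_def)
  have s: "sin \<theta> > 0" using \<theta> by (simp add: sin_gt_zero)
  \<comment> \<open>The complex structure of the rotation:
    \<open>J \<star> J = - one2\<close>.\<close>
  define J where "J = (1 / sin \<theta>) *\<^sub>R (B - cos \<theta> *\<^sub>R one2)"
  have J0: "tr2 J = 0" using \<theta> by (simp add: J_def) (simp add: one2_def)
  have BJ: "B = cos \<theta> *\<^sub>R one2 + sin \<theta> *\<^sub>R J" using s by (simp add: J_def)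
  have "1 = (cos \<theta>)\<^sup>2 + (sin \<theta>)\<^sup>2 * det2 J"
    using B1 det2_one_add[OF J0, of "cos \<theta>" "sin \<theta>"] by (simp flip: BJ)
  then have "(sin \<theta>)\<^sup>2 * (det2 J - 1) = 0"
    unfolding cos_squared_eq by (simp add: right_diff_distrib)
  then have J1: "det2 J = 1" using s by simp
  define E where "E t = cos t *\<^sub>R one2 + sin t *\<^sub>R J" for t
  interpret one_parameter J E
    unfolding E_def
    by (intro one_parameterI[OF J0]) (auto intro!: derivative_eq_intros simp: J1 cos_add sin_add)
  \<comment> \<open>The largest integer multiple of pi / (n + 1) that does not exceed
    \<open>\<theta>\<close>.\<close>
  define \<phi> where "\<phi> n = pi * of_int \<lfloor>real (Suc n) * \<theta> / pi\<rfloor> / real (Suc n)" for n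
  have "\<phi> \<longlonglongrightarrow> \<theta>"
  proof (rule tendsto_sandwich)
    have "\<theta> - pi * inverse (real (Suc n)) \<le> \<phi> n" "\<phi> n \<le> \<theta>" for n
    proof -
      define N where "N = real (Suc n)"
      define z where "z = real_of_int \<lfloor>N * \<theta> / pi\<rfloor>"
      have N: "N > 0" by (simp add: N_def)
      have "N * \<theta> / pi - 1 \<le> z" "z \<le> N * \<theta> / pi" unfolding z_def by linarith+
      then have "N * \<theta> - pi \<le> pi * z" "pi * z \<le> N * \<theta>"
        using pi_gt_zero by (simp_all add: field_simps)
      then have "(N * \<theta> - pi) / N \<le> pi * z / N" "pi * z / N \<le> (N * \<theta>) / N"
        using N by (simp_all only: divide_right_mono less_imp_le)
      moreover have "(N * \<theta> - pi) / N = \<theta> - pi * inverse N" "(N * \<theta>) / N = \<theta>"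
        using N by (simp_all add: field_simps)
      ultimately have "\<theta> - pi * inverse N \<le> pi * z / N" "pi * z / N \<le> \<theta>"
        by (simp_all only:)
      then show "\<theta> - pi * inverse (real (Suc n)) \<le> \<phi> n" "\<phi> n \<le> \<theta>"
        unfolding \<phi>_def N_def z_def by simp_all
    qed
    then show "\<forall>\<^sub>F n in sequentially. \<theta> - pi * inverse (real (Suc n)) \<le> \<phi> n"
      "\<forall>\<^sub>F n in sequentially. \<phi> n \<le> \<theta>" by (simp_all only: eventually_True)
    have "(\<lambda>n. \<theta> - pi * inverse (real (Suc n))) \<longlonglongrightarrow> \<theta> - pi * 0"
      by (intro tendsto_intros LIMSEQ_inverse_real_of_nat)
    then show "(\<lambda>n. \<theta> - pi * inverse (real (Suc n))) \<longlonglongrightarrow> \<theta>" by simp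
  qed simp
  then have "(\<lambda>n. E (\<phi> n)) \<longlonglongrightarrow> E \<theta>" by (rule isCont_tendsto_compose[OF isCont_E])
  moreover have "E \<theta> = B" by (simp add: E_def BJ)
  ultimately have "\<forall>\<^sub>F n in sequentially. E (\<phi> n) \<in> U" using BU eventually_in_U by simp
  then obtain n where n: "E (\<phi> n) \<in> U" unfolding eventually_sequentially by blast
  \<comment> \<open>Exponents start at 1: whether the power with exponent 0 lies in \<open>U\<close>
    is the question.\<close>
  have "E (real (Suc m) * \<phi> n) \<in> U" for m
  proof (induction m)
    case 0
    then show ?case using n by simp
  next
    case (Suc m)
    have eq: "real (Suc (Suc m)) * \<phi> n = \<phi> n + real (Suc m) * \<phi> n" by (simp add: algebra_simps)
    have "E (\<phi> n) \<star> E (real (Suc m) * \<phi> n) \<in> U" using Suc n U_mult_right U_subset_T by blast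
    then show ?case by (simp only: eq E_add)
  qed
  from this[of n] have "E (pi * of_int \<lfloor>real (Suc n) * \<theta> / pi\<rfloor>) \<in> U"
    by (simp add: \<phi>_def del: of_nat_Suc)
  moreover have "sin (pi * of_int i) = 0" for i :: int
    by (metis mult.commute sin_zero_iff_int2)
  moreover from this have "cos (pi * of_int i) = 1 \<or> cos (pi * of_int i) = -1" for i :: int
    by (metis sin_zero_abs_cos_one abs_eq_iff abs_one)
  ultimately have "one2 \<in> U \<or> - one2 \<in> U" unfolding E_def
    by (metis (no_types, lifting) add.right_neutral scaleR_minus1_left scaleR_one scaleR_zero_left)
  then show ?thesis using U_scale[of "- one2" "-1"] by auto
qed

text \<open>Adding a multiple \<open>e\<close> of \<open>(0, 1, -1, 0)\<close> keeps the trace and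
  changes the discriminant by \<open>4 * (e * (c - b)) - 4 * e\<^sup>2\<close>. The sign
  \<open>\<sigma>\<close> makes the linear term nonpositive, so a parabolic matrix becomes
  elliptic.\<close>

lemma one_in_U_if_not_hyperbolic:
  assumes A: "A \<in> U" "(tr2 A)\<^sup>2 \<le> 4 * det2 A"
  shows "one2 \<in> U"
proof -
  obtain a b c d where Adef: "A = (a, b, c, d)" by (cases A rule: prod_cases4)
  define \<sigma> :: real where "\<sigma> = (if c \<ge> b then -1 else 1)"
  define e where "e n = \<sigma> * inverse (real (Suc n))" for n
  have "(\<lambda>n. e n) \<longlonglongrightarrow> \<sigma> * 0"
    unfolding e_def by (intro tendsto_intros LIMSEQ_inverse_real_of_nat)
  then have "(\<lambda>n. A + e n *\<^sub>R (0, 1, -1, 0)) \<longlonglongrightarrow> A + 0 *\<^sub>R (0, 1, -1, 0)"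
    by (intro tendsto_intros) simp
  then have "(\<lambda>n. A + e n *\<^sub>R (0, 1, -1, 0)) \<longlonglongrightarrow> A"
    by (simp only: scaleR_zero_left add_0_right)
  from eventually_in_U[OF A(1) this] obtain n where n: "A + e n *\<^sub>R (0, 1, -1, 0) \<in> U"
    unfolding eventually_sequentially by blast
  have "e n * (c - b) \<le> 0"
    unfolding e_def \<sigma>_def by (auto simp: mult_le_0_iff zero_le_mult_iff)
  moreover have "e n \<noteq> 0" by (simp add: e_def \<sigma>_def)
  then have "(e n)\<^sup>2 > 0" by simp
  moreover have "(tr2 (A + e n *\<^sub>R (0, 1, -1, 0)))\<^sup>2 - 4 * det2 (A + e n *\<^sub>R (0, 1, -1, 0))
      = (tr2 A)\<^sup>2 - 4 * det2 A + 4 * (e n * (c - b)) - 4 * (e n)\<^sup>2"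
    by (simp add: Adef power2_eq_square algebra_simps)
  ultimately show ?thesis
    using A(2) by (intro one_in_U_if_elliptic[OF n]) linarith
qed

end

section \<open>Planar cones and rank-one matrices\<close>

fun app :: "mat \<Rightarrow> real \<times> real \<Rightarrow> real \<times> real" where
  "app (a, b, c, d) (x, y) = (a * x + b * y, c * x + d * y)"

fun wedge :: "real \<times> real \<Rightarrow> real \<times> real \<Rightarrow> real" where
  "wedge (x, y) (x', y') = x * y' - y * x'"

definition nonneg2 :: "mat \<Rightarrow> bool" where
  "nonneg2 A \<longleftrightarrow> (case A of (a, b, c, d) \<Rightarrow> a \<ge> 0 \<and> b \<ge> 0 \<and> c \<ge> 0 \<and> d \<ge> 0)"

lemma nonneg2_simp [simp]: "nonneg2 (a, b, c, d) \<longleftrightarrow> a \<ge> 0 \<and> b \<ge> 0 \<and> c \<ge> 0 \<and> d \<ge> 0"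
  by (simp add: nonneg2_def)

lemma bounded_bilinear_app: "bounded_bilinear app"
  unfolding bilinear_conv_bounded_bilinear[symmetric] bilinear_def
  by (intro conjI allI; rule linearI; clarsimp simp: algebra_simps)

lemmas app_add_left = bounded_bilinear.add_left[OF bounded_bilinear_app]
  and app_scaleR_left [simp] = bounded_bilinear.scaleR_left[OF bounded_bilinear_app]
  and app_scaleR_right [simp] = bounded_bilinear.scaleR_right[OF bounded_bilinear_app]
  and app_zero_right [simp] = bounded_bilinear.zero_right[OF bounded_bilinear_app]
  and tendsto_app [tendsto_intros] = bounded_bilinear.tendsto[OF bounded_bilinear_app]
  and continuous_on_app [continuous_intros] = bounded_bilinear.continuous_on[OF bounded_bilinear_app]

lemma app_mm: "app (A \<star> B) v = app A (app B v)"
  by (cases A rule: prod_cases4; cases B rule: prod_cases4; cases v) (simp add: algebra_simps)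

lemma cone_basis:
  fixes K :: "(real \<times> real) set"
  assumes closed: "closed K"
    and scale: "\<And>v r. v \<in> K \<Longrightarrow> r \<ge> 0 \<Longrightarrow> r *\<^sub>R v \<in> K"
    and w: "w0 \<in> K" "w1 \<in> K" "wedge w0 w1 \<noteq> 0"
    and e: "e > 0" "p \<noteq> 0 \<or> q \<noteq> 0"
    and pointed: "\<And>x y. (x, y) \<in> K \<Longrightarrow> p * x + q * y \<ge> e * \<bar>p * y - q * x\<bar>"
  obtains v1 v2 where "v1 \<in> K" "v2 \<in> K" "wedge v1 v2 > 0"
    "\<And>v. v \<in> K \<Longrightarrow> \<exists>l m. l \<ge> 0 \<and> m \<ge> 0 \<and> v = l *\<^sub>R v1 + m *\<^sub>R v2"
proof -
  define D where "D = p\<^sup>2 + q\<^sup>2"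
  have D: "D > 0" using e(2) by (simp add: D_def sum_power2_gt_zero_iff)
  \<comment> \<open>\<open>\<xi>\<close> and \<open>\<eta>\<close> are the coordinates in the
    orthogonal basis \<open>(p, q)\<close>, \<open>(- q, p)\<close>; \<open>g\<close> parametrises
    the line on which \<open>\<xi>\<close> is 1.\<close>
  define \<xi> where "\<xi> v = (p * fst v + q * snd v) / D" for v :: "real \<times> real"
  define \<eta> where "\<eta> v = (p * snd v - q * fst v) / D" for v :: "real \<times> real"
  define g where "g y = (p - y * q, q + y * p)" for y :: real
  have decomp: "v = (\<xi> v * p - \<eta> v * q, \<xi> v * q + \<eta> v * p)" for v
  proof -
    have "(\<xi> v * p - \<eta> v * q) * D = fst v * D" "(\<xi> v * q + \<eta> v * p) * D = snd v * D"
      using D by (simp_all add: \<xi>_def \<eta>_def field_simps) (simp_all add: D_def algebra_simps power2_eq_square)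
    then show ?thesis using D by (simp add: prod_eq_iff)
  qed
  have \<xi>\<eta>: "\<xi> v \<ge> e * \<bar>\<eta> v\<bar>" if "v \<in> K" for v
    using pointed[of "fst v" "snd v"] that D by (simp add: \<xi>_def \<eta>_def field_simps abs_divide)
  have zero: "v = 0" if "v \<in> K" "\<xi> v = 0" for v
  proof -
    have "e * \<bar>\<eta> v\<bar> \<le> 0" using \<xi>\<eta>[OF that(1)] that(2) by simp
    then have "\<eta> v = 0" using e(1) by (simp add: mult_le_0_iff)
    then show ?thesis using decomp[of v] that(2) by (simp add: zero_prod_def)
  qed
  have \<xi>_pos: "\<xi> v > 0" if "v \<in> K" "v \<noteq> 0" for v
  proof -
    have "e * \<bar>\<eta> v\<bar> \<ge> 0" using e(1) by simp
    then show ?thesis using \<xi>\<eta>[OF that(1)] zero[OF that(1)] that(2) by linarith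
  qed
  have on_line: "v = \<xi> v *\<^sub>R g (\<eta> v / \<xi> v)" if "v \<in> K" "v \<noteq> 0" for v
    using decomp[of v] \<xi>_pos[OF that] by (simp add: g_def algebra_simps)
  define Y where "Y = {y. g y \<in> K}"
  have in_Y: "\<eta> v / \<xi> v \<in> Y" if "v \<in> K" "v \<noteq> 0" for v
  proof -
    have "(1 / \<xi> v) *\<^sub>R v \<in> K" using that \<xi>_pos[OF that] by (intro scale) auto
    moreover have "(1 / \<xi> v) *\<^sub>R v = g (\<eta> v / \<xi> v)"
      by (subst on_line[OF that]) (use \<xi>_pos[OF that] in simp)
    ultimately show ?thesis by (simp add: Y_def)
  qed
  have "closed Y"
  proof -
    have "continuous_on UNIV g" unfolding g_def by (intro continuous_intros)
    from closed_vimage[OF closed this] show ?thesis by (simp add: Y_def vimage_def)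
  qed
  moreover have "Y \<subseteq> cball 0 (1 / e)"
  proof
    fix y assume "y \<in> Y"
    then have "p * (p - y * q) + q * (q + y * p) \<ge> e * \<bar>p * (q + y * p) - q * (p - y * q)\<bar>"
      unfolding Y_def g_def by (intro pointed) simp
    also have "p * (q + y * p) - q * (p - y * q) = y * D" by (simp add: D_def algebra_simps power2_eq_square)
    also have "p * (p - y * q) + q * (q + y * p) = D" by (simp add: D_def algebra_simps power2_eq_square)
    finally have "(e * \<bar>y\<bar>) * D \<le> 1 * D" using D by (simp add: abs_mult mult_ac)
    then have "e * \<bar>y\<bar> \<le> 1" using D mult_le_cancel_right_pos by blast
    then show "y \<in> cball 0 (1 / e)" using e(1) by (simp add: field_simps)
  qed
  ultimately have "compact Y"
    using bounded_subset[OF bounded_cball] by (auto simp: compact_eq_bounded_closed)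
  have w_nz: "w0 \<noteq> 0" "w1 \<noteq> 0" using w(3) by (cases w0, cases w1, auto simp: zero_prod_def)+
  define y0 where "y0 = \<eta> w0 / \<xi> w0"
  define y1 where "y1 = \<eta> w1 / \<xi> w1"
  have y: "y0 \<in> Y" "y1 \<in> Y" using in_Y w w_nz by (simp_all add: y0_def y1_def)
  have "y0 \<noteq> y1"
  proof
    assume "y0 = y1"
    have "w0 = \<xi> w0 *\<^sub>R g y0"
      unfolding y0_def by (rule on_line[OF w(1) w_nz(1)])
    moreover have "w1 = \<xi> w1 *\<^sub>R g y0"
      unfolding \<open>y0 = y1\<close> y1_def by (rule on_line[OF w(2) w_nz(2)])
    moreover have "wedge (r *\<^sub>R v) (r' *\<^sub>R v) = 0" for r r' v by (cases v) simp
    ultimately have "wedge w0 w1 = 0" by metis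
    then show False using w(3) by simp
  qed
  obtain s where s: "s \<in> Y" "\<And>y. y \<in> Y \<Longrightarrow> s \<le> y"
    using compact_attains_inf[OF \<open>compact Y\<close>] y by blast
  obtain t where t: "t \<in> Y" "\<And>y. y \<in> Y \<Longrightarrow> y \<le> t"
    using compact_attains_sup[OF \<open>compact Y\<close>] y by blast
  have st: "s < t" using s(2)[OF y(1)] s(2)[OF y(2)] t(2)[OF y(1)] t(2)[OF y(2)] \<open>y0 \<noteq> y1\<close> by linarith
  show thesis
  proof (rule that)
    show "g s \<in> K" "g t \<in> K" using s t by (simp_all add: Y_def)
    have "wedge (g s) (g t) = (t - s) * D" by (simp add: g_def D_def algebra_simps power2_eq_square)
    then show "wedge (g s) (g t) > 0" using st D by simp
    fix v assume v: "v \<in> K"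
    show "\<exists>l m. l \<ge> 0 \<and> m \<ge> 0 \<and> v = l *\<^sub>R g s + m *\<^sub>R g t"
    proof (cases "v = 0")
      case True
      then show ?thesis by (intro exI[of _ 0]) simp
    next
      case False
      define z where "z = \<eta> v / \<xi> v"
      have z: "s \<le> z" "z \<le> t" using in_Y[OF v False] s t by (simp_all add: z_def)
      have "g z = ((t - z) / (t - s)) *\<^sub>R g s + ((z - s) / (t - s)) *\<^sub>R g t"
        using st by (simp add: g_def divide_simps) (simp add: algebra_simps)
      then have "v = (\<xi> v * ((t - z) / (t - s))) *\<^sub>R g s + (\<xi> v * ((z - s) / (t - s))) *\<^sub>R g t"
        using on_line[OF v False] by (simp add: z_def[symmetric] scaleR_add_right)
      moreover have "\<xi> v * ((t - z) / (t - s)) \<ge> 0" "\<xi> v * ((z - s) / (t - s)) \<ge> 0"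
        using z st \<xi>_pos[OF v False] by simp_all
      ultimately show ?thesis by blast
    qed
  qed
qed

lemma same_sign_if_nonvanishing:
  fixes f :: "real \<Rightarrow> real"
  assumes "continuous_on {a..b} f" "a \<le> b" "\<And>x. x \<in> {a..b} \<Longrightarrow> f x \<noteq> 0"
  shows "f a * f b > 0"
proof (rule ccontr)
  assume "\<not> f a * f b > 0"
  moreover have "f a \<noteq> 0" "f b \<noteq> 0" using assms by auto
  ultimately have "f a \<le> 0 \<and> 0 \<le> f b \<or> f b \<le> 0 \<and> 0 \<le> f a"
    by (auto simp: zero_less_mult_iff)
  then obtain x where "x \<in> {a..b}" "f x = 0"
    using IVT'[of f a 0 b] IVT2'[of f b 0 a] assms by fastforce
  then show False using assms by blast
qed

text \<open>In the identity \<open>tr2 (X \<star> Y) = tr2 X * tr2 Y - tr2 (X \<star> adj Y)\<close>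
  for \<open>A \<star> P\<close> and \<open>B \<star> P\<close>, the last term contains
  \<open>P \<star> adj P = 0\<close>.\<close>

lemma tr2_mm_mm_rank_one:
  assumes "det2 P = 0"
  shows "tr2 (A \<star> P \<star> B \<star> P) = tr2 (A \<star> P) * tr2 (B \<star> P)"
proof -
  have "tr2 (X \<star> Y) = tr2 X * tr2 Y - tr2 (X \<star> adj Y)" for X Y
    by (cases X rule: prod_cases4; cases Y rule: prod_cases4) (simp add: algebra_simps)
  from this[of "A \<star> P" "B \<star> P"]
  have "tr2 (A \<star> P \<star> B \<star> P) = tr2 (A \<star> P) * tr2 (B \<star> P) - tr2 (A \<star> (P \<star> adj P) \<star> adj B)"
    by (simp add: mm_assoc adj_mm)
  then show ?thesis using assms linear_0[OF linear_tr2] by (simp add: mm_adj)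
qed

lemma rank_oneE:
  assumes "det2 P = 0" "P \<noteq> 0"
  obtains v1 v2 r1 r2 where "P = (v1 * r1, v1 * r2, v2 * r1, v2 * r2)"
    "v1 \<noteq> 0 \<or> v2 \<noteq> 0" "r1 \<noteq> 0 \<or> r2 \<noteq> 0"
proof -
  obtain p q r s where P: "P = (p, q, r, s)" by (cases P rule: prod_cases4)
  have ps: "p * s = q * r" using assms(1) by (simp add: P)
  consider "p \<noteq> 0" | "q \<noteq> 0" | "p = 0" "q = 0" by blast
  then show thesis
  proof cases
    case 1
    then show ?thesis using ps by (intro that[of 1 p q "r / p"]) (auto simp: P field_simps)
  next
    case 2
    then show ?thesis using ps by (intro that[of 1 p q "s / q"]) (auto simp: P field_simps)
  next
    case 3
    then show ?thesis using assms(2) by (intro that[of 0 r s 1]) (auto simp: P zero_prod_def)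
  qed
qed

section \<open>The invariant cone\<close>

context lifted_semigroup
begin

lemma tr2_nonzero_if_hyperbolic:
  assumes "one2 \<notin> U" "A \<in> U"
  shows "tr2 A \<noteq> 0"
proof
  assume "tr2 A = 0"
  then have "(tr2 A)\<^sup>2 \<le> 4 * det2 A" using U_pos[OF assms(2)] by simp
  then show False using one_in_U_if_not_hyperbolic assms by blast
qed

text \<open>
  As \<open>tr2\<close> has no zero on \<open>U\<close>, its sign is constant along \<open>t \<mapsto> A E(t)\<close> and \<open>t \<mapsto> A E(t) B E(t)\<close>;
  rescaled, these converge to \<open>A P\<close> and \<open>A P B P\<close> with \<open>P\<close> of rank one.
\<close>

lemma rank_one_limit:
  assumes proper: "one2 \<notin> U"
  obtains P where "P \<noteq> 0" "det2 P = 0" "\<And>A. A \<in> U \<Longrightarrow> tr2 A * tr2 (A \<star> P) > 0"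
    "\<And>A B. A \<in> U \<Longrightarrow> B \<in> U \<Longrightarrow> tr2 (A \<star> B) * (tr2 A * tr2 B) > 0"
proof -
  note tr_nz = tr2_nonzero_if_hyperbolic[OF proper]
  obtain X where X: "tr2 X = 0" "X \<noteq> 0" and ET: "\<And>E t. one_parameter X E \<Longrightarrow> t \<ge> 0 \<Longrightarrow> E t \<in> T"
    using infinitesimal_generator by metis
  show thesis
  proof (rule one_parameter_exists[OF X])
    fix E and t0 :: real
    assume E: "one_parameter X E" and t0: "t0 > 0" "E t0 = - one2"
    interpret one_parameter X E by (rule E)
    obtain A where A: "A \<in> U" using U_nonempty by blast
    \<comment> \<open>A rotation group is impossible: \<open>A \<star> E t\<close> would stay in
      \<open>U\<close> while its trace changes sign.\<close>
    have "tr2 (A \<star> E 0) * tr2 (A \<star> E t0) > 0"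
    proof (rule same_sign_if_nonvanishing[where f = "\<lambda>t. tr2 (A \<star> E t)" and a = 0 and b = t0])
      show "continuous_on {0..t0} (\<lambda>t. tr2 (A \<star> E t))" by (intro continuous_intros)
      show "tr2 (A \<star> E t) \<noteq> 0" if "t \<in> {0..t0}" for t
        using that A U_mult_right ET[OF E] by (intro tr_nz) simp
    qed (use t0 in simp)
    moreover have "tr2 (A \<star> E t0) = - tr2 A"
      using bounded_bilinear.minus_right[OF bounded_bilinear_mm, of A one2] linear_neg[OF linear_tr2, of A]
      by (simp add: t0(2))
    ultimately have "tr2 A * - tr2 A > 0" by simp
    moreover have "tr2 A * tr2 A \<ge> 0" by simp
    ultimately have False by simp
    then show thesis ..
  next
    fix E P and k :: "real \<Rightarrow> real"
    assume E: "one_parameter X E" and P: "P \<noteq> 0" "det2 P = 0"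
      and k: "\<And>t. t > 0 \<Longrightarrow> k t > 0" and lim: "((\<lambda>t. k t *\<^sub>R E t) \<longlongrightarrow> P) at_top"
    interpret one_parameter X E by (rule E)
    have weak: "tr2 A * tr2 (A \<star> P) \<ge> 0" if A: "A \<in> U" for A
    proof (rule tendsto_lowerbound)
      show "((\<lambda>t. tr2 A * tr2 (A \<star> (k t *\<^sub>R E t))) \<longlongrightarrow> tr2 A * tr2 (A \<star> P)) at_top"
        by (intro tendsto_intros lim)
      show "\<forall>\<^sub>F t in at_top. 0 \<le> tr2 A * tr2 (A \<star> (k t *\<^sub>R E t))"
        using eventually_gt_at_top[of 0]
      proof eventually_elim
        case (elim t)
        have "tr2 (A \<star> E 0) * tr2 (A \<star> E t) > 0"
        proof (rule same_sign_if_nonvanishing[where f = "\<lambda>t. tr2 (A \<star> E t)" and a = 0 and b = t])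
          show "continuous_on {0..t} (\<lambda>t. tr2 (A \<star> E t))" by (intro continuous_intros)
          show "tr2 (A \<star> E u) \<noteq> 0" if "u \<in> {0..t}" for u
            using that A U_mult_right ET[OF E] by (intro tr_nz) simp
        qed (use elim in simp)
        then have "k t * (tr2 A * tr2 (A \<star> E t)) \<ge> 0" using k[OF elim] by simp
        then show ?case by (simp add: mult_ac)
      qed
    qed simp
    have strict: "tr2 A * tr2 (A \<star> P) > 0" if A: "A \<in> U" for A
    proof (rule ccontr)
      assume "\<not> ?thesis"
      then have "tr2 A * tr2 (A \<star> P) = 0" using weak[OF A] by simp
      then have 0: "tr2 (A \<star> P) = 0" using tr_nz[OF A] by simp
      obtain p q r s where Pdef: "P = (p, q, r, s)" by (cases P rule: prod_cases4)
      \<comment> \<open>The transpose of \<open>P\<close>, for which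
        \<open>tr2 (Y \<star> P)\<close> is the sum of the squared entries. Moving \<open>A\<close>
        along \<open>Y\<close>, against the sign of its trace, would violate the weak
        inequality.\<close>
      define Y where "Y = (p, r, q, s)"
      have "tr2 (Y \<star> P) = (p\<^sup>2 + q\<^sup>2) + (r\<^sup>2 + s\<^sup>2)" by (simp add: Y_def Pdef power2_eq_square)
      moreover have "p\<^sup>2 + q\<^sup>2 > 0 \<or> r\<^sup>2 + s\<^sup>2 > 0"
        using P(1) by (auto simp: Pdef zero_prod_def sum_power2_gt_zero_iff)
      moreover have "p\<^sup>2 + q\<^sup>2 \<ge> 0" "r\<^sup>2 + s\<^sup>2 \<ge> 0" by simp_all
      ultimately have Y: "tr2 (Y \<star> P) > 0" by linarith
      define B where "B n = A + (- tr2 A * inverse (real (Suc n))) *\<^sub>R Y" for n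
      have "B \<longlonglongrightarrow> A + (- tr2 A * 0) *\<^sub>R Y"
        unfolding B_def by (intro tendsto_intros LIMSEQ_inverse_real_of_nat)
      then have B: "B \<longlonglongrightarrow> A" by simp
      have "(\<lambda>n. tr2 A * tr2 (B n)) \<longlonglongrightarrow> tr2 A * tr2 A" by (intro tendsto_intros B)
      moreover have "tr2 A * tr2 A > 0" using tr_nz[OF A] by (metis not_real_square_gt_zero)
      ultimately have "\<forall>\<^sub>F n in sequentially. tr2 A * tr2 (B n) > 0" by (rule order_tendstoD)
      moreover have "\<forall>\<^sub>F n in sequentially. B n \<in> U" by (rule eventually_in_U[OF A B])
      ultimately have "\<forall>\<^sub>F n in sequentially. tr2 A * tr2 (B n) > 0 \<and> B n \<in> U" by (rule eventually_conj)
      then obtain n where n: "tr2 A * tr2 (B n) > 0" "B n \<in> U"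
        unfolding eventually_sequentially by blast
      have "tr2 (B n \<star> P) = - tr2 A * inverse (real (Suc n)) * tr2 (Y \<star> P)"
      proof -
        have "tr2 ((A + u *\<^sub>R Y) \<star> P) = u * tr2 (Y \<star> P)" for u
          by (simp add: mm_add_left 0)
        then show ?thesis by (simp only: B_def)
      qed
      then have "tr2 (B n) * tr2 (B n \<star> P) = - (tr2 A * tr2 (B n)) * (inverse (real (Suc n)) * tr2 (Y \<star> P))"
        by simp
      also have "\<dots> < 0"
        by (rule mult_neg_pos) (use n(1) Y in simp_all)
      finally show False using weak[OF n(2)] by simp
    qed
    have mult: "tr2 (A \<star> B) * (tr2 A * tr2 B) > 0" if A: "A \<in> U" and B: "B \<in> U" for A B
    proof -
      have AB: "A \<star> B \<in> U" using A B U_mult_right U_subset_T by blast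
      have "tr2 (A \<star> B) * tr2 (A \<star> P \<star> B \<star> P) \<ge> 0"
      proof (rule tendsto_lowerbound)
        show "((\<lambda>t. tr2 (A \<star> B) * tr2 (A \<star> (k t *\<^sub>R E t) \<star> B \<star> (k t *\<^sub>R E t)))
            \<longlongrightarrow> tr2 (A \<star> B) * tr2 (A \<star> P \<star> B \<star> P)) at_top"
          by (intro tendsto_intros lim)
        show "\<forall>\<^sub>F t in at_top. 0 \<le> tr2 (A \<star> B) * tr2 (A \<star> (k t *\<^sub>R E t) \<star> B \<star> (k t *\<^sub>R E t))"
          using eventually_gt_at_top[of 0]
        proof eventually_elim
          case (elim t)
          have "tr2 (A \<star> E 0 \<star> B \<star> E 0) * tr2 (A \<star> E t \<star> B \<star> E t) > 0"
          proof (rule same_sign_if_nonvanishing[where f = "\<lambda>t. tr2 (A \<star> E t \<star> B \<star> E t)" and a = 0 and b = t])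
            show "continuous_on {0..t} (\<lambda>t. tr2 (A \<star> E t \<star> B \<star> E t))" by (intro continuous_intros)
            show "tr2 (A \<star> E u \<star> B \<star> E u) \<noteq> 0" if u: "u \<in> {0..t}" for u
            proof -
              have "E u \<in> T" using u ET[OF E] by simp
              moreover have "B \<in> T" using B U_subset_T by blast
              ultimately show ?thesis by (intro tr_nz U_mult_right A)
            qed
          qed (use elim in simp)
          then have "(k t * k t) * (tr2 (A \<star> B) * tr2 (A \<star> E t \<star> B \<star> E t)) \<ge> 0" by simp
          then show ?case by (simp add: mult_ac)
        qed
      qed simp
      then have ge: "tr2 (A \<star> B) * (tr2 (A \<star> P) * tr2 (B \<star> P)) \<ge> 0"
        by (simp only: tr2_mm_mm_rank_one[OF P(2)])
      have pos: "(tr2 A * tr2 (A \<star> P)) * (tr2 B * tr2 (B \<star> P)) > 0"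
        using strict[OF A] strict[OF B] by simp
      have "(tr2 (A \<star> B) * (tr2 A * tr2 B)) * (tr2 (A \<star> P) * tr2 (B \<star> P))\<^sup>2
          = (tr2 (A \<star> B) * (tr2 (A \<star> P) * tr2 (B \<star> P))) * ((tr2 A * tr2 (A \<star> P)) * (tr2 B * tr2 (B \<star> P)))"
        by (simp add: power2_eq_square algebra_simps)
      also have "\<dots> \<ge> 0" using ge pos by simp
      finally have prod: "(tr2 (A \<star> B) * (tr2 A * tr2 B)) * (tr2 (A \<star> P) * tr2 (B \<star> P))\<^sup>2 \<ge> 0" .
      have sq: "(tr2 (A \<star> P) * tr2 (B \<star> P))\<^sup>2 > 0" using pos by (auto simp: zero_less_power2)
      have "tr2 (A \<star> B) * (tr2 A * tr2 B) \<ge> 0"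
        using prod mult_neg_pos[OF _ sq] by (meson leD leI)
      moreover have "tr2 (A \<star> B) * (tr2 A * tr2 B) \<noteq> 0"
        using tr_nz A B AB by simp
      ultimately show ?thesis by linarith
    qed
    show thesis using that[OF P strict mult] .
  qed
qed

text \<open>
  With \<open>P\<close> the matrix of \<open>v \<mapsto> \<langle>\<rho>, v\<rangle> \<alpha>\<close>, the invariant cone is the set of all \<open>v\<close> such that
  \<open>\<langle>\<rho>, A v\<rangle> \<ge> 0\<close> for every \<open>A \<in> U\<close> of positive trace.
\<close>

lemma invariant_cone:
  assumes proper: "one2 \<notin> U"
  obtains B where "det2 B > 0" "\<And>A. A \<in> T \<Longrightarrow> nonneg2 (adj B \<star> A \<star> B) \<or> nonneg2 (- (adj B \<star> A \<star> B))"
proof -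
  obtain P where P: "P \<noteq> 0" "det2 P = 0" and strict: "\<And>A. A \<in> U \<Longrightarrow> tr2 A * tr2 (A \<star> P) > 0"
    and mult: "\<And>A B. A \<in> U \<Longrightarrow> B \<in> U \<Longrightarrow> tr2 (A \<star> B) * (tr2 A * tr2 B) > 0"
    using rank_one_limit[OF proper] by metis
  obtain v1 v2 r1 r2 where Pdef: "P = (v1 * r1, v1 * r2, v2 * r1, v2 * r2)"
    and v: "v1 \<noteq> 0 \<or> v2 \<noteq> 0" and r: "r1 \<noteq> 0 \<or> r2 \<noteq> 0"
    using rank_oneE[OF P(2,1)] by metis
  define \<alpha> where "\<alpha> = (v1, v2)"
  define \<rho> where "\<rho> = (r1, r2)"
  define W where "W = {A \<in> U. tr2 A > 0}"
  have \<rho>\<alpha>: "\<rho> \<bullet> app A \<alpha> = tr2 (A \<star> P)" for A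
    by (cases A rule: prod_cases4) (simp add: \<rho>_def \<alpha>_def Pdef algebra_simps)
  have WU: "A \<in> U" "tr2 A > 0" if "A \<in> W" for A using that by (simp_all add: W_def)
  have L: "\<rho> \<bullet> app A \<alpha> > 0" if "A \<in> W" for A
    using strict[of A] WU[OF that] by (simp add: \<rho>\<alpha> zero_less_mult_iff)
  have WW: "A \<star> B \<in> W" if "A \<in> W" "B \<in> W" for A B
  proof -
    have "A \<star> B \<in> U" using WU[OF that(1)] WU[OF that(2)] U_mult_right U_subset_T by blast
    moreover have "tr2 (A \<star> B) > 0"
      using mult[of A B] WU[OF that(1)] WU[OF that(2)]
      by (metis mult_pos_pos zero_less_mult_pos2)
    ultimately show ?thesis by (simp add: W_def)
  qed
  have evW: "\<forall>\<^sub>F n in sequentially. f n \<in> W" if "A \<in> W" "f \<longlonglongrightarrow> A" for f A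
  proof -
    have "\<forall>\<^sub>F n in sequentially. f n \<in> U" using WU that eventually_in_U by blast
    moreover have "(\<lambda>n. tr2 (f n)) \<longlonglongrightarrow> tr2 A" by (intro tendsto_intros that)
    then have "\<forall>\<^sub>F n in sequentially. tr2 (f n) > 0" by (rule order_tendstoD(1)) (rule WU(2)[OF that(1)])
    ultimately show ?thesis by eventually_elim (simp add: W_def)
  qed
  obtain A0 where A0: "A0 \<in> W"
  proof -
    obtain A where A: "A \<in> U" using U_nonempty by blast
    have "A \<in> W \<or> (-1) *\<^sub>R A \<in> W"
      using A tr2_nonzero_if_hyperbolic[OF proper A] U_scale[OF A, of "-1"]
      unfolding W_def mem_Collect_eq tr2_scaleR by auto
    then show thesis using that by blast
  qed
  define K where "K = {v. \<forall>A\<in>W. \<rho> \<bullet> app A v \<ge> 0}"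
  have K_scale: "s *\<^sub>R v \<in> K" if "v \<in> K" "s \<ge> 0" for v s
    using that by (simp add: K_def)
  have K_closed: "closed K"
  proof -
    have "K = (\<Inter>A\<in>W. {v. \<rho> \<bullet> app A v \<ge> 0})" by (auto simp: K_def)
    moreover have "closed {v. \<rho> \<bullet> app A v \<ge> 0}" for A
      by (intro closed_Collect_le continuous_intros)
    ultimately show ?thesis by auto
  qed
  have W\<alpha>: "app A \<alpha> \<in> K" if "A \<in> W" for A
    unfolding K_def using L[OF WW[OF _ that]] by (simp add: app_mm less_imp_le)
  \<comment> \<open>The product of \<open>B\<close>, \<open>h\<close> and \<open>A\<close> is split
    both as \<open>B\<close> times \<open>h \<star> A\<close> and as \<open>B \<star> h\<close>
    times \<open>A\<close>. Multiplicativity of signs gives \<open>tr2 (h \<star> A)\<close> and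
    \<open>tr2 (h \<star> B)\<close> the sign of its trace.\<close>
  have sign: "(\<forall>A\<in>W. tr2 (h \<star> A) > 0) \<or> (\<forall>A\<in>W. tr2 (h \<star> A) < 0)" if h: "h \<in> T" for h
  proof -
    have "tr2 (h \<star> A) * tr2 (h \<star> B) > 0" if A: "A \<in> W" and B: "B \<in> W" for A B
    proof -
      have hA: "h \<star> A \<in> U" and Bh: "B \<star> h \<in> U"
        using h WU[OF A] WU[OF B] U_mult_left U_mult_right by blast+
      have 1: "tr2 (B \<star> (h \<star> A)) * (tr2 B * tr2 (h \<star> A)) > 0" using mult hA WU[OF B] by blast
      have "tr2 ((B \<star> h) \<star> A) * (tr2 (B \<star> h) * tr2 A) > 0" using mult Bh WU[OF A] by blast
      then have 2: "tr2 (B \<star> (h \<star> A)) * (tr2 (h \<star> B) * tr2 A) > 0"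
        by (simp add: mm_assoc tr2_mm_commute[of B h])
      have "tr2 (B \<star> (h \<star> A)) * tr2 (h \<star> A) > 0"
        using 1 WU(2)[OF B] by (metis mult.left_commute zero_less_mult_pos)
      moreover have "tr2 (B \<star> (h \<star> A)) * tr2 (h \<star> B) > 0"
        using 2 WU(2)[OF A] by (metis mult.assoc zero_less_mult_pos2)
      ultimately show ?thesis by (auto simp: zero_less_mult_iff)
    qed
    then show ?thesis using A0 by (metis mult_pos_neg not_less_iff_gr_or_eq zero_less_mult_iff)
  qed
  have K_inv: "app h v \<in> K" if h: "h \<in> T" "\<forall>A\<in>W. tr2 (h \<star> A) > 0" and v: "v \<in> K" for h v
  proof -
    have "A \<star> h \<in> W" if A: "A \<in> W" for A
    proof -
      have "tr2 (h \<star> A) > 0" using h(2) A by blast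
      then have "tr2 (A \<star> h) > 0" by (simp only: tr2_mm_commute[of A h])
      moreover have "A \<star> h \<in> U" using U_mult_right[OF WU(1)[OF A] h(1)] .
      ultimately show ?thesis by (simp add: W_def)
    qed
    then show ?thesis using v by (simp add: K_def app_mm[symmetric])
  qed
  define w0 where "w0 = app A0 \<alpha>"
  have w0: "w0 \<in> K" using W\<alpha> A0 by (simp add: w0_def)
  have w0_nz: "w0 \<noteq> 0" using L[OF A0] by (auto simp: w0_def)
  obtain w1 where w1: "w1 \<in> K" "wedge w0 w1 \<noteq> 0"
  proof -
    obtain x y where xy: "w0 = (x, y)" by (cases w0)
    \<comment> \<open>\<open>Y\<close> sends \<open>\<alpha>\<close> to a positive multiple of
      \<open>w0\<close> turned by a right angle, so perturbing \<open>A0\<close> along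
      \<open>Y\<close> moves the image of \<open>\<alpha>\<close> off the line of
      \<open>w0\<close>.\<close>
    define Y where "Y = (- y * v1, - y * v2, x * v1, x * v2)"
    have "(\<lambda>n. A0 + inverse (real (Suc n)) *\<^sub>R Y) \<longlonglongrightarrow> A0 + 0 *\<^sub>R Y"
      by (intro tendsto_intros LIMSEQ_inverse_real_of_nat)
    then have "(\<lambda>n. A0 + inverse (real (Suc n)) *\<^sub>R Y) \<longlonglongrightarrow> A0" by simp
    from evW[OF A0 this] obtain n where n: "A0 + inverse (real (Suc n)) *\<^sub>R Y \<in> W"
      unfolding eventually_sequentially by blast
    define \<epsilon> where "\<epsilon> = inverse (real (Suc n))"
    have \<epsilon>: "\<epsilon> > 0" by (simp add: \<epsilon>_def)
    have "app (A0 + \<epsilon> *\<^sub>R Y) \<alpha> = (x, y) + \<epsilon> *\<^sub>R app Y \<alpha>"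
      by (simp add: app_add_left w0_def[symmetric] xy)
    also have "app Y \<alpha> = (v1\<^sup>2 + v2\<^sup>2) *\<^sub>R (- y, x)"
      by (simp add: Y_def \<alpha>_def power2_eq_square algebra_simps)
    finally have eq: "app (A0 + \<epsilon> *\<^sub>R Y) \<alpha> = (x, y) + (\<epsilon> * (v1\<^sup>2 + v2\<^sup>2)) *\<^sub>R (- y, x)" by simp
    have "wedge w0 (app (A0 + \<epsilon> *\<^sub>R Y) \<alpha>) = (\<epsilon> * (v1\<^sup>2 + v2\<^sup>2)) * (x\<^sup>2 + y\<^sup>2)"
      unfolding eq xy by (simp add: power2_eq_square algebra_simps)
    also have "\<dots> \<noteq> 0" using \<epsilon> v w0_nz by (auto simp: xy zero_prod_def sum_power2_eq_zero_iff)
    finally show thesis using that W\<alpha>[OF n] by (simp add: \<epsilon>_def)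
  qed
  obtain a b c d where A0def: "A0 = (a, b, c, d)" by (cases A0 rule: prod_cases4)
  define p where "p = r1 * a + r2 * c"
  define q where "q = r1 * b + r2 * d"
  have pq: "\<rho> \<bullet> app A0 (x, y) = p * x + q * y" for x y
    by (simp add: \<rho>_def A0def p_def q_def algebra_simps)
  have pq_nz: "p \<noteq> 0 \<or> q \<noteq> 0" using L[OF A0] by (auto simp: \<alpha>_def pq)
  \<comment> \<open>This \<open>Y\<close> contributes a multiple of \<open>p * y - q * x\<close> to
    the functional \<open>p * x + q * y\<close>. Small perturbations of either sign stay in
    \<open>W\<close>; the two inequalities they impose on \<open>K\<close> are the origin of
    \<open>e\<close>.\<close>
  define Y where "Y = (- r1 * q, r1 * p, - r2 * q, r2 * p)"
  have Ypq: "\<rho> \<bullet> app Y (x, y) = (r1\<^sup>2 + r2\<^sup>2) * (p * y - q * x)" for x y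
    by (simp add: \<rho>_def Y_def power2_eq_square algebra_simps)
  have rr: "r1\<^sup>2 + r2\<^sup>2 > 0" using r by (simp add: sum_power2_gt_zero_iff)
  have lim: "(\<lambda>n. A0 + (s * inverse (real (Suc n))) *\<^sub>R Y) \<longlonglongrightarrow> A0" for s
  proof -
    have "(\<lambda>n. A0 + (s * inverse (real (Suc n))) *\<^sub>R Y) \<longlonglongrightarrow> A0 + (s * 0) *\<^sub>R Y"
      by (intro tendsto_intros LIMSEQ_inverse_real_of_nat)
    then show ?thesis by simp
  qed
  have "\<forall>\<^sub>F n in sequentially. A0 + (1 * inverse (real (Suc n))) *\<^sub>R Y \<in> W \<and> A0 + (-1 * inverse (real (Suc n))) *\<^sub>R Y \<in> W"
    by (intro eventually_conj evW[OF A0] lim)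
  then obtain n where n: "A0 + (1 * inverse (real (Suc n))) *\<^sub>R Y \<in> W" "A0 + (-1 * inverse (real (Suc n))) *\<^sub>R Y \<in> W"
    unfolding eventually_sequentially by blast
  define e where "e = inverse (real (Suc n)) * (r1\<^sup>2 + r2\<^sup>2)"
  have e: "e > 0" using rr by (simp add: e_def)
  have pointed: "p * x + q * y \<ge> e * \<bar>p * y - q * x\<bar>" if "(x, y) \<in> K" for x y
  proof -
    have "\<rho> \<bullet> app (A0 + (s * inverse (real (Suc n))) *\<^sub>R Y) (x, y) = p * x + q * y + s * (e * (p * y - q * x))" for s
      by (simp add: app_add_left inner_add_right pq Ypq e_def)
    then have "p * x + q * y + 1 * (e * (p * y - q * x)) \<ge> 0" "p * x + q * y + -1 * (e * (p * y - q * x)) \<ge> 0"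
      using n that unfolding K_def by (metis (no_types, lifting) mem_Collect_eq)+
    moreover have "e * \<bar>p * y - q * x\<bar> = \<bar>e * (p * y - q * x)\<bar>" using e by (simp add: abs_mult)
    ultimately show ?thesis by (simp only: abs_le_iff) linarith
  qed
  obtain b1 b2 where b: "b1 \<in> K" "b2 \<in> K" "wedge b1 b2 > 0"
    "\<And>v. v \<in> K \<Longrightarrow> \<exists>l m. l \<ge> 0 \<and> m \<ge> 0 \<and> v = l *\<^sub>R b1 + m *\<^sub>R b2"
    using cone_basis[OF K_closed K_scale w0 w1 e pq_nz pointed] by metis
  \<comment> \<open>With the extreme rays as columns of \<open>B\<close>, the matrix
    \<open>adj B \<star> h \<star> B\<close> describes \<open>h\<close> in the basis of these rays,
    up to the positive factor \<open>det2 B\<close>.\<close>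
  define B where "B = (fst b1, fst b2, snd b1, snd b2)"
  have B_pos: "det2 B > 0" using b(3) by (cases b1, cases b2) (simp add: B_def algebra_simps)
  have pos: "nonneg2 (adj B \<star> h \<star> B)" if h: "h \<in> T" "\<forall>A\<in>W. tr2 (h \<star> A) > 0" for h
  proof -
    obtain l1 m1 where 1: "l1 \<ge> 0" "m1 \<ge> 0" "app h b1 = l1 *\<^sub>R b1 + m1 *\<^sub>R b2"
      using b(4) K_inv[OF h b(1)] by blast
    obtain l2 m2 where 2: "l2 \<ge> 0" "m2 \<ge> 0" "app h b2 = l2 *\<^sub>R b1 + m2 *\<^sub>R b2"
      using b(4) K_inv[OF h b(2)] by blast
    have "h \<star> B = (fst (app h b1), fst (app h b2), snd (app h b1), snd (app h b2))"
      by (cases h rule: prod_cases4, cases b1, cases b2) (simp add: B_def)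
    also have "\<dots> = B \<star> (l1, l2, m1, m2)"
      unfolding 1 2 by (cases b1, cases b2) (simp add: B_def algebra_simps)
    finally have hB: "h \<star> B = B \<star> (l1, l2, m1, m2)" .
    have "adj B \<star> h \<star> B = adj B \<star> (h \<star> B)" by (rule mm_assoc)
    also have "\<dots> = adj B \<star> B \<star> (l1, l2, m1, m2)" unfolding hB by (rule mm_assoc[symmetric])
    finally have "adj B \<star> h \<star> B = det2 B *\<^sub>R (l1, l2, m1, m2)"
      by (simp only: mm_adj mm_scaleR_left mm_one)
    then show ?thesis using 1 2 B_pos by simp
  qed
  have "nonneg2 (adj B \<star> h \<star> B) \<or> nonneg2 (- (adj B \<star> h \<star> B))" if h: "h \<in> T" for h
  proof (cases "\<forall>A\<in>W. tr2 (h \<star> A) > 0")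
    case True
    then show ?thesis using pos h by blast
  next
    case False
    then have neg: "\<forall>A\<in>W. tr2 (h \<star> A) < 0" using sign[OF h] by blast
    have "(-1) *\<^sub>R h \<in> T" using h by (intro T_scale) auto
    moreover have "\<forall>A\<in>W. tr2 ((-1) *\<^sub>R h \<star> A) > 0" unfolding mm_scaleR_left tr2_scaleR using neg by simp
    ultimately have "nonneg2 (adj B \<star> ((-1) *\<^sub>R h) \<star> B)" by (rule pos)
    then have "nonneg2 ((-1) *\<^sub>R (adj B \<star> h \<star> B))" by (simp only: mm_scaleR_left mm_scaleR_right)
    then have "nonneg2 (- (adj B \<star> h \<star> B))" by (simp only: scaleR_minus1_left)
    then show ?thesis ..
  qed
  with B_pos show thesis using that by blast
qed

theorem dense_or_invariant_cone:
  obtains "{A. det2 A > 0} \<subseteq> closure Q"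
  | B where "det2 B > 0" "\<And>A. A \<in> Q \<Longrightarrow> nonneg2 (adj B \<star> A \<star> B) \<or> nonneg2 (- (adj B \<star> A \<star> B))"
proof (cases "one2 \<in> U")
  case True
  then have "{A. det2 A > 0} \<subseteq> closure Q" using T_eq_if_one_in_U unfolding T_def by blast
  then show thesis by (rule that(1))
next
  case False
  show thesis
  proof (rule invariant_cone[OF False])
    fix B
    assume B: "det2 B > 0" "\<And>A. A \<in> T \<Longrightarrow> nonneg2 (adj B \<star> A \<star> B) \<or> nonneg2 (- (adj B \<star> A \<star> B))"
    show thesis
    proof (rule that(2)[OF B(1)])
      fix A assume "A \<in> Q"
      then have "A \<in> T" using Q_subset_T by blast
      then show "nonneg2 (adj B \<star> A \<star> B) \<or> nonneg2 (- (adj B \<star> A \<star> B))" by (rule B(2))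
    qed
  qed
qed

end

section \<open>Products of nonnegative matrices\<close>

lemma nonneg2_mm: "nonneg2 A \<Longrightarrow> nonneg2 B \<Longrightarrow> nonneg2 (A \<star> B)"
  by (cases A rule: prod_cases4; cases B rule: prod_cases4) simp

text \<open>The monoid generated by \<open>G\<close>, empty word included. Words grow on the left,
  as the invariants below are stable under left multiplication by a generator.\<close>

inductive_set products :: "mat set \<Rightarrow> mat set" for G where
  one: "one2 \<in> products G"
| mult: "A \<in> G \<Longrightarrow> N \<in> products G \<Longrightarrow> A \<star> N \<in> products G"

text \<open>The gap through which finiteness of the generating set enters the estimates. The
  inserted 1 covers the case where no value is positive.\<close>

lemma finite_positive_lower_bound:
  assumes "finite G"
  obtains e :: real where "e > 0" "\<And>x. x \<in> G \<Longrightarrow> q x > 0 \<Longrightarrow> e \<le> q x"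
proof -
  define e where "e = Min (insert 1 (q ` {x \<in> G. q x > 0}))"
  have fin: "finite (insert 1 (q ` {x \<in> G. q x > 0}))" using assms by simp
  then have "e > 0" unfolding e_def by (subst Min_gr_iff) auto
  moreover have "e \<le> q x" if "x \<in> G" "q x > 0" for x
    unfolding e_def using that fin by (intro Min_le) auto
  ultimately show thesis by (rule that)
qed

fun prod12 :: "mat \<Rightarrow> real" where
  "prod12 (a, b, c, d) = b * c"

text \<open>Determinant 1 turns \<open>p * s\<close> into \<open>1 + q * r\<close> and
  \<open>a * d\<close> into \<open>1 + b * c\<close>; all terms of the expansion beyond the two
  wanted ones are nonnegative.\<close>

lemma prod12_mm_ge:
  assumes "nonneg2 A" "nonneg2 N" "det2 A = 1" "det2 N = 1"
  shows "prod12 (A \<star> N) \<ge> prod12 A + prod12 N"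
proof -
  obtain p q r s where A: "A = (p, q, r, s)" by (cases A rule: prod_cases4)
  obtain a b c d where N: "N = (a, b, c, d)" by (cases N rule: prod_cases4)
  have nn: "p \<ge> 0" "q \<ge> 0" "r \<ge> 0" "s \<ge> 0" "a \<ge> 0" "b \<ge> 0" "c \<ge> 0" "d \<ge> 0"
    using assms by (simp_all add: A N)
  have ps: "p * s = 1 + q * r" "a * d = 1 + b * c" using assms by (simp_all add: A N)
  have "prod12 (A \<star> N) = (p * s) * (b * c) + (q * r) * (a * d) + p * b * (r * a) + q * d * (s * c)"
    by (simp add: A N algebra_simps)
  also have "\<dots> = b * c + q * r + 2 * (q * r * (b * c)) + p * b * (r * a) + q * d * (s * c)"
    unfolding ps by (simp add: algebra_simps)
  finally show ?thesis using nn by (simp add: A N)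
qed

text \<open>
  The first two alternatives, for diagonal matrices only, together with the other three are invariant
  under left multiplication by a generator. Without the assumption on the diagonal generators this
  fails: for \<open>U\<close> upper triangular, \<open>L\<close> lower triangular and \<open>D = diag(x, 1/x)\<close> with large
  \<open>x\<close>, the product of \<open>1/D\<close>, \<open>U\<close>, \<open>D\<close>, \<open>D\<close>, \<open>L\<close>, \<open>1/D\<close> is close to the identity if \<open>U\<close> and \<open>L\<close> are unipotent.
\<close>

lemma products_separated:
  assumes fin: "finite G" and G: "\<And>A. A \<in> G \<Longrightarrow> nonneg2 A" "\<And>A. A \<in> G \<Longrightarrow> det2 A = 1"
    and expanding: "\<And>a d. (a, 0, 0, d) \<in> G \<Longrightarrow> a \<ge> 1"
  shows "\<exists>\<kappa>>0. \<exists>\<mu>>0. \<exists>\<eta>>0. \<forall>a b c d. (a, b, c, d) \<in> products G \<longrightarrow>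
    (a, b, c, d) = one2 \<or> a \<ge> 1 + \<kappa> \<or> b * c \<ge> \<eta> \<or> b \<ge> \<mu> * d \<or> c \<ge> \<mu> * d"
proof -
  obtain \<kappa> where \<kappa>: "\<kappa> > 0" "\<And>A. A \<in> G \<Longrightarrow> fst A - 1 > 0 \<Longrightarrow> \<kappa> \<le> fst A - 1"
    using finite_positive_lower_bound[OF fin, of "\<lambda>A. fst A - 1"] by metis
  obtain \<mu>1 where \<mu>1: "\<mu>1 > 0"
    "\<And>A. A \<in> G \<Longrightarrow> fst (snd A) / snd (snd (snd A)) > 0 \<Longrightarrow> \<mu>1 \<le> fst (snd A) / snd (snd (snd A))"
    using finite_positive_lower_bound[OF fin, of "\<lambda>A. fst (snd A) / snd (snd (snd A))"] by metis
  obtain \<mu>2 where \<mu>2: "\<mu>2 > 0"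
    "\<And>A. A \<in> G \<Longrightarrow> fst (snd (snd A)) / snd (snd (snd A)) > 0 \<Longrightarrow> \<mu>2 \<le> fst (snd (snd A)) / snd (snd (snd A))"
    using finite_positive_lower_bound[OF fin, of "\<lambda>A. fst (snd (snd A)) / snd (snd (snd A))"] by metis
  define \<mu> where "\<mu> = min \<mu>1 \<mu>2"
  have \<mu>: "\<mu> > 0" using \<mu>1 \<mu>2 by (simp add: \<mu>_def)
  obtain \<eta>1 where \<eta>1: "\<eta>1 > 0" "\<And>A. A \<in> G \<Longrightarrow> prod12 A > 0 \<Longrightarrow> \<eta>1 \<le> prod12 A"
    using finite_positive_lower_bound[OF fin, of prod12] by metis
  obtain \<eta>2 where \<eta>2: "\<eta>2 > 0" "\<And>A. A \<in> G \<Longrightarrow> fst A * fst (snd (snd A)) > 0 \<Longrightarrow> \<eta>2 \<le> fst A * fst (snd (snd A))"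
    using finite_positive_lower_bound[OF fin, of "\<lambda>A. fst A * fst (snd (snd A))"] by metis
  \<comment> \<open>The bound \<open>\<eta>2 * \<mu>\<close> serves a lower triangular generator
    applied to a word with \<open>b \<ge> \<mu> * d\<close>; their product has both off-diagonal
    entries positive.\<close>
  define \<eta> where "\<eta> = min \<eta>1 (\<eta>2 * \<mu>)"
  have \<eta>: "\<eta> > 0" using \<eta>1 \<eta>2 \<mu> by (simp add: \<eta>_def)
  define sep_inv where "sep_inv N \<longleftrightarrow> nonneg2 N \<and> det2 N = 1 \<and> (case N of (a, b, c, d) \<Rightarrow>
      b = 0 \<and> c = 0 \<and> (a = 1 \<or> a \<ge> 1 + \<kappa>) \<or> b * c \<ge> \<eta> \<or> b \<ge> \<mu> * d \<or> c \<ge> \<mu> * d)" for N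
  have "sep_inv N" if "N \<in> products G" for N
    using that
  proof induction
    case one
    then show ?case by (simp add: sep_inv_def one2_def)
  next
    case (mult A N)
    obtain p q r s where A: "A = (p, q, r, s)" by (cases A rule: prod_cases4)
    obtain a b c d where N: "N = (a, b, c, d)" by (cases N rule: prod_cases4)
    have nn: "p \<ge> 0" "q \<ge> 0" "r \<ge> 0" "s \<ge> 0" "a \<ge> 0" "b \<ge> 0" "c \<ge> 0" "d \<ge> 0"
      using G(1)[OF mult(1)] mult.IH by (simp_all add: A N sep_inv_def)
    have det: "p * s = 1 + q * r" "a * d = 1 + b * c"
      using G(2)[OF mult(1)] mult.IH by (simp_all add: A N sep_inv_def)
    have "q * r \<ge> 0" "b * c \<ge> 0" using nn by simp_all
    then have "p * s > 0" "a * d > 0" using det by simp_all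
    then have pos: "p > 0" "s > 0" "a > 0" "d > 0"
      using nn by (auto simp: zero_less_mult_iff)
    have alt: "b = 0 \<and> c = 0 \<and> (a = 1 \<or> a \<ge> 1 + \<kappa>) \<or> b * c \<ge> \<eta> \<or> b \<ge> \<mu> * d \<or> c \<ge> \<mu> * d"
      using mult.IH by (simp add: sep_inv_def N)
    have prod: "prod12 (A \<star> N) \<ge> prod12 A + b * c"
      using prod12_mm_ge[OF G(1)[OF mult(1)] _ G(2)[OF mult(1)], of N] mult.IH by (simp add: sep_inv_def N)
    have prodA: "prod12 A \<ge> 0" using nn by (simp add: A)
    have q\<mu>: "q \<ge> \<mu> * s" if "q > 0"
      using \<mu>1(2)[OF mult(1)] that pos by (simp add: A \<mu>_def field_simps min_mult_distrib_left)
    have r\<mu>: "r \<ge> \<mu> * s" if "r > 0"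
      using \<mu>2(2)[OF mult(1)] that pos by (simp add: A \<mu>_def field_simps min_mult_distrib_left)
    have AN: "A \<star> N = (p * a + q * c, p * b + q * d, r * a + s * c, r * b + s * d)" by (simp add: A N)
    have goal: "p * b + q * d = 0 \<and> r * a + s * c = 0 \<and> (p * a + q * c = 1 \<or> p * a + q * c \<ge> 1 + \<kappa>)
        \<or> prod12 (A \<star> N) \<ge> \<eta> \<or> p * b + q * d \<ge> \<mu> * (r * b + s * d) \<or> r * a + s * c \<ge> \<mu> * (r * b + s * d)"
    proof -
      \<comment> \<open>Once \<open>b * c \<ge> \<eta>\<close>, superadditivity preserves it; before
        that, the shape of the generator \<open>A\<close> decides.\<close>
      consider (lower_case) "b * c \<ge> \<eta>" | (both) "q > 0" "r > 0" | (diag) "q = 0" "r = 0"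
        | (upper) "q > 0" "r = 0" "b * c < \<eta>" | (lower) "q = 0" "r > 0" "b * c < \<eta>"
        using nn by force
      then show ?thesis
      proof cases
        case lower_case
        then show ?thesis using prod prodA by linarith
      next
        case both
        then have "prod12 A \<ge> \<eta>1" using \<eta>1(2)[OF mult(1)] by (simp add: A)
        moreover have "\<eta> \<le> \<eta>1" by (simp add: \<eta>_def)
        ultimately show ?thesis using prod \<open>b * c \<ge> 0\<close> by linarith
      next
        case diag
        have p1: "p \<ge> 1" using expanding mult(1) by (simp add: A diag)
        have ps: "p * s = 1" using det diag by simp
        \<comment> \<open>A diagonal generator multiplies the ratio of \<open>b\<close> to
          \<open>d\<close> by \<open>p / s\<close>, which is at least 1, and leaves the ratio of
          \<open>c\<close> to \<open>d\<close> unchanged.\<close>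
        have "s \<le> p" using mult_right_mono[OF p1 nn(4)] ps p1 by simp
        consider "b = 0" "c = 0" "a = 1 \<or> a \<ge> 1 + \<kappa>" | "b * c \<ge> \<eta>" | "b \<ge> \<mu> * d" | "c \<ge> \<mu> * d" using alt by blast
        then show ?thesis
        proof cases
          case 1
          have "p = 1 \<or> p \<ge> 1 + \<kappa>" using p1 \<kappa>(2)[OF mult(1)] by (force simp: A)
          then have "p * a = 1 \<or> p * a \<ge> 1 + \<kappa>"
          proof (elim disjE)
            assume p: "p \<ge> 1 + \<kappa>"
            have "a \<ge> 1" using 1(3) \<kappa>(1) by auto
            then have "p * 1 \<le> p * a" using pos by (intro mult_left_mono) auto
            then show ?thesis using p by simp
          next
            assume "p = 1" then show ?thesis using 1(3) by simp
          qed
          then show ?thesis using 1 diag by simp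
        next
          case 2
          then show ?thesis using prod prodA by linarith
        next
          case 3
          have "\<mu> * (s * d) = s * (\<mu> * d)" by simp
          also have "\<dots> \<le> p * b" using 3 \<open>s \<le> p\<close> nn \<mu> by (intro mult_mono) auto
          finally show ?thesis using diag by simp
        next
          case 4
          have "\<mu> * (s * d) = s * (\<mu> * d)" by simp
          also have "\<dots> \<le> s * c" using 4 nn by (intro mult_left_mono) auto
          finally show ?thesis using diag by simp
        qed
      next
        case upper
        have "\<mu> * (s * d) = (\<mu> * s) * d" by simp
        also have "\<dots> \<le> q * d" using q\<mu> upper nn by (intro mult_right_mono) auto
        also have "\<dots> \<le> p * b + q * d" using nn by simp
        finally show ?thesis using upper by simp
      next
        case lower
        consider "b = 0" "c = 0" "a = 1 \<or> a \<ge> 1 + \<kappa>" | "b \<ge> \<mu> * d" | "c \<ge> \<mu> * d" using alt lower by linarith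
        then show ?thesis
        proof cases
          case 1
          have "a \<ge> 1" using 1(3) \<kappa>(1) by auto
          moreover have "a * d = 1" using det 1 by simp
          ultimately have "d \<le> a" using mult_right_mono[of 1 a d] nn by simp
          have "\<mu> * (s * d) = (\<mu> * s) * d" by simp
          also have "\<dots> \<le> r * a" using r\<mu> lower nn \<open>d \<le> a\<close> \<mu> by (intro mult_mono) auto
          finally show ?thesis using 1 by simp
        next
          case 2
          have "\<eta>2 \<le> p * r" using \<eta>2(2)[OF mult(1)] pos lower by (simp add: A)
          have "\<eta> \<le> \<eta>2 * \<mu>" by (simp add: \<eta>_def)
          also have "\<dots> \<le> (p * r) * \<mu>" using \<open>\<eta>2 \<le> p * r\<close> \<mu> by (intro mult_right_mono) auto
          also have "\<dots> \<le> (p * r) * \<mu> * (a * d)"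
          proof -
            have "a * d \<ge> 1" using det \<open>b * c \<ge> 0\<close> by simp
            then show ?thesis using mult_left_mono[of 1 "a * d" "(p * r) * \<mu>"] nn \<mu> by simp
          qed
          also have "\<dots> = (p * r * a) * (\<mu> * d)" by (simp add: mult_ac)
          also have "\<dots> \<le> (p * r * a) * b" using 2 nn by (intro mult_left_mono) auto
          also have "\<dots> \<le> (p * b) * (r * a + s * c)" using nn by (simp add: algebra_simps)
          also have "\<dots> = prod12 (A \<star> N)" using lower by (simp add: AN)
          finally show ?thesis by simp
        next
          case 3
          \<comment> \<open>A large ratio of \<open>c\<close> to \<open>d\<close> makes
            \<open>b\<close> small against \<open>a\<close>, because
            \<open>b * c \<le> a * d\<close>; so the term \<open>r * b\<close> of the new lower
            right entry is dominated by \<open>r * a\<close>.\<close>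
          have "d * (\<mu> * b) = b * (\<mu> * d)" by simp
          also have "\<dots> \<le> b * c" using 3 nn by (intro mult_left_mono) auto
          also have "\<dots> \<le> d * a" using det by (simp add: mult.commute)
          finally have "\<mu> * b \<le> a" using pos by simp
          have "\<mu> * (r * b + s * d) = r * (\<mu> * b) + s * (\<mu> * d)" by (simp add: algebra_simps)
          also have "\<dots> \<le> r * a + s * c"
            using 3 nn \<open>\<mu> * b \<le> a\<close> by (intro add_mono mult_left_mono) auto
          finally show ?thesis by simp
        qed
      qed
    qed
    have "nonneg2 (A \<star> N)" using G(1)[OF mult(1)] mult.IH by (intro nonneg2_mm) (auto simp: sep_inv_def)
    moreover have "det2 (A \<star> N) = 1" using G(2)[OF mult(1)] mult.IH by (simp add: sep_inv_def)
    ultimately show ?case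
      using goal unfolding sep_inv_def AN by simp
  qed note sep_inv = this
  have "(a, b, c, d) = one2 \<or> a \<ge> 1 + \<kappa> \<or> b * c \<ge> \<eta> \<or> b \<ge> \<mu> * d \<or> c \<ge> \<mu> * d"
    if "(a, b, c, d) \<in> products G" for a b c d
    using sep_inv[OF that] unfolding sep_inv_def by (auto simp: one2_def)
  then show ?thesis using \<kappa>(1) \<mu> \<eta> by blast
qed

text \<open>Words that converge to \<open>one2\<close> without reaching it eventually violate every
  alternative of \<open>products_separated\<close>, so its assumption on the diagonal generators
  must fail.\<close>

lemma contracting_generator_exists:
  assumes fin: "finite G" and G: "\<And>A. A \<in> G \<Longrightarrow> nonneg2 A" "\<And>A. A \<in> G \<Longrightarrow> det2 A = 1"
    and N: "\<forall>\<^sub>F n in sequentially. N n \<in> products G \<and> N n \<noteq> one2" "N \<longlonglongrightarrow> one2"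
  shows "\<exists>a d. (a, 0, 0, d) \<in> G \<and> a < 1"
proof (rule ccontr)
  assume "\<not> ?thesis"
  then have exp: "\<And>a d. (a, 0, 0, d) \<in> G \<Longrightarrow> a \<ge> 1" by force
  have "\<exists>\<kappa>>0. \<exists>\<mu>>0. \<exists>\<eta>>0. \<forall>a b c d. (a, b, c, d) \<in> products G \<longrightarrow>
    (a, b, c, d) = one2 \<or> a \<ge> 1 + \<kappa> \<or> b * c \<ge> \<eta> \<or> b \<ge> \<mu> * d \<or> c \<ge> \<mu> * d"
    by (rule products_separated[OF fin]; fact)
  then obtain \<kappa> \<mu> \<eta> :: real where e: "\<kappa> > 0" "\<mu> > 0" "\<eta> > 0" and sep:
    "\<forall>a b c d. (a, b, c, d) \<in> products G \<longrightarrow>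
       (a, b, c, d) = one2 \<or> a \<ge> 1 + \<kappa> \<or> b * c \<ge> \<eta> \<or> b \<ge> \<mu> * d \<or> c \<ge> \<mu> * d"
    by (elim exE conjE) (rule that)
  define a where "a n = fst (N n)" for n
  define b where "b n = fst (snd (N n))" for n
  define c where "c n = fst (snd (snd (N n)))" for n
  define d where "d n = snd (snd (snd (N n)))" for n
  have Nn: "N n = (a n, b n, c n, d n)" for n by (simp add: a_def b_def c_def d_def)
  have a: "a \<longlonglongrightarrow> 1" and b: "b \<longlonglongrightarrow> 0" and c: "c \<longlonglongrightarrow> 0" and d: "d \<longlonglongrightarrow> 1"
    unfolding a_def b_def c_def d_def
    using tendsto_fst[OF N(2)] tendsto_fst[OF tendsto_snd[OF N(2)]]
      tendsto_fst[OF tendsto_snd[OF tendsto_snd[OF N(2)]]] tendsto_snd[OF tendsto_snd[OF tendsto_snd[OF N(2)]]]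
    by (simp_all add: one2_def)
  have l1: "(\<lambda>n. b n * c n) \<longlonglongrightarrow> 0 * 0" and l2: "(\<lambda>n. b n - \<mu> * d n) \<longlonglongrightarrow> 0 - \<mu> * 1"
    and l3: "(\<lambda>n. c n - \<mu> * d n) \<longlonglongrightarrow> 0 - \<mu> * 1"
    by (intro tendsto_intros a b c d)+
  have "\<forall>\<^sub>F n in sequentially. b n * c n < \<eta>" by (rule order_tendstoD(2)[OF l1]) (use e in simp)
  moreover have "\<forall>\<^sub>F n in sequentially. b n - \<mu> * d n < 0" by (rule order_tendstoD(2)[OF l2]) (use e in simp)
  moreover have "\<forall>\<^sub>F n in sequentially. c n - \<mu> * d n < 0" by (rule order_tendstoD(2)[OF l3]) (use e in simp)
  moreover have "\<forall>\<^sub>F n in sequentially. a n < 1 + \<kappa>" by (rule order_tendstoD(2)[OF a]) (use e in simp)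
  ultimately have "\<forall>\<^sub>F n in sequentially. False" using N(1)
  proof eventually_elim
    case (elim n)
    then show ?case using sep[rule_format, of "a n" "b n" "c n" "d n"] by (auto simp: Nn)
  qed
  then show False by simp
qed

text \<open>Conjugation by the swap of the coordinates. It preserves nonnegativity and determinant
  and exchanges expanding and contracting diagonal matrices.\<close>

fun flip :: "mat \<Rightarrow> mat" where
  "flip (a, b, c, d) = (d, c, b, a)"

lemma flip_mm: "flip (A \<star> B) = flip A \<star> flip B"
  by (cases A rule: prod_cases4; cases B rule: prod_cases4) (simp add: algebra_simps)

lemma flip_products: "N \<in> products G \<Longrightarrow> flip N \<in> products (flip ` G)"
proof (induction rule: products.induct)
  case one
  then show ?case using products.one[of "flip ` G"] by (simp add: one2_def)
next
  case (mult A N)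
  then show ?case by (simp only: flip_mm) (intro products.mult imageI)
qed

lemma expanding_generator_exists:
  assumes fin: "finite G" and G: "\<And>A. A \<in> G \<Longrightarrow> nonneg2 A" "\<And>A. A \<in> G \<Longrightarrow> det2 A = 1"
    and N: "\<forall>\<^sub>F n in sequentially. N n \<in> products G \<and> N n \<noteq> one2" "N \<longlonglongrightarrow> one2"
  shows "\<exists>a d. (a, 0, 0, d) \<in> G \<and> a > 1"
proof -
  have lin: "linear flip" by (rule linearI; clarsimp)
  have "(\<lambda>n. flip (N n)) \<longlonglongrightarrow> flip one2"
    using N(2) lin by (intro bounded_linear.tendsto[of flip]) (simp_all add: linear_conv_bounded_linear)
  then have lim: "(\<lambda>n. flip (N n)) \<longlonglongrightarrow> one2" by (simp add: one2_def)
  have flip_flip: "flip (flip A) = A" for A by (cases A rule: prod_cases4) simp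
  have "flip one2 = one2" by (simp add: one2_def)
  then have nz: "flip A \<noteq> one2" if "A \<noteq> one2" for A using that flip_flip[of A] by metis
  have ev: "\<forall>\<^sub>F n in sequentially. flip (N n) \<in> products (flip ` G) \<and> flip (N n) \<noteq> one2"
    using N(1) by eventually_elim (use flip_products nz in blast)
  have "nonneg2 (flip A)" "det2 (flip A) = 1" if "A \<in> G" for A
    using G(1)[OF that] G(2)[OF that] by (cases A rule: prod_cases4; simp add: mult.commute)+
  then have "nonneg2 A" "det2 A = 1" if "A \<in> flip ` G" for A using that by blast+
  from contracting_generator_exists[OF _ this ev lim] fin
  obtain a d where ad: "(a, 0, 0, d) \<in> flip ` G" "a < 1" by auto
  then obtain A where A: "A \<in> G" "(a, 0, 0, d) = flip A" by blast
  then have "A = (d, 0, 0, a)" using flip_flip[of A] by (metis flip.simps)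
  then have dG: "(d, 0, 0, a) \<in> G" using A by simp
  have "a \<ge> 0" "d * a = 1" using G(1)[OF dG] G(2)[OF dG] by simp_all
  then have "d > 1" using ad(2) mult_left_mono[of d 1 a] by (force simp: mult.commute)
  with dG show ?thesis by blast
qed

text \<open>A word is diagonal until a generator with both off-diagonal entries positive occurs;
  from then on superadditivity keeps the off-diagonal product above the least positive value among
  the generators.\<close>

lemma products_diagonal_or_separated:
  assumes fin: "finite G" and G: "\<And>A. A \<in> G \<Longrightarrow> nonneg2 A" "\<And>A. A \<in> G \<Longrightarrow> det2 A = 1"
    and full: "\<And>a b c d. (a, b, c, d) \<in> G \<Longrightarrow> b = 0 \<and> c = 0 \<or> b \<noteq> 0 \<and> c \<noteq> 0"
  shows "\<exists>\<eta>>0. \<forall>a b c d. (a, b, c, d) \<in> products G \<longrightarrow> b = 0 \<and> c = 0 \<or> b * c \<ge> \<eta>"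
proof -
  obtain \<eta> where \<eta>: "\<eta> > 0" "\<And>A. A \<in> G \<Longrightarrow> prod12 A > 0 \<Longrightarrow> \<eta> \<le> prod12 A"
    using finite_positive_lower_bound[OF fin, of prod12] by metis
  define sep_inv where "sep_inv N \<longleftrightarrow> nonneg2 N \<and> det2 N = 1 \<and>
    (fst (snd N) = 0 \<and> fst (snd (snd N)) = 0 \<or> prod12 N \<ge> \<eta>)" for N
  have "sep_inv N" if "N \<in> products G" for N
    using that
  proof induction
    case one
    then show ?case by (simp add: sep_inv_def one2_def)
  next
    case (mult A N)
    have A: "nonneg2 A" "det2 A = 1" using G mult(1) by blast+
    have N: "nonneg2 N" "det2 N = 1" using mult.IH by (simp_all add: sep_inv_def)
    obtain p q r s where Ad: "A = (p, q, r, s)" by (cases A rule: prod_cases4)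
    obtain a b c d where Nd: "N = (a, b, c, d)" by (cases N rule: prod_cases4)
    have ge: "prod12 (A \<star> N) \<ge> prod12 A + prod12 N" by (rule prod12_mm_ge[OF A(1) N(1) A(2) N(2)])
    have nn: "prod12 A \<ge> 0" "prod12 N \<ge> 0" using A N by (simp_all add: Ad Nd)
    consider "q = 0" "r = 0" "b = 0" "c = 0" | "prod12 N \<ge> \<eta>" | "prod12 A > 0"
      using full[of p q r s] mult A(1) unfolding sep_inv_def Ad Nd by force
    then have "fst (snd (A \<star> N)) = 0 \<and> fst (snd (snd (A \<star> N))) = 0 \<or> prod12 (A \<star> N) \<ge> \<eta>"
    proof cases
      case 1
      then show ?thesis by (simp add: Ad Nd)
    next
      case 2
      then show ?thesis using ge nn by linarith
    next
      case 3
      then show ?thesis using \<eta>(2)[OF mult(1)] ge nn by linarith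
    qed
    then show ?case using A N nonneg2_mm by (simp add: sep_inv_def)
  qed
  then have "fst (snd N) = 0 \<and> fst (snd (snd N)) = 0 \<or> prod12 N \<ge> \<eta>" if "N \<in> products G" for N
    using that unfolding sep_inv_def by blast
  from this[of "(_, _, _, _)"] show ?thesis using \<eta>(1) by (intro exI[of _ \<eta>]) simp
qed

section \<open>Additive subsemigroups of the real line\<close>

lemma additive_semigroup_dense:
  fixes \<Sigma> :: "real set"
  assumes add: "\<And>x y. x \<in> \<Sigma> \<Longrightarrow> y \<in> \<Sigma> \<Longrightarrow> x + y \<in> \<Sigma>"
    and neg: "y \<in> \<Sigma>" "y < 0" and small: "\<And>\<epsilon>. \<epsilon> > 0 \<Longrightarrow> \<exists>x\<in>\<Sigma>. 0 < x \<and> x < \<epsilon>"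
    and \<epsilon>: "\<epsilon> > 0"
  shows "\<exists>z\<in>\<Sigma>. \<bar>z - t\<bar> < \<epsilon>"
proof -
  have mult: "real (Suc n) * x \<in> \<Sigma>" if "x \<in> \<Sigma>" for x n
  proof (induction n)
    case (Suc n)
    have "real (Suc (Suc n)) * x = x + real (Suc n) * x" by (simp add: algebra_simps)
    then show ?case using add[OF that Suc] by simp
  qed (use that in simp)
  obtain x where x: "x \<in> \<Sigma>" "0 < x" "x < \<epsilon>" using small[OF \<epsilon>] by blast
  obtain n where n: "- t < real n * - y" using ex_less_of_nat_mult[of "- y" "- t"] neg by auto
  \<comment> \<open>A multiple of \<open>y\<close> lies below \<open>t\<close>; from there steps of
    length \<open>x < \<epsilon>\<close> climb up to \<open>t\<close>.\<close>
  define z0 where "z0 = real (Suc n) * y"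
  have z0: "z0 \<in> \<Sigma>" "z0 < t" using mult[OF neg(1)] n neg by (simp_all add: z0_def algebra_simps)
  define k where "k = nat \<lfloor>(t - z0) / x\<rfloor>"
  have "real k \<le> (t - z0) / x" "(t - z0) / x < real k + 1"
    using z0 x unfolding k_def by (simp, linarith)
  then have k: "real k * x \<le> t - z0" "t - z0 < real k * x + x" using x by (simp_all add: field_simps)
  have "z0 + real k * x \<in> \<Sigma>"
  proof (cases k)
    case 0
    then show ?thesis using z0 by simp
  next
    case (Suc m)
    then show ?thesis using add[OF z0(1) mult[OF x(1), of m]] by simp
  qed
  moreover have "\<bar>z0 + real k * x - t\<bar> < \<epsilon>" using k x by linarith
  ultimately show ?thesis by blast
qed

text \<open>Arbitrarily small elements of one sign and a single element of the other give density.
  Otherwise there is a gap around 0, and the elements nearest to 0 on the two sides turn out to be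
  opposite and generate.\<close>

lemma additive_semigroup_dichotomy:
  fixes \<Sigma> :: "real set"
  assumes add: "\<And>x y. x \<in> \<Sigma> \<Longrightarrow> y \<in> \<Sigma> \<Longrightarrow> x + y \<in> \<Sigma>"
    and pos: "x0 \<in> \<Sigma>" "x0 > 0" and neg: "y0 \<in> \<Sigma>" "y0 < 0"
  shows "closure \<Sigma> = UNIV \<or> (\<exists>c>0. \<Sigma> = range (\<lambda>i::int. of_int i * c))"
proof -
  have dense: ?thesis if "\<And>t \<epsilon>. \<epsilon> > 0 \<Longrightarrow> \<exists>z\<in>\<Sigma>. \<bar>z - t\<bar> < \<epsilon>"
  proof (rule disjI1)
    show "closure \<Sigma> = UNIV"
      using \<open>\<And>t \<epsilon>. \<epsilon> > 0 \<Longrightarrow> \<exists>z\<in>\<Sigma>. \<bar>z - t\<bar> < \<epsilon>\<close> by (auto simp: closure_approachable dist_real_def)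
  qed
  consider (small_pos) "\<forall>\<epsilon>>0. \<exists>x\<in>\<Sigma>. 0 < x \<and> x < \<epsilon>" | (small_neg) "\<forall>\<epsilon>>0. \<exists>x\<in>\<Sigma>. 0 < - x \<and> - x < \<epsilon>"
    | (gap) \<epsilon>1 \<epsilon>2 where "\<epsilon>1 > 0" "\<epsilon>2 > 0" "\<And>x. x \<in> \<Sigma> \<Longrightarrow> x > 0 \<Longrightarrow> x \<ge> \<epsilon>1" "\<And>x. x \<in> \<Sigma> \<Longrightarrow> x < 0 \<Longrightarrow> - x \<ge> \<epsilon>2"
    by (metis neg_0_less_iff_less not_less)
  then show ?thesis
  proof cases
    case small_pos
    then show ?thesis by (intro dense additive_semigroup_dense[OF add neg]) auto
  next
    case small_neg
    show ?thesis
    proof (rule dense)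
      fix t \<epsilon> :: real assume "\<epsilon> > 0"
      have "\<exists>z\<in>uminus ` \<Sigma>. \<bar>z - (- t)\<bar> < \<epsilon>"
      proof (rule additive_semigroup_dense[OF _ _ _ _ \<open>\<epsilon> > 0\<close>])
        show "- x0 \<in> uminus ` \<Sigma>" "- x0 < 0" using pos by simp_all
        show "x + y \<in> uminus ` \<Sigma>" if "x \<in> uminus ` \<Sigma>" "y \<in> uminus ` \<Sigma>" for x y
          using that add by (force simp: image_iff intro: bexI[of _ "- x - y"])
        show "\<exists>x\<in>uminus ` \<Sigma>. 0 < x \<and> x < \<epsilon>" if "\<epsilon> > 0" for \<epsilon> using small_neg that by blast
      qed
      then show "\<exists>z\<in>\<Sigma>. \<bar>z - t\<bar> < \<epsilon>"
        by (auto simp: abs_minus_commute)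
    qed
  next
    case gap
    define \<delta> where "\<delta> = min \<epsilon>1 \<epsilon>2 / 2"
    have \<delta>: "\<delta> > 0" "2 * \<delta> \<le> \<epsilon>1" "2 * \<delta> \<le> \<epsilon>2" using gap by (auto simp: \<delta>_def)
    define P where "P = {x \<in> \<Sigma>. x > 0}"
    define N where "N = {x. - x \<in> \<Sigma> \<and> x > 0}"
    have bdd: "bdd_below P" "bdd_below N" by (auto simp: P_def N_def intro!: bdd_belowI[of _ 0])
    have "x0 \<in> P" "- y0 \<in> N" using pos neg by (simp_all add: P_def N_def)
    then have ne: "P \<noteq> {}" "N \<noteq> {}" by blast+
    obtain p where p: "p \<in> P" "p < Inf P + \<delta>" using cInf_lessD[OF ne(1), of "Inf P + \<delta>"] \<delta> by auto
    obtain n where n: "n \<in> N" "n < Inf N + \<delta>" using cInf_lessD[OF ne(2), of "Inf N + \<delta>"] \<delta> by auto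
    \<comment> \<open>Nearly minimal elements on the two sides must cancel: both have size at least
      \<open>2 * \<delta>\<close>, so a nonzero \<open>x - n\<close> would be closer to 0 than the
      infimum on its side.\<close>
    have eq: "x = n" if x: "x \<in> P" "x < Inf P + \<delta>" for x
    proof -
      have sum: "x + - n \<in> \<Sigma>" using x n by (intro add) (auto simp: P_def N_def)
      have x_ge: "x \<ge> 2 * \<delta>" using x gap(3) \<delta> by (force simp: P_def)
      have n_ge: "n \<ge> 2 * \<delta>" using n gap(4)[of "- n"] \<delta> by (force simp: N_def)
      have "\<not> x + - n > 0"
      proof
        assume "x + - n > 0"
        then have "Inf P \<le> x + - n" using sum bdd by (intro cInf_lower) (auto simp: P_def)
        then show False using x n_ge \<delta> by linarith
      qed
      moreover have "\<not> x + - n < 0"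
      proof
        assume "x + - n < 0"
        then have "Inf N \<le> n - x" using sum bdd by (intro cInf_lower) (auto simp: N_def)
        then show False using n x_ge \<delta> by linarith
      qed
      ultimately show ?thesis by simp
    qed
    have min: "p \<le> x" if "x \<in> P" for x using eq[OF p] eq[OF that] p by linarith
    have p\<Sigma>: "p \<in> \<Sigma>" "- p \<in> \<Sigma>" "p > 0" using p n eq[OF p] by (simp_all add: P_def N_def)
    have mult: "real k * x \<in> \<Sigma>" if "x = p \<or> x = - p" for x k
    proof (induction k)
      case 0
      then show ?case using add[OF p\<Sigma>(1,2)] by simp
    next
      case (Suc k)
      have "real (Suc k) * x = x + real k * x" by (simp add: algebra_simps)
      then show ?case using add[OF _ Suc, of x] that p\<Sigma> by auto
    qed
    have int: "of_int i * p \<in> \<Sigma>" for i :: int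
    proof (cases "i \<ge> 0")
      case True
      then show ?thesis using mult[of p "nat i"] by simp
    next
      case False
      then show ?thesis using mult[of "- p" "nat (- i)"] by simp
    qed
    have "x \<in> range (\<lambda>i::int. of_int i * p)" if x: "x \<in> \<Sigma>" for x
    proof -
      define i where "i = \<lfloor>x / p\<rfloor>"
      have "of_int i \<le> x / p" "x / p < of_int i + 1" by (simp_all add: i_def)
      then have i: "of_int i * p \<le> x" "x < of_int i * p + p" using p\<Sigma> by (simp_all add: field_simps)
      have "x + of_int (- i) * p \<in> \<Sigma>" using add[OF x int] .
      then have "x - of_int i * p \<in> P" if "x - of_int i * p > 0" using that by (simp add: P_def)
      then have "\<not> x - of_int i * p > 0" using min[of "x - of_int i * p"] i by linarith
      then have "x = of_int i * p" using i by simp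
      then show ?thesis by blast
    qed
    with int have "\<Sigma> = range (\<lambda>i::int. of_int i * p)" by auto
    with p\<Sigma>(3) show ?thesis by blast
  qed
qed

section \<open>Intervals of the circle\<close>

text \<open>The point with homogeneous coordinates \<open>x\<close> and \<open>y\<close>; the value
  at the zero vector is a mere default.\<close>

fun pt :: "real \<times> real \<Rightarrow> real option" where
  "pt (x, y) = (if y = 0 then None else Some (x / y))"

lemma pt_surj:
  obtains v where "v \<noteq> 0" "pt v = x"
proof (cases x)
  case None
  then show thesis using that[of "(1, 0)"] by (simp add: zero_prod_def)
next
  case (Some r)
  then show thesis using that[of "(r, 1)"] by (simp add: zero_prod_def)
qed

lemma pt_scaleR: "r \<noteq> 0 \<Longrightarrow> pt (r *\<^sub>R v) = pt v"
  by (cases v) simp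

lemma app_eq_zero_iff:
  assumes "det2 A \<noteq> 0"
  shows "app A v = 0 \<longleftrightarrow> v = 0"
proof
  assume "app A v = 0"
  then have "app (adj A \<star> A) v = 0" by (simp add: app_mm)
  then have "det2 A *\<^sub>R app one2 v = 0" by (simp add: mm_adj)
  then show "v = 0" using assms by (cases v) (simp add: one2_def zero_prod_def)
qed simp

lemma act_mobm_pt:
  assumes "det2 A > 0" "v \<noteq> 0"
  shows "act (mobm A) (embed (pt v)) = embed (pt (app A v))"
proof -
  obtain a b c d where A: "A = (a, b, c, d)" by (cases A rule: prod_cases4)
  obtain x y where v: "v = (x, y)" by (cases v)
  have act: "act (mob a b c d) = mob_fun a b c d" using assms by (simp add: A act_mob)
  show ?thesis
  proof (cases "y = 0")
    case True
    then have "x \<noteq> 0" using assms by (auto simp: v zero_prod_def)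
    then show ?thesis using True by (simp add: act A v mob_fun_def)
  next
    case False
    have num: "complex_of_real a * of_real (x / y) + of_real b = of_real ((a * x + b * y) / y)"
      and den: "complex_of_real c * of_real (x / y) + of_real d = of_real ((c * x + d * y) / y)"
      using False by (simp_all add: field_simps)
    have "act (mobm A) (embed (pt v)) = (if (c * x + d * y) / y = 0 then None
        else Some (complex_of_real ((a * x + b * y) / y) / of_real ((c * x + d * y) / y)))"
      using False unfolding A mobm.simps act v mob_fun_def by (simp add: num den del: of_real_divide of_real_add of_real_mult)
    then show ?thesis using False by (simp add: A v)
  qed
qed

lemma zero_le_mult_iff_same_sign:
  fixes k l x :: real
  assumes "k * l > 0"
  shows "0 \<le> k * x \<longleftrightarrow> 0 \<le> l * x"
  using assms by (auto simp: zero_less_mult_iff zero_le_mult_iff)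

text \<open>The two vectors represent the images of 0 and infinity. A matrix of positive determinant
  preserves the orientation of the circle, so in that case the arc is the image of [0, infinity]
  under \<open>B\<close>.\<close>

definition mat_interval :: "mat \<Rightarrow> complex option set" where
  "mat_interval B = embed ` circle_arc (pt (app B (0, 1))) (pt (app B (1, 0)))"

text \<open>Up to the factor \<open>det2 B\<close>, the components of \<open>app (adj B) v\<close>
  are the coordinates of \<open>v\<close> in the columns of \<open>B\<close>; on the arc they are
  never of opposite sign. The cases are which of the three points are infinite, and the sign of
  \<open>c * d\<close>, which decides whether an arc with finite end points passes through
  infinity.\<close>

lemma pt_in_circle_arc_iff:
  assumes "det2 B > 0" "v \<noteq> 0"
  shows "pt v \<in> circle_arc (pt (app B (0, 1))) (pt (app B (1, 0)))
    \<longleftrightarrow> fst (app (adj B) v) * snd (app (adj B) v) \<ge> 0"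
proof -
  obtain a b c d where B: "B = (a, b, c, d)" by (cases B rule: prod_cases4)
  obtain x y where v: "v = (x, y)" by (cases v)
  have det: "a * d - b * c > 0" using assms by (simp add: B)
  have ends: "pt (app B (0, 1)) = (if d = 0 then None else Some (b / d))"
    "pt (app B (1, 0)) = (if c = 0 then None else Some (a / c))" by (simp_all add: B)
  have val: "fst (app (adj B) v) * snd (app (adj B) v) = (d * x - b * y) * (a * y - c * x)"
    by (simp add: B v algebra_simps)
  have gap: "a / c - b / d = (a * d - b * c) / (c * d)" if "c \<noteq> 0" "d \<noteq> 0"
    using that by (simp add: field_simps)
  show ?thesis
  proof (cases "y = 0")
    case True
    then have x: "x \<noteq> 0" using assms by (auto simp: v zero_prod_def)
    have "(d * x - b * y) * (a * y - c * x) = - (x\<^sup>2 * (c * d))"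
      by (simp add: True power2_eq_square)
    then have R: "(d * x - b * y) * (a * y - c * x) \<ge> 0 \<longleftrightarrow> c * d \<le> 0"
      using x by (simp add: mult_le_0_iff zero_le_mult_iff)
    show ?thesis
    proof (cases "c = 0 \<or> d = 0")
      case True
      then show ?thesis using det R \<open>y = 0\<close> unfolding val ends by (auto simp: v)
    next
      case False
      have "b / d \<le> a / c \<longleftrightarrow> (a * d - b * c) / (c * d) \<ge> 0" using gap False by (metis diff_ge_0_iff_ge)
      also have "\<dots> \<longleftrightarrow> c * d > 0" using det False by (simp add: zero_le_divide_iff) (auto simp: less_le)
      finally have "b / d \<le> a / c \<longleftrightarrow> c * d > 0" .
      then show ?thesis using R False \<open>y = 0\<close> unfolding val ends by (auto simp: v not_less[symmetric])
    qed
  next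
    case False
    define z where "z = x / y"
    have x: "x = z * y" using False by (simp add: z_def)
    have "(d * x - b * y) * (a * y - c * x) = y\<^sup>2 * ((d * z - b) * (a - c * z))"
      by (simp add: x power2_eq_square algebra_simps)
    then have R: "(d * x - b * y) * (a * y - c * x) \<ge> 0 \<longleftrightarrow> (d * z - b) * (a - c * z) \<ge> 0"
      using False by (simp add: zero_le_mult_iff)
    have ptv: "pt v = Some z" using False by (simp add: v z_def)
    consider "d = 0" | "c = 0" "d \<noteq> 0" | "c \<noteq> 0" "d \<noteq> 0" by blast
    then show ?thesis
    proof cases
      case 1
      then have "c \<noteq> 0" and bc: "- b * c > 0" using det by auto
      from bc have "0 \<le> - b * (a - c * z) \<longleftrightarrow> 0 \<le> c * (a - c * z)"
        by (rule zero_le_mult_iff_same_sign)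
      also have "\<dots> \<longleftrightarrow> 0 \<le> c\<^sup>2 * (a / c - z)" 
      proof -
        have "c * (a - c * z) = c\<^sup>2 * (a / c - z)"
          using \<open>c \<noteq> 0\<close> by (simp add: right_diff_distrib power2_eq_square)
        then show ?thesis by (simp only:)
      qed
      also have "\<dots> \<longleftrightarrow> z \<le> a / c" using \<open>c \<noteq> 0\<close> by (simp add: zero_le_mult_iff)
      finally show ?thesis using 1 R \<open>c \<noteq> 0\<close> unfolding val ends ptv by (simp add: image_iff)
    next
      case 2
      then have "a * d > 0" using det by simp
      then have "0 \<le> (d * z - b) * a \<longleftrightarrow> 0 \<le> (d * z - b) * d"
        unfolding mult.commute[of "d * z - b"] by (rule zero_le_mult_iff_same_sign)
      also have "\<dots> \<longleftrightarrow> 0 \<le> d\<^sup>2 * (z - b / d)" 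
      proof -
        have "(d * z - b) * d = d\<^sup>2 * (z - b / d)"
          using 2 by (simp add: right_diff_distrib left_diff_distrib power2_eq_square)
        then show ?thesis by (simp only:)
      qed
      also have "\<dots> \<longleftrightarrow> b / d \<le> z" using 2 by (simp add: zero_le_mult_iff)
      finally show ?thesis using 2 R unfolding val ends ptv by (simp add: image_iff)
    next
      case 3
      have eq: "(d * z - b) * (a - c * z) = (c * d) * ((z - b / d) * (a / c - z))"
        using 3 by (simp add: field_simps)
      show ?thesis
      proof (cases "c * d > 0")
        case True
        then have "a / c > b / d" using gap 3 det by (smt (verit) divide_pos_pos)
        moreover have "0 \<le> (d * z - b) * (a - c * z) \<longleftrightarrow> 0 \<le> (z - b / d) * (a / c - z)"
          unfolding eq using True by (simp add: zero_le_mult_iff[of "c * d"])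
        moreover have "0 \<le> (z - b / d) * (a / c - z) \<longleftrightarrow> b / d \<le> z \<and> z \<le> a / c"
          using \<open>a / c > b / d\<close> by (auto simp: zero_le_mult_iff)
        ultimately show ?thesis using 3 R unfolding val ends ptv by (auto simp: image_iff)
      next
        case False
        then have cd: "c * d < 0" using 3 by (auto simp: not_less less_le)
        then have lt: "a / c < b / d" using gap 3 det by (smt (verit) divide_pos_neg)
        moreover have "0 \<le> (d * z - b) * (a - c * z) \<longleftrightarrow> (z - b / d) * (a / c - z) \<le> 0"
          unfolding eq using cd by (simp add: zero_le_mult_iff[of "c * d"] not_le[symmetric])
        moreover have "(z - b / d) * (a / c - z) \<le> 0 \<longleftrightarrow> b / d \<le> z \<or> z \<le> a / c"
          using lt by (auto simp: mult_le_0_iff)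
        ultimately show ?thesis using 3 R unfolding val ends ptv by (auto simp: image_iff)
      qed
    qed
  qed
qed

lemma mat_interval_iff:
  assumes "det2 B > 0"
  shows "w \<in> mat_interval B \<longleftrightarrow> (\<exists>v. v \<noteq> 0 \<and> w = embed (pt v) \<and> fst (app (adj B) v) * snd (app (adj B) v) \<ge> 0)"
proof
  assume "w \<in> mat_interval B"
  then obtain x where x: "x \<in> circle_arc (pt (app B (0, 1))) (pt (app B (1, 0)))" "w = embed x"
    by (auto simp: mat_interval_def)
  obtain v where "v \<noteq> 0" "pt v = x" by (rule pt_surj)
  then show "\<exists>v. v \<noteq> 0 \<and> w = embed (pt v) \<and> fst (app (adj B) v) * snd (app (adj B) v) \<ge> 0"
    using x pt_in_circle_arc_iff[OF assms] by blast
next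
  assume "\<exists>v. v \<noteq> 0 \<and> w = embed (pt v) \<and> fst (app (adj B) v) * snd (app (adj B) v) \<ge> 0"
  then show "w \<in> mat_interval B" using pt_in_circle_arc_iff[OF assms] by (auto simp: mat_interval_def)
qed

lemma embed_pt_in_mat_interval_iff:
  assumes "det2 B > 0" "v \<noteq> 0"
  shows "embed (pt v) \<in> mat_interval B \<longleftrightarrow> fst (app (adj B) v) * snd (app (adj B) v) \<ge> 0"
proof -
  have "inj embed" by (intro option.inj_map injI) simp
  then have "embed (pt v) \<in> mat_interval B \<longleftrightarrow> pt v \<in> circle_arc (pt (app B (0, 1))) (pt (app B (1, 0)))"
    unfolding mat_interval_def by (rule inj_image_mem_iff)
  then show ?thesis using pt_in_circle_arc_iff[OF assms] by simp
qed

lemma pt_endpoints_distinct: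
  assumes "det2 B > 0"
  shows "pt (app B (0, 1)) \<noteq> pt (app B (1, 0))"
  using assms by (cases B rule: prod_cases4) (auto simp: frac_eq_eq mult.commute)

lemma closed_interval_mat_interval:
  assumes "det2 B > 0"
  shows "closed_interval_with_endpoints (mat_interval B) (embed (pt (app B (0, 1)))) (embed (pt (app B (1, 0))))"
  unfolding closed_interval_with_endpoints_def mat_interval_def
  using pt_endpoints_distinct[OF assms] by blast

section \<open>Moebius maps in coordinates relative to \<open>B\<close>\<close>

text \<open>Up to the factor \<open>det2 B\<close>, this is conjugation by \<open>B\<close>.\<close>

definition cmob :: "mat \<Rightarrow> mat \<Rightarrow> mobius" where
  "cmob B N = mobm (B \<star> N \<star> adj B)"

lemma cmob_mm:
  assumes "det2 B > 0" "det2 M > 0" "det2 N > 0"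
  shows "cmob B (M \<star> N) = cmob B M * cmob B N"
proof -
  have "B \<star> M \<star> adj B \<star> (B \<star> N \<star> adj B) = B \<star> M \<star> (adj B \<star> B) \<star> N \<star> adj B"
    by (simp only: mm_assoc)
  also have "\<dots> = det2 B *\<^sub>R (B \<star> (M \<star> N) \<star> adj B)"
    by (simp add: mm_adj mm_assoc)
  finally have "cmob B M * cmob B N = mobm (det2 B *\<^sub>R (B \<star> (M \<star> N) \<star> adj B))"
    using assms by (simp add: cmob_def flip: mobm_mm)
  also have "\<dots> = mobm (B \<star> (M \<star> N) \<star> adj B)" using assms by (intro mobm_scaleR) auto
  finally show ?thesis by (simp add: cmob_def)
qed

lemma cmob_eq_iff:
  assumes "det2 B > 0" "det2 M > 0" "det2 N > 0"
  shows "cmob B M = cmob B N \<longleftrightarrow> (\<exists>r. r \<noteq> 0 \<and> M = r *\<^sub>R N)"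
proof
  assume "cmob B M = cmob B N"
  then obtain r where r: "r \<noteq> 0" "B \<star> M \<star> adj B = r *\<^sub>R (B \<star> N \<star> adj B)"
    using mobm_eq_iff[of "B \<star> M \<star> adj B" "B \<star> N \<star> adj B"] assms unfolding cmob_def by auto
  then have "(det2 B)\<^sup>2 *\<^sub>R M = (det2 B)\<^sup>2 *\<^sub>R (r *\<^sub>R N)"
    using adj_conj_conj[of B M] adj_conj_conj[of B N] by (simp add: mult.commute)
  then have "M = r *\<^sub>R N" using assms(1) by (simp only: real_vector.scale_left_imp_eq[of "(det2 B)\<^sup>2"] scaleR_cancel_left) auto
  then show "\<exists>r. r \<noteq> 0 \<and> M = r *\<^sub>R N" using r(1) by blast
next
  assume "\<exists>r. r \<noteq> 0 \<and> M = r *\<^sub>R N"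
  then obtain r where "r \<noteq> 0" "M = r *\<^sub>R N" by blast
  then show "cmob B M = cmob B N"
    using mobm_scaleR[of r "B \<star> N \<star> adj B"] assms by (simp add: cmob_def)
qed

lemma cmob_one: "det2 B > 0 \<Longrightarrow> cmob B one2 = 1"
  using mobm_scaleR[of "det2 B" one2] by (simp add: cmob_def mm_adj)

lemma cmob_adj_conj:
  assumes "det2 B > 0" "det2 A > 0" "r \<noteq> 0"
  shows "cmob B (r *\<^sub>R (adj B \<star> A \<star> B)) = mobm A"
proof -
  have "B \<star> (r *\<^sub>R (adj B \<star> A \<star> B)) \<star> adj B = (r * (det2 B)\<^sup>2) *\<^sub>R A"
    using adj_conj_conj[of "adj B" A] by simp
  then show ?thesis using mobm_scaleR[of "r * (det2 B)\<^sup>2" A] assms by (simp add: cmob_def)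
qed

lemma cmob_surj:
  assumes "det2 B > 0"
  obtains N where "det2 N = 1" "cmob B N = h"
proof -
  obtain A where A: "det2 A = 1" "mobm A = h" by (rule mobm_surj)
  show thesis
    using A assms by (intro that[of "(1 / det2 B) *\<^sub>R (adj B \<star> A \<star> B)"])
      (simp_all only: cmob_adj_conj det2_scaleR det2_mm det2_adj, simp_all add: power2_eq_square cmob_adj_conj)
qed

lemma act_cmob:
  assumes "det2 B > 0" "det2 N > 0" "s \<noteq> 0"
  shows "act (cmob B N) (embed (pt (app B s))) = embed (pt (app B (app N s)))"
proof -
  have nz: "app B s \<noteq> 0" using assms by (simp add: app_eq_zero_iff)
  have "act (cmob B N) (embed (pt (app B s))) = embed (pt (app (B \<star> N \<star> adj B) (app B s)))"
    unfolding cmob_def using assms nz by (intro act_mobm_pt) auto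
  also have "app (B \<star> N \<star> adj B) (app B s) = app (B \<star> N) (app (adj B \<star> B) s)"
    by (simp add: app_mm)
  also have "\<dots> = det2 B *\<^sub>R app B (app N s)"
    by (simp add: mm_adj app_mm) (cases s, simp add: one2_def)
  finally show ?thesis using assms by (simp add: pt_scaleR)
qed

lemma mat_interval_iff':
  assumes "det2 B > 0"
  shows "w \<in> mat_interval B \<longleftrightarrow> (\<exists>s. s \<noteq> 0 \<and> w = embed (pt (app B s)) \<and> fst s * snd s \<ge> 0)"
proof
  assume "w \<in> mat_interval B"
  then obtain v where v: "v \<noteq> 0" "w = embed (pt v)" "fst (app (adj B) v) * snd (app (adj B) v) \<ge> 0"
    using mat_interval_iff[OF assms] by blast
  have "app B (app (adj B) v) = det2 B *\<^sub>R v"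
    by (simp add: app_mm[symmetric] mm_adj) (cases v, simp add: one2_def)
  then show "\<exists>s. s \<noteq> 0 \<and> w = embed (pt (app B s)) \<and> fst s * snd s \<ge> 0"
    using v assms by (intro exI[of _ "app (adj B) v"]) (simp add: pt_scaleR app_eq_zero_iff)
next
  assume "\<exists>s. s \<noteq> 0 \<and> w = embed (pt (app B s)) \<and> fst s * snd s \<ge> 0"
  then obtain s where s: "s \<noteq> 0" "w = embed (pt (app B s))" "fst s * snd s \<ge> 0" by blast
  have "app (adj B) (app B s) = det2 B *\<^sub>R s"
    by (simp add: app_mm[symmetric] mm_adj) (cases s, simp add: one2_def)
  then have "fst (app (adj B) (app B s)) * snd (app (adj B) (app B s)) = (det2 B)\<^sup>2 * (fst s * snd s)"
    by (simp add: power2_eq_square)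
  also have "\<dots> \<ge> 0" using s by simp
  finally show "w \<in> mat_interval B"
    using s embed_pt_in_mat_interval_iff[OF assms, of "app B s"] assms by (simp add: app_eq_zero_iff)
qed

lemma embed_pt_app_in_mat_interval_iff:
  assumes "det2 B > 0" "s \<noteq> 0"
  shows "embed (pt (app B s)) \<in> mat_interval B \<longleftrightarrow> fst s * snd s \<ge> 0"
proof -
  have "app (adj B) (app B s) = det2 B *\<^sub>R s"
    by (simp add: app_mm[symmetric] mm_adj) (cases s, simp add: one2_def)
  then have "fst (app (adj B) (app B s)) * snd (app (adj B) (app B s)) = (det2 B)\<^sup>2 * (fst s * snd s)"
    by (simp add: power2_eq_square)
  moreover have "0 \<le> (det2 B)\<^sup>2 * (fst s * snd s) \<longleftrightarrow> 0 \<le> fst s * snd s"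
    using assms(1) by (simp add: zero_le_mult_iff[of "(det2 B)\<^sup>2"])
  ultimately show ?thesis
    using embed_pt_in_mat_interval_iff[OF assms(1), of "app B s"] assms by (simp add: app_eq_zero_iff)
qed

lemma cmob_in_Mob_iff:
  assumes B: "det2 B > 0" and N: "det2 N > 0"
  shows "cmob B N \<in> Mob (mat_interval B) \<longleftrightarrow> (\<forall>s. fst s * snd s \<ge> 0 \<longrightarrow> fst (app N s) * snd (app N s) \<ge> 0)"
proof -
  have "cmob B N \<in> Mob (mat_interval B) \<longleftrightarrow> (\<forall>w\<in>mat_interval B. act (cmob B N) w \<in> mat_interval B)"
    by (auto simp: Mob_def)
  also have "\<dots> \<longleftrightarrow> (\<forall>s. s \<noteq> 0 \<longrightarrow> fst s * snd s \<ge> 0 \<longrightarrow> embed (pt (app B (app N s))) \<in> mat_interval B)"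
  proof
    assume L: "\<forall>w\<in>mat_interval B. act (cmob B N) w \<in> mat_interval B"
    show "\<forall>s. s \<noteq> 0 \<longrightarrow> fst s * snd s \<ge> 0 \<longrightarrow> embed (pt (app B (app N s))) \<in> mat_interval B"
    proof (intro allI impI)
      fix s :: "real \<times> real" assume s: "s \<noteq> 0" "fst s * snd s \<ge> 0"
      then have "embed (pt (app B s)) \<in> mat_interval B" using embed_pt_app_in_mat_interval_iff[OF B] by blast
      with L have "act (cmob B N) (embed (pt (app B s))) \<in> mat_interval B" by blast
      then show "embed (pt (app B (app N s))) \<in> mat_interval B" by (simp only: act_cmob[OF B N s(1)])
    qed
  next
    assume R: "\<forall>s. s \<noteq> 0 \<longrightarrow> fst s * snd s \<ge> 0 \<longrightarrow> embed (pt (app B (app N s))) \<in> mat_interval B"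
    show "\<forall>w\<in>mat_interval B. act (cmob B N) w \<in> mat_interval B"
    proof
      fix w assume "w \<in> mat_interval B"
      then obtain s where s: "s \<noteq> 0" "w = embed (pt (app B s))" "fst s * snd s \<ge> 0"
        using mat_interval_iff'[OF B] by blast
      then have "embed (pt (app B (app N s))) \<in> mat_interval B" using R by blast
      then show "act (cmob B N) w \<in> mat_interval B" by (simp only: s(2) act_cmob[OF B N s(1)])
    qed
  qed
  also have "\<dots> \<longleftrightarrow> (\<forall>s. s \<noteq> 0 \<longrightarrow> fst s * snd s \<ge> 0 \<longrightarrow> fst (app N s) * snd (app N s) \<ge> 0)"
    using embed_pt_app_in_mat_interval_iff[OF B] N by (simp add: app_eq_zero_iff)
  also have "\<dots> \<longleftrightarrow> (\<forall>s. fst s * snd s \<ge> 0 \<longrightarrow> fst (app N s) * snd (app N s) \<ge> 0)"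
    by (metis (no_types, lifting) app_zero_right fst_zero mult_zero_left order_refl)
  finally show ?thesis .
qed

lemma nonneg2_preserves_quadrants:
  assumes "nonneg2 N" "fst s * snd s \<ge> 0"
  shows "fst (app N s) * snd (app N s) \<ge> 0"
proof -
  obtain a b c d where N: "N = (a, b, c, d)" by (cases N rule: prod_cases4)
  obtain x y where s: "s = (x, y)" by (cases s)
  have xy: "x * y \<ge> 0" using assms by (simp add: s)
  have "fst (app N s) * snd (app N s) = a * c * x\<^sup>2 + (a * d + b * c) * (x * y) + b * d * y\<^sup>2"
    by (simp add: N s power2_eq_square algebra_simps)
  also have "\<dots> \<ge> 0" using assms xy by (simp add: N)
  finally show ?thesis .
qed

text \<open>The axes give \<open>a * c \<ge> 0\<close> and \<open>b * d \<ge> 0\<close>. If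
  \<open>a * d \<le> 0\<close>, then \<open>b * c < 0\<close>, so the line
  \<open>a * x + b * y = 0\<close> runs through the region \<open>x * y \<ge> 0\<close>; just beside
  it the first component takes the sign opposite to that of the second.\<close>

lemma nonneg2_if_preserves_quadrants:
  assumes det: "det2 N > 0" and pres: "\<And>s. fst s * snd s \<ge> 0 \<Longrightarrow> fst (app N s) * snd (app N s) \<ge> 0"
  shows "nonneg2 N \<or> nonneg2 (- N)"
proof -
  obtain a b c d where N: "N = (a, b, c, d)" by (cases N rule: prod_cases4)
  have D: "a * d - b * c > 0" using det by (simp add: N)
  have q: "(a * x + b * y) * (c * x + d * y) \<ge> 0" if "x * y \<ge> 0" for x y
    using pres[of "(x, y)"] that by (simp add: N)
  have ac: "a * c \<ge> 0" using q[of 1 0] by simp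
  have bd: "b * d \<ge> 0" using q[of 0 1] by simp
  have "a * d > 0"
  proof (rule ccontr)
    assume "\<not> a * d > 0"
    then have bc: "b * c < 0" using D by linarith
    define D where "D = a * d - b * c"
    \<comment> \<open>On that line the second component of the test vector's image is
      \<open>D\<close> or \<open>- D\<close>; the displacement by \<open>\<epsilon>\<close> changes
      it by less than \<open>D\<close>.\<close>
    define \<epsilon> where "\<epsilon> = D / (2 * (\<bar>d\<bar> + 1))"
    have "D > 0" using D by (simp add: D_def)
    then have \<epsilon>: "\<epsilon> > 0" by (simp add: \<epsilon>_def)
    have "\<bar>d\<bar> * \<epsilon> \<le> (\<bar>d\<bar> + 1) * \<epsilon>" using \<epsilon> by (simp add: mult_right_mono)
    also have "\<dots> = D / 2" by (simp add: \<epsilon>_def field_simps)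
    finally have "\<bar>d * \<epsilon>\<bar> < D" using \<open>D > 0\<close> \<epsilon> by (simp add: abs_mult)
    then have d\<epsilon>: "d * \<epsilon> < D" "- (d * \<epsilon>) < D" by linarith+
    consider "b < 0" "c > 0" | "b > 0" "c < 0" using bc by (auto simp: mult_less_0_iff)
    then show False
    proof cases
      case 1
      then have "a \<ge> 0" using ac by (simp add: zero_le_mult_iff)
      then have "- b * (a + \<epsilon>) \<ge> 0" using 1 \<epsilon> by (intro mult_nonneg_nonneg) auto
      then have "(a * - b + b * (a + \<epsilon>)) * (c * - b + d * (a + \<epsilon>)) \<ge> 0" by (rule q)
      moreover have "(a * - b + b * (a + \<epsilon>)) * (c * - b + d * (a + \<epsilon>)) = (b * \<epsilon>) * (D + d * \<epsilon>)"
        by (simp add: D_def algebra_simps)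
      moreover have "(b * \<epsilon>) * (D + d * \<epsilon>) < 0"
        using 1 \<epsilon> d\<epsilon> by (intro mult_neg_pos) (auto simp: mult_less_0_iff)
      ultimately show False by simp
    next
      case 2
      then have "a \<le> 0" using ac by (simp add: zero_le_mult_iff)
      then have "b * (\<epsilon> - a) \<ge> 0" using 2 \<epsilon> by simp
      then have "(a * b + b * (\<epsilon> - a)) * (c * b + d * (\<epsilon> - a)) \<ge> 0" by (rule q)
      moreover have "(a * b + b * (\<epsilon> - a)) * (c * b + d * (\<epsilon> - a)) = (b * \<epsilon>) * (d * \<epsilon> - D)"
        by (simp add: D_def algebra_simps)
      moreover have "(b * \<epsilon>) * (d * \<epsilon> - D) < 0"
        using 2 \<epsilon> d\<epsilon> by (intro mult_pos_neg) auto
      ultimately show False by simp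
    qed
  qed
  then show ?thesis using ac bd by (auto simp: N zero_less_mult_iff zero_le_mult_iff)
qed

section \<open>The diagonal group as stabiliser of the interval\<close>

definition dg :: "real \<Rightarrow> mat" where
  "dg x = (exp x, 0, 0, exp (- x))"

lemma det2_dg [simp]: "det2 (dg x) = 1"
  by (simp add: dg_def flip: exp_add)

lemma dg_add: "dg (x + y) = dg x \<star> dg y"
  by (simp add: dg_def flip: exp_add)

lemma dg_0 [simp]: "dg 0 = one2"
  by (simp add: dg_def one2_def)

lemma nonneg2_dg [simp]: "nonneg2 (dg x)"
  by (simp add: dg_def)

lemma dg_eq_scaleR_iff: "dg x = r *\<^sub>R dg y \<longleftrightarrow> r = 1 \<and> x = y"
proof
  assume "dg x = r *\<^sub>R dg y"
  then have *: "exp x = r * exp y" "exp (- x) = r * exp (- y)" by (simp_all add: dg_def)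
  have "exp (- x) * exp x = r * exp (- y) * (r * exp y)" using * by simp
  then have "r * r = 1" by (simp add: exp_minus field_simps)
  moreover have "r > 0" using *(1) by (metis exp_gt_zero zero_less_mult_pos2)
  ultimately have "r = 1" by (metis abs_of_pos real_sqrt_abs2 real_sqrt_one)
  then show "r = 1 \<and> x = y" using * by simp
qed simp

lemma diagonal_eq_dg:
  assumes "a * d = 1" "a > 0"
  shows "(a, 0, 0, d) = dg (ln a)"
  using assms by (simp add: dg_def exp_minus field_simps)

lemma cmob_dg_eq_iff:
  assumes "det2 B > 0"
  shows "cmob B (dg x) = cmob B (dg y) \<longleftrightarrow> x = y"
  using cmob_eq_iff[OF assms, of "dg x" "dg y"] by (auto simp: dg_eq_scaleR_iff)

lemma cmob_dg_add: "det2 B > 0 \<Longrightarrow> cmob B (dg (x + y)) = cmob B (dg x) * cmob B (dg y)"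
  by (simp add: dg_add cmob_mm)

lemma cmob_dg_minus: "det2 B > 0 \<Longrightarrow> cmob B (dg (- x)) * cmob B (dg x) = 1"
  by (simp add: cmob_one flip: cmob_dg_add)

lemma cmob_in_MobI:
  assumes "det2 B > 0" "det2 N > 0" "nonneg2 N"
  shows "cmob B N \<in> Mob (mat_interval B)"
  using assms cmob_in_Mob_iff nonneg2_preserves_quadrants by blast

text \<open>A stabilising map and its inverse both preserve the interval, so a lift and its adjugate
  each have entries of a single sign. The adjugate negates the off-diagonal entries and keeps the
  diagonal ones; hence one of the two pairs vanishes, and the determinant shows that it is the
  off-diagonal pair.\<close>

lemma Mob0_mat_interval:
  assumes B: "det2 B > 0"
  shows "Mob0 (mat_interval B) = range (\<lambda>x. cmob B (dg x))"
proof
  show "range (\<lambda>x. cmob B (dg x)) \<subseteq> Mob0 (mat_interval B)"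
  proof
    fix h assume "h \<in> range (\<lambda>x. cmob B (dg x))"
    then obtain x where h: "h = cmob B (dg x)" by blast
    have sub: "act (cmob B (dg y)) ` mat_interval B \<subseteq> mat_interval B" for y
      using cmob_in_MobI[OF B, of "dg y"] by (simp add: Mob_def)
    have "act h (act (cmob B (dg (- x))) w) = w" for w
      using cmob_dg_minus[OF B, of "- x"] by (metis act_mult act_one comp_apply h id_apply minus_minus)
    then have "mat_interval B \<subseteq> act h ` mat_interval B" using sub[of "- x"] by (metis image_eqI image_subset_iff subsetI)
    then show "h \<in> Mob0 (mat_interval B)" using sub[of x] by (auto simp: Mob0_def h)
  qed
next
  show "Mob0 (mat_interval B) \<subseteq> range (\<lambda>x. cmob B (dg x))"
  proof
    fix h assume h: "h \<in> Mob0 (mat_interval B)"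
    obtain N where N: "det2 N = 1" "cmob B N = h" using cmob_surj[OF B] by blast
    have adjN: "cmob B (adj N) * h = 1"
      using cmob_mm[OF B, of "adj N" N] N by (simp add: mm_adj cmob_one B)
    have "act (cmob B (adj N)) w \<in> mat_interval B" if w: "w \<in> mat_interval B" for w
    proof -
      have "w \<in> act h ` mat_interval B" using h w by (simp add: Mob0_def)
      then obtain w' where w': "w' \<in> mat_interval B" "act h w' = w" by blast
      have "act (cmob B (adj N)) w = w'" using adjN w'(2) by (metis act_mult act_one comp_apply id_apply)
      then show ?thesis using w' by simp
    qed
    then have "cmob B (adj N) \<in> Mob (mat_interval B)" by (auto simp: Mob_def)
    then have 1: "nonneg2 (adj N) \<or> nonneg2 (- adj N)"
      using cmob_in_Mob_iff[OF B, of "adj N"] N by (intro nonneg2_if_preserves_quadrants) auto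
    have "cmob B N \<in> Mob (mat_interval B)" using h N by (auto simp: Mob0_def Mob_def)
    then have 2: "nonneg2 N \<or> nonneg2 (- N)"
      using cmob_in_Mob_iff[OF B, of N] N by (intro nonneg2_if_preserves_quadrants) auto
    obtain a b c d where Nd: "N = (a, b, c, d)" by (cases N rule: prod_cases4)
    have det: "a * d - b * c = 1" using N by (simp add: Nd)
    have "b = 0 \<and> c = 0 \<or> a = 0 \<and> d = 0" using 1 2 by (auto simp: Nd)
    moreover have "b * c \<ge> 0" using 2 by (auto simp: Nd zero_le_mult_iff)
    ultimately have bc: "b = 0" "c = 0" using det by auto
    have ad: "a * d = 1" using det bc by simp
    show "h \<in> range (\<lambda>x. cmob B (dg x))"
    proof (cases "a > 0")
      case True
      then have "N = dg (ln a)" using diagonal_eq_dg[OF ad] by (simp add: Nd bc)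
      then show ?thesis using N by auto
    next
      case False
      then have "- a > 0" using ad by (cases "a = 0") auto
      then have "- N = dg (ln (- a))" using diagonal_eq_dg[of "- a" "- d"] ad by (simp add: Nd bc)
      moreover have "cmob B (- N) = cmob B N"
        using cmob_eq_iff[OF B, of "- N" N] N det2_scaleR[of "-1" N] by (auto intro!: exI[of _ "-1"])
      ultimately show ?thesis using N by (metis rangeI)
    qed
  qed
qed

lemma tendsto_cmob_dg:
  assumes "det2 B > 0" "(f \<longlongrightarrow> x) F"
  shows "((\<lambda>n. cmob B (dg (f n))) \<longlongrightarrow> cmob B (dg x)) F"
proof -
  have "((\<lambda>n. dg (f n)) \<longlongrightarrow> dg x) F"
    unfolding dg_def by (intro tendsto_Pair tendsto_intros assms)
  then have "((\<lambda>n. B \<star> dg (f n) \<star> adj B) \<longlongrightarrow> B \<star> dg x \<star> adj B) F" by (intro tendsto_intros)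
  then show ?thesis unfolding cmob_def by (rule tendsto_mobm) (use assms in simp)
qed

text \<open>Two lifts of determinant 1 differ by a sign, and the sign -1 would make the diagonal of
  \<open>N\<close> vanish although its product is at least 1. Equations between words in
  \<open>S\<close> thereby become equations between matrices.\<close>

lemma nonneg2_unique:
  assumes B: "det2 B > 0" and M: "nonneg2 M" "det2 M = 1" and N: "nonneg2 N" "det2 N = 1"
    and eq: "cmob B M = cmob B N"
  shows "M = N"
proof -
  obtain r where r: "r \<noteq> 0" "M = r *\<^sub>R N" using cmob_eq_iff[OF B, of M N] M N eq by auto
  have "r\<^sup>2 = 1" using M N r(2) by simp
  moreover have "r \<noteq> -1"
  proof
    assume "r = -1"
    obtain a b c d where Nd: "N = (a, b, c, d)" by (cases N rule: prod_cases4)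
    have "a \<ge> 0" "d \<ge> 0" "- a \<ge> 0" "- d \<ge> 0" "b * c \<ge> 0"
      using M N r \<open>r = -1\<close> by (simp_all add: Nd)
    moreover have "a * d - b * c = 1" using N by (simp add: Nd)
    ultimately show False by auto
  qed
  ultimately show ?thesis using r by (simp add: power2_eq_1_iff)
qed

text \<open>
  The matrix entries are taken relative to \<open>B\<close>; the ratio of the second to the first diagonal entry is invariant under
  scaling and equals \<open>exp (- 2 x)\<close> at \<open>dg x\<close>.
\<close>

lemma open_cmob_ratio:
  assumes B: "det2 B > 0"
  shows "open {h. \<exists>N. det2 N = 1 \<and> cmob B N = h \<and> l * (fst N)\<^sup>2 < fst N * snd (snd (snd N))
    \<and> fst N * snd (snd (snd N)) < u * (fst N)\<^sup>2}" (is "open ?V")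
proof -
  define R where "R N \<longleftrightarrow> l * (fst N)\<^sup>2 < fst N * snd (snd (snd N)) \<and> fst N * snd (snd (snd N)) < u * (fst N)\<^sup>2"
    for N :: mat
  have R_scale: "R (r *\<^sub>R N) \<longleftrightarrow> R N" if "r \<noteq> 0" for r N
  proof -
    have r: "r\<^sup>2 > 0" using that by simp
    have "R (r *\<^sub>R N) \<longleftrightarrow> r\<^sup>2 * (l * (fst N)\<^sup>2) < r\<^sup>2 * (fst N * snd (snd (snd N)))
        \<and> r\<^sup>2 * (fst N * snd (snd (snd N))) < r\<^sup>2 * (u * (fst N)\<^sup>2)"
      by (simp add: R_def power_mult_distrib power2_eq_square mult_ac)
    then show ?thesis unfolding R_def mult_less_cancel_left_pos[OF r] .
  qed
  have iff: "mobm A \<in> ?V \<longleftrightarrow> R (adj B \<star> A \<star> B)" if A: "det2 A > 0" for A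
  proof -
    define N0 where "N0 = (1 / (det2 B * sqrt (det2 A))) *\<^sub>R (adj B \<star> A \<star> B)"
    have nz: "1 / (det2 B * sqrt (det2 A)) \<noteq> 0" using A B by simp
    have "det2 N0 = (1 / (det2 B * sqrt (det2 A)))\<^sup>2 * (det2 B * det2 A * det2 B)"
      unfolding N0_def by (simp only: det2_scaleR det2_mm det2_adj)
    then have N0: "det2 N0 = 1" using A B by (simp add: power_mult_distrib power_divide) (simp add: power2_eq_square)
    have cN0: "cmob B N0 = mobm A" unfolding N0_def by (rule cmob_adj_conj[OF B A nz])
    have RN0: "R N0 \<longleftrightarrow> R (adj B \<star> A \<star> B)" unfolding N0_def by (rule R_scale[OF nz])
    have "mobm A \<in> ?V \<longleftrightarrow> (\<exists>N. det2 N = 1 \<and> cmob B N = mobm A \<and> R N)"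
      by (simp add: R_def)
    also have "\<dots> \<longleftrightarrow> R N0"
    proof
      assume "\<exists>N. det2 N = 1 \<and> cmob B N = mobm A \<and> R N"
      then obtain N where N: "det2 N = 1" "cmob B N = mobm A" "R N" by blast
      then obtain r where "r \<noteq> 0" "N = r *\<^sub>R N0"
        using cmob_eq_iff[OF B, of N N0] N0 cN0 by auto
      then show "R N0" using N R_scale by simp
    qed (use N0 cN0 in blast)
    finally show ?thesis using RN0 by simp
  qed
  have "{A. det2 A > 0 \<and> mobm A \<in> ?V} = {A. det2 A > 0} \<inter> {A. R (adj B \<star> A \<star> B)}"
    using iff by blast
  moreover have "open {A. R (adj B \<star> A \<star> B)}"
    unfolding R_def by (intro open_Collect_conj open_Collect_less continuous_intros)
  ultimately show ?thesis unfolding open_mobius_iff using open_det2_pos by (simp add: open_Int)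
qed

text \<open>Bounding the ratio of the diagonal entries by \<open>exp (- 2 * (x + c))\<close> and
  \<open>exp (- 2 * (x - c))\<close> cuts out the parameters within \<open>c\<close> of
  \<open>x\<close>. With \<open>c\<close> the period of a cyclic group this isolates its
  elements.\<close>

lemma cmob_dg_neighbourhood:
  assumes B: "det2 B > 0" and c: "c > 0"
  obtains V where "open V" "cmob B (dg x) \<in> V" "\<And>y. cmob B (dg y) \<in> V \<Longrightarrow> \<bar>x - y\<bar> < c"
proof -
  define V where "V = {h. \<exists>N. det2 N = 1 \<and> cmob B N = h
    \<and> exp (- 2 * (x + c)) * (fst N)\<^sup>2 < fst N * snd (snd (snd N))
    \<and> fst N * snd (snd (snd N)) < exp (- 2 * (x - c)) * (fst N)\<^sup>2}"
  have ratio: "exp (- 2 * z) * (fst (dg y))\<^sup>2 = exp (2 * (y - z))" "fst (dg y) * snd (snd (snd (dg y))) = 1" for y z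
    by (simp_all add: dg_def power2_eq_square flip: exp_add)
  have "cmob B (dg y) \<in> V \<longleftrightarrow> \<bar>x - y\<bar> < c" for y
  proof -
    have "cmob B (dg y) \<in> V \<longleftrightarrow> exp (2 * (y - (x + c))) < 1 \<and> 1 < exp (2 * (y - (x - c)))"
    proof
      assume "cmob B (dg y) \<in> V"
      then obtain N where N: "det2 N = 1" "cmob B N = cmob B (dg y)"
        "exp (- 2 * (x + c)) * (fst N)\<^sup>2 < fst N * snd (snd (snd N))"
        "fst N * snd (snd (snd N)) < exp (- 2 * (x - c)) * (fst N)\<^sup>2" unfolding V_def by blast
      obtain r where r: "N = r *\<^sub>R dg y" using cmob_eq_iff[OF B, of N "dg y"] N by auto
      then have "r\<^sup>2 = 1" using N by simp
      then have eqs: "(fst N)\<^sup>2 = (fst (dg y))\<^sup>2" "fst N * snd (snd (snd N)) = fst (dg y) * snd (snd (snd (dg y)))"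
        unfolding r by (simp_all add: power_mult_distrib) (simp add: power2_eq_square algebra_simps)
      then show "exp (2 * (y - (x + c))) < 1 \<and> 1 < exp (2 * (y - (x - c)))"
        using N(3,4) by (simp only: eqs ratio)
    next
      assume "exp (2 * (y - (x + c))) < 1 \<and> 1 < exp (2 * (y - (x - c)))"
      then show "cmob B (dg y) \<in> V"
        unfolding V_def by (intro CollectI exI[of _ "dg y"]) (simp only: ratio det2_dg)
    qed
    also have "\<dots> \<longleftrightarrow> \<bar>x - y\<bar> < c" by auto
    finally show ?thesis .
  qed
  moreover have "open V" unfolding V_def by (rule open_cmob_ratio[OF B])
  ultimately show thesis using c by (intro that[of V]) simp_all
qed

section \<open>Semigroups mapping an interval into itself\<close>

lemma lifted_semigroup_lift:
  assumes "mobius_semigroup S" "\<not> elementary S" "1 islimpt S"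
  shows "lifted_semigroup {A. det2 A > 0 \<and> mobm A \<in> S}"
proof
  fix A B :: mat and r :: real
  assume A: "A \<in> {A. det2 A > 0 \<and> mobm A \<in> S}"
  then show "det2 A > 0" by simp
  show "r *\<^sub>R A \<in> {A. det2 A > 0 \<and> mobm A \<in> S}" if "r \<noteq> 0"
    using A that by (simp add: mobm_scaleR)
  show "A \<star> B \<in> {A. det2 A > 0 \<and> mobm A \<in> S}" if "B \<in> {A. det2 A > 0 \<and> mobm A \<in> S}"
    using A that assms(1) by (simp add: mobm_mm mobius_semigroup_def)
next
  fix Z assume "tr2 Z = 0" "Z \<noteq> 0"
  then show "\<exists>A\<in>{A. det2 A > 0 \<and> mobm A \<in> S}. \<forall>k. A \<star> Z \<star> adj A \<noteq> k *\<^sub>R Z"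
    using elementary_if_conj_eigenvector[of Z S] assms(2) by blast
next
  obtain f where f: "\<And>n. det2 (f n) = 1" "\<And>n::nat. mobm (f n) \<in> S" "\<And>n. f n \<noteq> one2" "f \<longlonglongrightarrow> one2"
    using islimpt_one_sequence[OF assms(3)] by blast
  then show "\<exists>f::nat \<Rightarrow> mat. (\<forall>n. f n \<in> {A. det2 A > 0 \<and> mobm A \<in> S} \<and> det2 (f n) = 1 \<and> f n \<noteq> one2) \<and> f \<longlonglongrightarrow> one2"
    by (intro exI[of _ f]) simp
qed

lemma nonneg2_scaleR: "r \<ge> 0 \<Longrightarrow> nonneg2 A \<Longrightarrow> nonneg2 (r *\<^sub>R A)"
  by (cases A rule: prod_cases4) simp

text \<open>Relative to \<open>B\<close>, each element of \<open>S\<close> has exactly one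
  nonnegative lift of determinant 1, so words in the generators of \<open>S\<close> lift to words in
  nonnegative matrices. Lifts close to \<open>one2\<close> have a positive first entry and therefore
  are these nonnegative lifts.\<close>

lemma compression_semigroup_generators:
  assumes S: "mobius_semigroup S" "finitely_generated S" and lim: "1 islimpt S"
    and B: "det2 B > 0"
    and compress: "\<forall>A. det2 A > 0 \<longrightarrow> mobm A \<in> S \<longrightarrow> nonneg2 (adj B \<star> A \<star> B) \<or> nonneg2 (- (adj B \<star> A \<star> B))"
  obtains G N where "finite G" "\<And>A. A \<in> G \<Longrightarrow> nonneg2 A" "\<And>A. A \<in> G \<Longrightarrow> det2 A = 1" "\<And>A. A \<in> G \<Longrightarrow> cmob B A \<in> S"
    "\<And>h. h \<in> S \<Longrightarrow> \<exists>A. nonneg2 A \<and> det2 A = 1 \<and> cmob B A = h"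
    "\<forall>\<^sub>F n in sequentially. N n \<in> products G \<and> N n \<noteq> one2" "N \<longlonglongrightarrow> one2"
    "\<And>n. cmob B (N n) \<in> S" "\<And>n. det2 (N n) = 1"
proof -
  have "\<exists>N. nonneg2 N \<and> det2 N = 1 \<and> cmob B N = h" if h: "h \<in> S" for h
  proof -
    obtain A where A: "det2 A = 1" "mobm A = h" by (rule mobm_surj)
    obtain \<sigma> :: real where \<sigma>: "\<sigma> = 1 \<or> \<sigma> = -1" "nonneg2 (\<sigma> *\<^sub>R (adj B \<star> A \<star> B))"
      using compress[rule_format, of A] A h by (metis scaleR_minus1_left scaleR_one zero_less_one)
    define N where "N = (\<sigma> / det2 B) *\<^sub>R (adj B \<star> A \<star> B)"
    have "N = (1 / det2 B) *\<^sub>R (\<sigma> *\<^sub>R (adj B \<star> A \<star> B))" by (simp add: N_def)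
    then have "nonneg2 N" using nonneg2_scaleR[OF _ \<sigma>(2), of "1 / det2 B"] B by (simp only: zero_le_divide_1_iff less_imp_le)
    moreover have "det2 N = 1"
      unfolding N_def det2_scaleR det2_mm det2_adj using A B \<sigma>(1)
      by (auto simp: power2_eq_square)
    moreover have "\<sigma> / det2 B \<noteq> 0" using \<sigma>(1) B by auto
    then have "cmob B N = h" unfolding N_def using cmob_adj_conj[OF B, of A "\<sigma> / det2 B"] A by simp
    ultimately show ?thesis by blast
  qed
  then obtain \<nu> where \<nu>: "\<And>h. h \<in> S \<Longrightarrow> nonneg2 (\<nu> h)" "\<And>h. h \<in> S \<Longrightarrow> det2 (\<nu> h) = 1"
    "\<And>h. h \<in> S \<Longrightarrow> cmob B (\<nu> h) = h" by metis
  obtain F where F: "finite F" "F \<subseteq> S"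
    "\<And>h. h \<in> S \<Longrightarrow> \<exists>hs. hs \<noteq> [] \<and> set hs \<subseteq> F \<and> h = prod_list hs"
    using S(2) unfolding finitely_generated_def by blast
  define G where "G = \<nu> ` F"
  have G: "nonneg2 A" "det2 A = 1" "cmob B A \<in> S" if "A \<in> G" for A
  proof -
    obtain h where "h \<in> S" "A = \<nu> h" using \<open>A \<in> G\<close> F(2) by (auto simp: G_def)
    then show "nonneg2 A" "det2 A = 1" "cmob B A \<in> S" using \<nu> by simp_all
  qed
  have words: "\<exists>N\<in>products G. nonneg2 N \<and> det2 N = 1 \<and> cmob B N = prod_list hs" if "set hs \<subseteq> F" for hs
    using that
  proof (induction hs)
    case Nil
    have "nonneg2 one2" by (simp add: one2_def)
    then show ?case using products.one cmob_one[OF B] by (intro bexI[of _ one2]) simp_all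
  next
    case (Cons h hs)
    then obtain N where N: "N \<in> products G" "nonneg2 N" "det2 N = 1" "cmob B N = prod_list hs" by auto
    have h: "h \<in> S" "\<nu> h \<in> G" using Cons.prems F(2) by (auto simp: G_def)
    have "\<nu> h \<star> N \<in> products G" using h N by (intro products.mult)
    moreover have "nonneg2 (\<nu> h \<star> N)" using \<nu>(1) h N by (intro nonneg2_mm)
    moreover have "det2 (\<nu> h \<star> N) = 1" using \<nu>(2) h N by simp
    moreover have "cmob B (\<nu> h \<star> N) = prod_list (h # hs)"
      using cmob_mm[OF B, of "\<nu> h" N] \<nu> h N by simp
    ultimately show ?case by blast
  qed
  have in_products: "A \<in> products G" if A: "nonneg2 A" "det2 A = 1" "cmob B A \<in> S" for A
  proof -
    obtain hs where hs: "set hs \<subseteq> F" "cmob B A = prod_list hs" using F(3)[OF A(3)] by blast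
    obtain N where N: "N \<in> products G" "nonneg2 N" "det2 N = 1" "cmob B N = prod_list hs"
      using words[OF hs(1)] by blast
    have "A = N" using A N hs by (intro nonneg2_unique[OF B]) auto
    then show ?thesis using N by simp
  qed
  obtain f where f: "\<And>n. det2 (f n) = 1" "\<And>n::nat. mobm (f n) \<in> S" "\<And>n. f n \<noteq> one2" "f \<longlonglongrightarrow> one2"
    using islimpt_one_sequence[OF lim] by blast
  define N where "N n = (1 / det2 B) *\<^sub>R (adj B \<star> f n \<star> B)" for n
  have "N \<longlonglongrightarrow> (1 / det2 B) *\<^sub>R (adj B \<star> one2 \<star> B)"
    unfolding N_def by (intro tendsto_intros f)
  then have N_lim: "N \<longlonglongrightarrow> one2" using B by (simp add: mm_adj)
  have nz: "1 / det2 B \<noteq> 0" using B by simp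
  have N_S: "cmob B (N n) \<in> S" for n
    unfolding N_def using cmob_adj_conj[OF B _ nz, of "f n"] f by simp
  have N_det: "det2 (N n) = 1" for n
    unfolding N_def det2_scaleR det2_mm det2_adj using f(1) B by (simp add: power2_eq_square)
  have N_nz: "N n \<noteq> one2" for n
  proof
    assume "N n = one2"
    then have "B \<star> N n \<star> adj B = det2 B *\<^sub>R one2" by (simp add: mm_adj)
    moreover have "B \<star> N n \<star> adj B = det2 B *\<^sub>R f n"
      using adj_conj_conj[of "adj B" "f n"] B by (simp add: N_def power2_eq_square)
    ultimately show False using f(3)[of n] B by simp
  qed
  have "(\<lambda>n. fst (N n)) \<longlonglongrightarrow> fst one2" by (intro tendsto_fst N_lim)
  then have "\<forall>\<^sub>F n in sequentially. fst (N n) > 0"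
    by (rule order_tendstoD) (simp add: one2_def)
  then have ev: "\<forall>\<^sub>F n in sequentially. N n \<in> products G \<and> N n \<noteq> one2"
  proof eventually_elim
    case (elim n)
    have "nonneg2 (N n) \<or> nonneg2 (- N n)"
    proof -
      have "nonneg2 (adj B \<star> f n \<star> B) \<or> nonneg2 (- (adj B \<star> f n \<star> B))"
        using compress[rule_format, of "f n"] f by simp
      moreover have "1 / det2 B \<ge> 0" using B by simp
      ultimately have "nonneg2 ((1 / det2 B) *\<^sub>R (adj B \<star> f n \<star> B)) \<or> nonneg2 ((1 / det2 B) *\<^sub>R (- (adj B \<star> f n \<star> B)))"
        using nonneg2_scaleR by blast
      then show ?thesis by (simp add: N_def)
    qed
    moreover have "\<not> nonneg2 (- N n)" using elim by (cases "N n" rule: prod_cases4) simp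
    ultimately show ?case using in_products N_det N_S N_nz by blast
  qed
  show thesis
  proof (rule that[of G N])
    show "finite G" using F by (simp add: G_def)
    show "\<exists>A. nonneg2 A \<and> det2 A = 1 \<and> cmob B A = h" if "h \<in> S" for h using \<nu> that by blast
  qed (fact G ev N_lim N_S N_det)+
qed

text \<open>The part of \<open>S\<close> stabilising the interval is the cyclic group generated by
  \<open>cmob B (dg c)\<close>. The triangular matrix \<open>A\<close> has a coordinate axis as
  eigenline, so it fixes an end point.\<close>

lemma exceptional_if_discrete:
  assumes B: "det2 B > 0" and S: "S \<subseteq> Mob (mat_interval B)"
    and c: "c > 0" and \<Sigma>: "{x. cmob B (dg x) \<in> S} = range (\<lambda>i::int. of_int i * c)"
    and A: "nonneg2 A" "det2 A = 1" "cmob B A \<in> S" "A = (a, b, b', d)" "(b = 0) \<noteq> (b' = 0)"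
  shows "exceptional S"
proof -
  define J where "J = mat_interval B"
  define H where "H = S \<inter> Mob0 J"
  have H: "H = (\<lambda>i::int. cmob B (dg (of_int i * c))) ` UNIV"
  proof -
    have "H = (\<lambda>x. cmob B (dg x)) ` {x. cmob B (dg x) \<in> S}"
      unfolding H_def J_def Mob0_mat_interval[OF B] by blast
    then show ?thesis unfolding \<Sigma> by (simp add: image_image)
  qed
  have mem: "cmob B (dg (of_int i * c)) \<in> H" for i :: int unfolding H by blast
  have one: "1 \<in> H" using mem[of 0] cmob_one[OF B] by simp
  have "subgroup H mobius_group"
  proof
    show "H \<subseteq> carrier mobius_group" by (simp add: mobius_group_def)
    show "\<one>\<^bsub>mobius_group\<^esub> \<in> H" using one by (simp add: mobius_group_def)
    fix g assume "g \<in> H"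
    then obtain i :: int where g: "g = cmob B (dg (of_int i * c))" unfolding H by blast
    have "cmob B (dg (- (of_int i * c))) * g = 1" unfolding g by (rule cmob_dg_minus[OF B])
    then have "inv\<^bsub>mobius_group\<^esub> g = cmob B (dg (- (of_int i * c)))"
      by (intro group.inv_equality[OF group_mobius_group]) (simp_all add: mobius_group_def)
    then show "inv\<^bsub>mobius_group\<^esub> g \<in> H" using mem[of "- i"] by simp
    fix h assume "h \<in> H"
    then obtain j :: int where h: "h = cmob B (dg (of_int j * c))" unfolding H by blast
    have "g * h = cmob B (dg (of_int (i + j) * c))"
      unfolding g h by (simp add: distrib_right cmob_dg_add[OF B])
    then show "g \<otimes>\<^bsub>mobius_group\<^esub> h \<in> H" using mem[of "i + j"] by (simp add: mobius_group_def)
  qed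
  moreover have "H \<noteq> {1}"
  proof
    assume "H = {1}"
    then have "cmob B (dg c) = cmob B (dg 0)" using mem[of 1] cmob_one[OF B] by simp
    then show False using c cmob_dg_eq_iff[OF B, of c 0] by simp
  qed
  moreover have "discrete H"
  proof (rule discreteI)
    fix g assume g: "g \<in> H"
    then obtain i :: int where i: "g = cmob B (dg (of_int i * c))" unfolding H by blast
    obtain V where V: "open V" "g \<in> V" "\<And>y. cmob B (dg y) \<in> V \<Longrightarrow> \<bar>of_int i * c - y\<bar> < c"
      using cmob_dg_neighbourhood[OF B c, of "of_int i * c"] i by metis
    have "V \<inter> H = {g}"
    proof
      show "V \<inter> H \<subseteq> {g}"
      proof
        fix h assume h: "h \<in> V \<inter> H"
        then obtain j :: int where j: "h = cmob B (dg (of_int j * c))" unfolding H by blast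
        have "\<bar>of_int i * c - of_int j * c\<bar> < c" using V(3) h j by simp
        then have "\<bar>real_of_int (i - j)\<bar> * c < 1 * c"
          using c by (simp add: abs_mult flip: left_diff_distrib)
        then have "\<bar>real_of_int (i - j)\<bar> < 1" using c by (simp only: mult_less_cancel_right_pos)
        then have "i = j" by linarith
        then show "h \<in> {g}" by (simp add: i j)
      qed
    qed (use V g in auto)
    then show "g isolated_in H" using V(1) g unfolding isolated_in_def by blast
  qed
  moreover have "cmob B A \<in> S - Mob0 J"
  proof -
    have "cmob B A \<noteq> cmob B (dg x)" for x
    proof
      assume "cmob B A = cmob B (dg x)"
      then obtain r where "A = r *\<^sub>R dg x" using cmob_eq_iff[OF B, of A "dg x"] A by auto
      then show False using A(4,5) by (simp add: dg_def)
    qed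
    then show ?thesis using A(3) unfolding J_def Mob0_mat_interval[OF B] by blast
  qed
  moreover have "act (cmob B A) (embed (pt (app B (0, 1)))) = embed (pt (app B (0, 1))) \<or>
      act (cmob B A) (embed (pt (app B (1, 0)))) = embed (pt (app B (1, 0)))"
  proof (cases "b = 0")
    case True
    then have "app A (0, 1) = d *\<^sub>R (0, 1)" "d \<noteq> 0" using A by auto
    then show ?thesis
      using act_cmob[OF B, of A "(0, 1)"] A(2) pt_scaleR[of d "app B (0, 1)"]
      by (simp only: app_scaleR_right) (simp add: zero_prod_def)
  next
    case False
    then have "app A (1, 0) = a *\<^sub>R (1, 0)" "a \<noteq> 0" using A by auto
    then show ?thesis
      using act_cmob[OF B, of A "(1, 0)"] A(2) pt_scaleR[of a "app B (1, 0)"]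
      by (simp only: app_scaleR_right) (simp add: zero_prod_def)
  qed
  ultimately show ?thesis
    unfolding exceptional_def H_def
    using closed_interval_mat_interval[OF B] S unfolding J_def by blast
qed

lemma compression_semigroup_cases:
  assumes S: "mobius_semigroup S" "finitely_generated S" and lim: "1 islimpt S"
    and B: "det2 B > 0"
    and compress: "\<forall>A. det2 A > 0 \<longrightarrow> mobm A \<in> S \<longrightarrow> nonneg2 (adj B \<star> A \<star> B) \<or> nonneg2 (- (adj B \<star> A \<star> B))"
  shows "S \<subseteq> Mob (mat_interval B)"
    and "exceptional S \<or> Mob0 (mat_interval B) \<subseteq> closure (S \<inter> Mob0 (mat_interval B))"
proof -
  obtain G N where fin: "finite G" and G: "\<And>A. A \<in> G \<Longrightarrow> nonneg2 A" "\<And>A. A \<in> G \<Longrightarrow> det2 A = 1" "\<And>A. A \<in> G \<Longrightarrow> cmob B A \<in> S"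
    and repr: "\<And>h. h \<in> S \<Longrightarrow> \<exists>A. nonneg2 A \<and> det2 A = 1 \<and> cmob B A = h"
    and ev: "\<forall>\<^sub>F n in sequentially. N n \<in> products G \<and> N n \<noteq> one2" and N_lim: "N \<longlonglongrightarrow> one2"
    and N: "\<And>n. cmob B (N n) \<in> S" "\<And>n. det2 (N n) = 1"
    by (rule compression_semigroup_generators[OF S lim B compress]) (rule that; assumption)
  show sub: "S \<subseteq> Mob (mat_interval B)"
  proof
    fix h assume "h \<in> S"
    then obtain A where "nonneg2 A" "det2 A = 1" "cmob B A = h" using repr by blast
    then show "h \<in> Mob (mat_interval B)" using cmob_in_MobI[OF B, of A] by simp
  qed
  define \<Sigma> where "\<Sigma> = {x. cmob B (dg x) \<in> S}"
  have diag: "ln a \<in> \<Sigma>" "a > 0" if "(a, 0, 0, d) \<in> G" for a d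
  proof -
    have "a \<ge> 0" "a * d = 1" using G(1,2)[OF that] by simp_all
    then show "a > 0" by (cases "a = 0") auto
    then have "cmob B (dg (ln a)) \<in> S" using diagonal_eq_dg[OF \<open>a * d = 1\<close>] G(3)[OF that] by simp
    then show "ln a \<in> \<Sigma>" by (simp add: \<Sigma>_def)
  qed
  obtain a1 d1 where 1: "(a1, 0, 0, d1) \<in> G" "a1 < 1"
    using contracting_generator_exists[OF fin G(1,2) ev N_lim] by blast
  obtain a2 d2 where 2: "(a2, 0, 0, d2) \<in> G" "a2 > 1"
    using expanding_generator_exists[OF fin G(1,2) ev N_lim] by blast
  have "closure \<Sigma> = UNIV \<or> (\<exists>c>0. \<Sigma> = range (\<lambda>i::int. of_int i * c))"
  proof (rule additive_semigroup_dichotomy)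
    show "x + y \<in> \<Sigma>" if "x \<in> \<Sigma>" "y \<in> \<Sigma>" for x y
      using that S(1) by (simp add: \<Sigma>_def mobius_semigroup_def cmob_dg_add[OF B])
    show "ln a2 \<in> \<Sigma>" "ln a2 > 0" "ln a1 \<in> \<Sigma>" "ln a1 < 0" using diag 1 2 by auto
  qed
  then consider (dense) "closure \<Sigma> = UNIV" | (discrete) c where "c > 0" "\<Sigma> = range (\<lambda>i::int. of_int i * c)"
    by blast
  then show "exceptional S \<or> Mob0 (mat_interval B) \<subseteq> closure (S \<inter> Mob0 (mat_interval B))"
  proof cases
    case dense
    have "cmob B (dg x) \<in> closure (S \<inter> Mob0 (mat_interval B))" for x
    proof -
      have "x \<in> closure \<Sigma>" using dense by simp
      then obtain f where f: "\<And>n::nat. f n \<in> \<Sigma>" "f \<longlonglongrightarrow> x" unfolding closure_sequential by blast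
      have "cmob B (dg (f n)) \<in> S \<inter> Mob0 (mat_interval B)" for n
        using f(1)[of n] by (simp add: \<Sigma>_def Mob0_mat_interval[OF B])
      then have "cmob B (dg (f n)) \<in> closure (S \<inter> Mob0 (mat_interval B))" for n
        using closure_subset by blast
      then show ?thesis
        using tendsto_cmob_dg[OF B f(2)]
        by (intro Lim_in_closed_set[OF closed_closure, of "\<lambda>n. cmob B (dg (f n))" _ sequentially]) auto
    qed
    then show ?thesis unfolding Mob0_mat_interval[OF B] by blast
  next
    case (discrete c)
    have "\<exists>a b b' d. (a, b, b', d) \<in> G \<and> (b = 0) \<noteq> (b' = 0)"
    proof (rule ccontr)
      assume "\<not> ?thesis"
      then have full: "\<And>a b c d. (a, b, c, d) \<in> G \<Longrightarrow> b = 0 \<and> c = 0 \<or> b \<noteq> 0 \<and> c \<noteq> 0" by blast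
      \<comment> \<open>Words close to \<open>one2\<close> are then diagonal, with parameter a
        multiple of \<open>c\<close> strictly between \<open>- c\<close> and \<open>c\<close>; so
        they equal \<open>one2\<close>, which \<open>N n\<close> avoids.\<close>
      have "\<exists>\<eta>>0. \<forall>a b c d. (a, b, c, d) \<in> products G \<longrightarrow> b = 0 \<and> c = 0 \<or> b * c \<ge> \<eta>"
        by (rule products_diagonal_or_separated[OF fin]; fact)
      then obtain \<eta> :: real where \<eta>: "\<eta> > 0"
        "\<forall>a b c d. (a, b, c, d) \<in> products G \<longrightarrow> b = 0 \<and> c = 0 \<or> b * c \<ge> \<eta>" by blast
      have "(\<lambda>n. fst (snd (N n)) * fst (snd (snd (N n)))) \<longlonglongrightarrow> fst (snd one2) * fst (snd (snd one2))"
        by (intro tendsto_intros N_lim)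
      then have "\<forall>\<^sub>F n in sequentially. fst (snd (N n)) * fst (snd (snd (N n))) < \<eta>"
        by (rule order_tendstoD) (use \<eta> in \<open>simp add: one2_def\<close>)
      moreover have fst_lim: "(\<lambda>n. fst (N n)) \<longlonglongrightarrow> 1"
        using tendsto_fst[OF N_lim] by (simp add: one2_def)
      then have "\<forall>\<^sub>F n in sequentially. fst (N n) < exp c" "\<forall>\<^sub>F n in sequentially. exp (- c) < fst (N n)"
        using discrete(1) by (auto intro: order_tendstoD)
      ultimately have "\<forall>\<^sub>F n in sequentially. False" using ev
      proof eventually_elim
        case (elim n)
        obtain a b b' d where Nn: "N n = (a, b, b', d)" by (cases "N n" rule: prod_cases4)
        have b: "b = 0" "b' = 0" using elim \<eta>(2)[rule_format, of a b b' d] by (auto simp: Nn)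
        have a: "exp (- c) < a" "a < exp c" using elim by (simp_all add: Nn)
        then have "a > 0" by (meson exp_gt_zero less_trans)
        have "a * d = 1" using N(2)[of n] by (simp add: Nn b)
        then have Na: "N n = dg (ln a)" using diagonal_eq_dg \<open>a > 0\<close> by (simp add: Nn b)
        then have "ln a \<in> \<Sigma>" using N(1)[of n] by (simp add: \<Sigma>_def)
        then obtain i :: int where i: "ln a = of_int i * c" unfolding discrete(2) by blast
        have "- c < ln a" "ln a < c"
          using a \<open>a > 0\<close> by (metis exp_less_cancel_iff exp_ln)+
        then have "(-1) * c < real_of_int i * c" "real_of_int i * c < 1 * c" using i by simp_all
        then have "-1 < real_of_int i" "real_of_int i < 1"
          using discrete(1) by (simp_all only: mult_less_cancel_right_pos)
        then have "i = 0" by linarith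
        then have "N n = one2" using Na i by simp
        then show False using elim by simp
      qed
      then show False by simp
    qed
    then obtain a b b' d where A: "(a, b, b', d) \<in> G" "(b = 0) \<noteq> (b' = 0)" by blast
    have "exceptional S"
      by (rule exceptional_if_discrete[OF B sub discrete(1) discrete(2)[unfolded \<Sigma>_def] G(1)[OF A(1)] G(2)[OF A(1)] G(3)[OF A(1)] refl A(2)])
    then show ?thesis ..
  qed
qed

theorem theorem14p1:
  fixes S :: "mobius set"
  assumes "mobius_semigroup S" and "finitely_generated S"
  shows "elementary S \<or>
         semidiscrete S \<or>
         (\<exists>J. closed_interval J \<and> S \<subseteq> Mob J \<and>
              (exceptional S \<or> Mob0 J \<subseteq> closure (S \<inter> Mob0 J))) \<or>
         closure S = UNIV"
proof (cases "elementary S \<or> semidiscrete S")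
  case False
  then have lim: "1 islimpt S" by (simp add: semidiscrete_def)
  interpret lifted_semigroup "{A. det2 A > 0 \<and> mobm A \<in> S}"
    using lifted_semigroup_lift assms(1) False lim by blast
  show ?thesis
  proof (rule dense_or_invariant_cone)
    assume "{A. det2 A > 0} \<subseteq> closure {A. det2 A > 0 \<and> mobm A \<in> S}"
    then show ?thesis using closure_eq_UNIV_if_lift_dense by blast
  next
    fix B assume B: "det2 B > 0" and inv_cone: "\<And>A. A \<in> {A. det2 A > 0 \<and> mobm A \<in> S} \<Longrightarrow>
      nonneg2 (adj B \<star> A \<star> B) \<or> nonneg2 (- (adj B \<star> A \<star> B))"
    have compress: "\<forall>A. det2 A > 0 \<longrightarrow> mobm A \<in> S \<longrightarrow> nonneg2 (adj B \<star> A \<star> B) \<or> nonneg2 (- (adj B \<star> A \<star> B))"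
      using inv_cone by blast
    have "closed_interval (mat_interval B)"
      using closed_interval_mat_interval[OF B] unfolding closed_interval_def by blast
    then show ?thesis using compression_semigroup_cases[OF assms lim B compress] by blast
  qed
qed blast

end
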